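(* Let $q$ be an odd prime power, let $c\in\mathbb{F}_q^\ast$ be a non-square, and choose a generator $\delta$ of the cyclic group $\mathbb{F}_{q^2}^\ast$. Let $\tau\neq 1$ be an element of $\mathbb{F}_q^\ast$, and let $\zeta\in\mathbb{F}_{q^2}^\ast$ be an element with norm $\zeta^{1+q}=(\tau-1)/\tau$. Let $G$ be the algebraic group over $\mathbb{F}_q[t]$ of units of the order $\mathfrak{O}$ modulo the center (defined in the context). Then the irreducible arithmetic lattice $G\big(\mathbb{F}_q[t,\tfrac{1}{t(t-\tau)}]\big)$ has the following presentation: $$G\big(\mathbb{F}_q[t,\tfrac{1}{t(t-\tau)}]\big)\ \simeq\ \left\langle\, d,a,b \ \left|\ \begin{array}{c} d^{q+1}=a^2=b^2=1,\\ (d^i a d^{-i})(d^j b d^{-j})=(d^l b d^{-l})(d^k a d^{-k})\\ \text{for all } 0\le i,l\le q \text{ and } j,k \text{ determined by } (\star)\end{array}\right.\right\rangle,$$ where $(\star)$ is the system of equations in the quotient group $\mathbb{F}_{q^2}^\ast/\mathbb{F}_q^\ast$ $$\delta^{j-l}=\big(1-\zeta\,\delta^{(i-l)(1-q)}\big)\cdot\delta^{(q+1)/2}\quad\text{and}\quad \delta^{k-i}=\Big(1-\frac{1}{\zeta\,\delta^{(i-l)(1-q)}}\Big)\cdot\delta^{(q+1)/2}.$$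
   Context: With non-commuting variables $Z,F$ set $\mathfrak{O}=\mathbb{F}_q[t]\{Z,F\}/(Z^2=c,\ F^2=t(t-1),\ ZF=-FZ)$, an $\mathbb{F}_q[t]$-order in the quaternion algebra $D=\mathfrak{O}\otimes\mathbb{F}_q(t)$ over $\mathbb{F}_q(t)$ (ramified exactly at $t=0,1$). $G=\mathrm{PGL}_{1,\mathfrak{O}}$ is the algebraic group over $\mathbb{F}_q[t]$ of units of $\mathfrak{O}$ modulo the center. For the principal ideal domain $R'=\mathbb{F}_q[t,\frac{1}{t(t-\tau)}]$ one has $G(R')=(\mathfrak{O}\otimes_{\mathbb{F}_q[t]}R')^\ast/R'^\ast$. It is considered as a lattice in $G(K_\tau)\times G(K_\infty)$, where $K_\tau$, $K_\infty$ are the completions of $\mathbb{F}_q(t)$ at $t=\tau$ and $t=\infty$; both factors are isomorphic to $\mathrm{PGL}_2$ of a Laurent series field over $\mathbb{F}_q$. Since $d^{q+1}=1$, the exponents $j,k$ matter only modulo $q+1$, and $\delta$ has order $q+1$ in $\mathbb{F}_{q^2}^\ast/\mathbb{F}_q^\ast$. *)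

theory Defs
  imports
    "HOL-Algebra.Algebraic_Closure_Type"
    "HOL-Library.Poly_Mapping"
    "HOL-Library.Cardinality"
    "HOL-Computational_Algebra.Polynomial_Factorial"
begin

section \<open>Groups given by generators and relations\<close>

text \<open>
  Words are lists of letters \<open>(x, True)\<close>, standing for the generator \<open>x\<close>, and \<open>(x, False)\<close>,
  standing for its inverse. A relation \<open>l = r\<close> is a pair of words. The generators of the
  presented group are all elements of the type \<open>'g\<close>.
\<close>

type_synonym 'g gword = "('g \<times> bool) list"

inductive pres_eq :: "('g gword \<times> 'g gword) set \<Rightarrow> 'g gword \<Rightarrow> 'g gword \<Rightarrow> bool"
  for Rels where
  pres_refl: "pres_eq Rels u u"
| pres_sym: "pres_eq Rels u v \<Longrightarrow> pres_eq Rels v u"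
| pres_trans: "pres_eq Rels u v \<Longrightarrow> pres_eq Rels v w \<Longrightarrow> pres_eq Rels u w"
| pres_cancel: "pres_eq Rels (u @ [(x, s), (x, \<not> s)] @ v) (u @ v)"
| pres_rel: "(l, r) \<in> Rels \<Longrightarrow> pres_eq Rels (u @ l @ v) (u @ r @ v)"

definition pres_rel_set :: "('g gword \<times> 'g gword) set \<Rightarrow> ('g gword \<times> 'g gword) set" where
  "pres_rel_set Rels = {(u, v). pres_eq Rels u v}"

definition presented_group :: "('g gword \<times> 'g gword) set \<Rightarrow> 'g gword set monoid" where
  "presented_group Rels =
    \<lparr> carrier = UNIV // pres_rel_set Rels,
      monoid.mult = (\<lambda>P Q. \<Union>u\<in>P. \<Union>v\<in>Q. pres_rel_set Rels `` {u @ v}),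
      monoid.one = pres_rel_set Rels `` {[]} \<rparr>"


section \<open>Free associative algebras\<close>

datatype 'g free_mon = FM "'g list"

text \<open>
  The free monoid on \<open>'g\<close>, written additively because \<^type>\<open>poly_mapping\<close> forms monoid algebras
  over additive monoids: the convolution ring \<open>'g free_mon \<Rightarrow>\<^sub>0 'k\<close> is the free associative
  \<open>'k\<close>-algebra on \<open>'g\<close>.
\<close>

instantiation free_mon :: (type) monoid_add
begin

definition zero_free_mon :: "'a free_mon" where
  "zero_free_mon = FM []"

fun plus_free_mon :: "'a free_mon \<Rightarrow> 'a free_mon \<Rightarrow> 'a free_mon" where
  "plus_free_mon (FM u) (FM v) = FM (u @ v)"

instance
proof
  fix a b c :: "'a free_mon"
  show "a + b + c = a + (b + c)" by (cases a; cases b; cases c) simp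
  show "0 + a = a" by (cases a) (simp add: zero_free_mon_def)
  show "a + 0 = a" by (cases a) (simp add: zero_free_mon_def)
qed

end

type_synonym ('g, 'k) free_alg = "'g free_mon \<Rightarrow>\<^sub>0 'k"

definition scalar :: "'k::ring_1 \<Rightarrow> ('g, 'k) free_alg" where
  "scalar a = Poly_Mapping.single 0 a"

definition indet :: "'g \<Rightarrow> ('g, 'k::ring_1) free_alg" where
  "indet x = Poly_Mapping.single (FM [x]) 1"

text \<open>The free algebra over a subring \<open>A\<close> of \<open>'k\<close>.\<close>

definition free_alg_over :: "'k::comm_ring_1 set \<Rightarrow> ('g, 'k) free_alg ring" where
  "free_alg_over A =
    ring_of_type_algebra \<lparr> carrier := {f. \<forall>w. Poly_Mapping.lookup f w \<in> A} \<rparr>"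


section \<open>The quaternion order and its projective unit group\<close>

text \<open>
  Coefficient rings are subrings of \<open>\<bbbF>\<^sub>q(t)\<close>, which is \<open>'a poly fract\<close> with \<open>t = [:0, 1:]\<close>.
  The ring \<open>\<bbbF>\<^sub>q[t]\<close> is \<open>range to_fract\<close>, and \<open>poly_inverting f\<close> is \<open>\<bbbF>\<^sub>q[t, 1/f]\<close>.
\<close>

definition poly_inverting :: "'a::field poly \<Rightarrow> 'a poly fract set" where
  "poly_inverting f = {to_fract p / to_fract f ^ n | p n. True}"

datatype quat_gen = GenZ | GenF

definition quat_relators :: "'a::field \<Rightarrow> (quat_gen, 'a poly fract) free_alg set" where
  "quat_relators c =
    { indet GenZ * indet GenZ - scalar (to_fract [:c:]),
      indet GenF * indet GenF - scalar (to_fract ([:0, 1:] * [:-1, 1:])),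
      indet GenZ * indet GenF - (- (indet GenF * indet GenZ)) }"

definition quat_ideal ::
    "'a::field \<Rightarrow> 'a poly fract set \<Rightarrow> (quat_gen, 'a poly fract) free_alg set" where
  "quat_ideal c A = genideal (free_alg_over A) (quat_relators c)"

text \<open>
  For \<open>\<bbbF>\<^sub>q[t] \<subseteq> A\<close>, \<open>quat_order c A\<close> is \<open>A{Z, F}/(Z\<^sup>2 = c, F\<^sup>2 = t(t-1), ZF = -FZ)\<close>. For
  \<open>A = \<bbbF>\<^sub>q[t]\<close> this is the order itself. In general it is the tensor product of the order with
  \<open>A\<close> over \<open>\<bbbF>\<^sub>q[t]\<close>, since extension of scalars of an algebra given by generators and
  relations keeps the generators and relations.
\<close>

definition quat_order ::
    "'a::field \<Rightarrow> 'a poly fract set \<Rightarrow> (quat_gen, 'a poly fract) free_alg set ring" where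
  "quat_order c A = free_alg_over A Quot quat_ideal c A"

definition quat_scalar ::
    "'a::field \<Rightarrow> 'a poly fract set \<Rightarrow> 'a poly fract \<Rightarrow> (quat_gen, 'a poly fract) free_alg set"
  where "quat_scalar c A a = quat_ideal c A +>\<^bsub>free_alg_over A\<^esub> scalar a"

text \<open>
  The group of units of the order over \<open>A\<close> modulo the units of \<open>A\<close>. These are the \<open>A\<close>-points
  of the units of the order modulo the center when \<open>A\<close> is a principal ideal domain.
\<close>

definition PGL1_order ::
    "'a::field \<Rightarrow> 'a poly fract set \<Rightarrow> (quat_gen, 'a poly fract) free_alg set set monoid" where
  "PGL1_order c A =
    units_of (quat_order c A) Mod
      (quat_scalar c A ` Units (ring_of_type_algebra \<lparr> carrier := A \<rparr>))"


section \<open>The presentation\<close>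

text \<open>
  Equality of the classes of \<open>x\<close> and \<open>y\<close> in the quotient of the multiplicative group of a field by
  that of a subfield, the subfield being the image of the embedding \<open>\<iota>\<close>.
\<close>

definition eq_mod_subfield :: "('a::field \<Rightarrow> 'b::field) \<Rightarrow> 'b \<Rightarrow> 'b \<Rightarrow> bool" where
  "eq_mod_subfield \<iota> x y \<longleftrightarrow> x \<noteq> 0 \<and> y \<noteq> 0 \<and> (\<exists>u. u \<noteq> 0 \<and> x = \<iota> u * y)"

definition star_system ::
    "('a::field \<Rightarrow> 'b::field) \<Rightarrow> nat \<Rightarrow> 'b \<Rightarrow> 'b \<Rightarrow> nat \<Rightarrow> nat \<Rightarrow> nat \<Rightarrow> nat \<Rightarrow> bool" where
  "star_system \<iota> q \<delta> \<zeta> i l j k \<longleftrightarrow>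
    eq_mod_subfield \<iota> (\<delta> powi (int j - int l))
      ((1 - \<zeta> * \<delta> powi ((int i - int l) * (1 - int q))) * \<delta> ^ ((q + 1) div 2)) \<and>
    eq_mod_subfield \<iota> (\<delta> powi (int k - int i))
      ((1 - 1 / (\<zeta> * \<delta> powi ((int i - int l) * (1 - int q)))) * \<delta> ^ ((q + 1) div 2))"

datatype lattice_gen = GenD | GenA | GenB

definition conj_d :: "nat \<Rightarrow> lattice_gen \<Rightarrow> lattice_gen gword" where
  "conj_d n x = replicate n (GenD, True) @ [(x, True)] @ replicate n (GenD, False)"

text \<open>
  The exponents \<open>j\<close>, \<open>k\<close> are determined by the system only modulo \<open>q + 1\<close>; their
  representatives are taken between \<open>0\<close> and \<open>q\<close>.
\<close>

definition lattice_rels ::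
    "('a::field \<Rightarrow> 'b::field) \<Rightarrow> nat \<Rightarrow> 'b \<Rightarrow> 'b \<Rightarrow> (lattice_gen gword \<times> lattice_gen gword) set"
  where
  "lattice_rels \<iota> q \<delta> \<zeta> =
    { (replicate (q + 1) (GenD, True), []),
      ([(GenA, True), (GenA, True)], []),
      ([(GenB, True), (GenB, True)], []) } \<union>
    { (conj_d i GenA @ conj_d j GenB, conj_d l GenB @ conj_d k GenA) | i j k l.
        i \<le> q \<and> l \<le> q \<and> j \<le> q \<and> k \<le> q \<and> star_system \<iota> q \<delta> \<zeta> i l j k }"

end

theory Submission
  imports Defs
begin

text \<open>
  Put \<open>x = (t - 1) / t\<close> and \<open>F = t F'\<close>, so that \<open>F'\<^sup>2 = x\<close>. Over \<open>\<bbbF>\<^sub>q[t, 1/(t(t-\<tau>))]\<close>, which is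
  \<open>\<bbbF>\<^sub>q[x, 1/((x-1)(x-\<kappa>))]\<close> with \<open>\<kappa> = (\<tau>-1)/\<tau>\<close> the norm of \<open>\<zeta>\<close>, the order becomes a
  localisation of the ring of skew polynomials in \<open>F'\<close> over the field with \<open>q\<^sup>2\<close> elements. Let
  \<open>d\<close>, \<open>a\<close>, \<open>b\<close> be the classes of \<open>\<delta>\<close>, \<open>Z(1 + F')\<close> and \<open>Z(1 + \<zeta>\<^sup>-\<^sup>1F')\<close>; the last two have
  norms proportional to \<open>x - 1\<close> and \<open>x - \<kappa>\<close>, and their conjugates by powers of \<open>d\<close> are, up to
  constants, all linear skew polynomials of these norms. The system of equations of the presentation
  describes when two products of two such linear factors coincide.

  Generation: if the norm of a skew polynomial vanishes at \<open>x = 1\<close> or \<open>x = \<kappa>\<close>, then a linear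
  factor of that norm, or the central polynomial \<open>x - 1\<close> or \<open>x - \<kappa>\<close> itself, splits off on the left.
  A skew polynomial of constant norm is constant, since the two terms of the norm
  \<open>X \<sigma>(X) - x Y \<sigma>(Y)\<close> of \<open>X + Y F'\<close> have degrees of different parity.

  Faithfulness: the relations bring every word into the form of a product of conjugates of \<open>a\<close>,
  then of conjugates of \<open>b\<close>, then a power of \<open>d\<close>, with no two equal neighbours. At \<open>x = 1\<close> (or
  \<open>x = \<kappa>\<close>) the conjugates of \<open>a\<close> (or \<open>b\<close>) become matrices of rank one whose reduced products do
  not vanish, while the other factors remain invertible. A scalar of vanishing norm vanishes, so a
  word whose image is scalar contains no conjugates of \<open>a\<close> or \<open>b\<close>.
\<close>

section \<open>Two by two matrices\<close>

text \<open>A type of fixed size is an instance of \<open>ring_1\<close> over every commutative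
  ring, and \<open>map_mat2\<close> carries matrices between polynomials, rational functions and the
  finite field.\<close>

datatype 'r mat2 = Mat2 (m11: 'r) (m12: 'r) (m21: 'r) (m22: 'r)

instantiation mat2 :: (comm_ring_1) ring_1
begin

definition zero_mat2 :: "'a mat2" where "zero_mat2 = Mat2 0 0 0 0"
definition one_mat2 :: "'a mat2" where "one_mat2 = Mat2 1 0 0 1"

fun plus_mat2 :: "'a mat2 \<Rightarrow> 'a mat2 \<Rightarrow> 'a mat2" where
  "plus_mat2 (Mat2 a b c d) (Mat2 a' b' c' d') = Mat2 (a + a') (b + b') (c + c') (d + d')"

fun minus_mat2 :: "'a mat2 \<Rightarrow> 'a mat2 \<Rightarrow> 'a mat2" where
  "minus_mat2 (Mat2 a b c d) (Mat2 a' b' c' d') = Mat2 (a - a') (b - b') (c - c') (d - d')"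

fun uminus_mat2 :: "'a mat2 \<Rightarrow> 'a mat2" where
  "uminus_mat2 (Mat2 a b c d) = Mat2 (- a) (- b) (- c) (- d)"

fun times_mat2 :: "'a mat2 \<Rightarrow> 'a mat2 \<Rightarrow> 'a mat2" where
  "times_mat2 (Mat2 a b c d) (Mat2 a' b' c' d') =
    Mat2 (a * a' + b * c') (a * b' + b * d') (c * a' + d * c') (c * b' + d * d')"

instance
proof
  fix x y w :: "'a mat2"
  show "x + y + w = x + (y + w)" by (cases x; cases y; cases w) (simp add: algebra_simps)
  show "x + y = y + x" by (cases x; cases y) (simp add: algebra_simps)
  show "0 + x = x" by (cases x) (simp add: zero_mat2_def)
  show "- x + x = 0" by (cases x) (simp add: zero_mat2_def)
  show "x - y = x + - y" by (cases x; cases y) simp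
  show "x * y * w = x * (y * w)" by (cases x; cases y; cases w) (simp add: algebra_simps)
  show "(x + y) * w = x * w + y * w" by (cases x; cases y; cases w) (simp add: algebra_simps)
  show "x * (y + w) = x * y + x * w" by (cases x; cases y; cases w) (simp add: algebra_simps)
  show "1 * x = x" by (cases x) (simp add: one_mat2_def)
  show "x * 1 = x" by (cases x) (simp add: one_mat2_def)
  show "(0 :: 'a mat2) \<noteq> 1" by (simp add: zero_mat2_def one_mat2_def)
qed

end

definition scal :: "'r::comm_ring_1 \<Rightarrow> 'r mat2" where "scal a = Mat2 a 0 0 a"

lemma scal_simps:
  "scal a * Mat2 e f g h = Mat2 (a * e) (a * f) (a * g) (a * h)"
  "scal 1 = 1" "scal 0 = 0" "scal (a * b) = scal a * scal b" "scal (a + b) = scal a + scal b"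
  by (simp_all add: scal_def one_mat2_def zero_mat2_def)

lemma scal_commute: "scal a * M = M * scal a"
  by (cases M) (simp add: scal_def mult.commute)

lemma scal_left_commute: "N * (scal a * M) = scal a * (N * M)"
  by (metis mult.assoc scal_commute)

lemma scal_mult_cancel:
  fixes a :: "'r::idom"
  assumes "scal a * M = scal a * N" "a \<noteq> 0"
  shows "M = N"
  using assms by (cases M; cases N) (simp add: scal_simps)

fun det2 :: "'r::comm_ring_1 mat2 \<Rightarrow> 'r" where
  "det2 (Mat2 a b c d) = a * d - b * c"

lemma det2_mult: "det2 (M * N) = det2 M * det2 N"
  by (cases M; cases N) (simp add: algebra_simps)

lemma det2_scal [simp]: "det2 (scal a) = a * a"
  by (simp add: scal_def)

lemma det2_one [simp]: "det2 1 = 1"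
  by (simp add: one_mat2_def)

fun adj2 :: "'r::comm_ring_1 mat2 \<Rightarrow> 'r mat2" where
  "adj2 (Mat2 a b c d) = Mat2 d (- b) (- c) a"

lemma mult_adj2: "M * adj2 M = scal (det2 M)" and adj2_mult: "adj2 M * M = scal (det2 M)"
  by (cases M; simp add: scal_def algebra_simps)+

text \<open>Multiplication by the adjugate turns \<open>N\<close> into the nonzero scalar
  \<open>det2 N\<close>, which cancels over a domain.\<close>

lemma mat2_mult_eq_0_right:
  fixes M N :: "'r::idom mat2"
  assumes "M * N = 0" "det2 N \<noteq> 0"
  shows "M = 0"
proof -
  have "scal (det2 N) * M = M * N * adj2 N"
    by (metis mult.assoc mult_adj2 scal_commute)
  also have "\<dots> = scal (det2 N) * 0" using assms by simp
  finally show ?thesis using assms(2) scal_mult_cancel by blast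
qed

lemma mat2_mult_eq_0_left:
  fixes M N :: "'r::idom mat2"
  assumes "M * N = 0" "det2 M \<noteq> 0"
  shows "N = 0"
proof -
  have "scal (det2 M) * N = adj2 M * (M * N)"
    by (metis mult.assoc adj2_mult)
  also have "\<dots> = scal (det2 M) * 0" using assms by simp
  finally show ?thesis using assms(2) scal_mult_cancel by blast
qed

text \<open>A one-sided inverse forces \<open>det2 M\<close> to be nonzero, so \<open>M\<close> may
  be cancelled from \<open>M * (N * M - 1) = 0\<close>.\<close>

lemma mat2_right_inverse:
  fixes M N :: "'r::idom mat2"
  assumes "M * N = 1"
  shows "N * M = 1"
proof -
  have "det2 M * det2 N = 1" using assms det2_mult[of M N] by simp
  then have "det2 M \<noteq> 0" by auto
  moreover have "M * (N * M - 1) = 0"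
    using assms by (simp add: right_diff_distrib flip: mult.assoc)
  ultimately show ?thesis using mat2_mult_eq_0_left by force
qed


section \<open>Homomorphisms of commutative rings\<close>

text \<open>One notion serves the embedding \<open>\<iota>\<close>, the Frobenius map, their
  coefficientwise extensions, evaluation at a point and the passage to fractions;
  \<open>map_mat2_hom\<close> extends each of them to matrices.\<close>

locale unital_ring_hom =
  fixes f :: "'r::comm_ring_1 \<Rightarrow> 's::comm_ring_1"
  assumes hom_add: "f (x + y) = f x + f y"
    and hom_mult: "f (x * y) = f x * f y"
    and hom_one [simp]: "f 1 = 1"
begin

lemma hom_zero [simp]: "f 0 = 0"
  using hom_add[of 0 0] by simp

lemma hom_uminus: "f (- x) = - f x"
  using hom_add[of x "- x"] by (simp add: eq_neg_iff_add_eq_0 add.commute)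

lemma hom_diff: "f (x - y) = f x - f y"
  using hom_add[of x "- y"] by (simp add: hom_uminus)

lemma hom_power: "f (x ^ n) = f x ^ n"
  by (induction n) (simp_all add: hom_mult)

lemma hom_sum: "f (\<Sum>i\<in>I. g i) = (\<Sum>i\<in>I. f (g i))"
  by (induction I rule: infinite_finite_induct) (simp_all add: hom_add)

lemma map_mat2_hom:
  "map_mat2 f (M * N) = map_mat2 f M * map_mat2 f N"
  "map_mat2 f (M + N) = map_mat2 f M + map_mat2 f N"
  "map_mat2 f 1 = 1"
  "map_mat2 f 0 = 0"
  "map_mat2 f (scal a) = scal (f a)"
  "det2 (map_mat2 f M) = f (det2 M)"
  by (cases M; cases N; simp add: hom_add hom_mult hom_diff one_mat2_def zero_mat2_def scal_def)+

lemma map_poly_hom: "unital_ring_hom (map_poly f)"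
proof
  fix p r :: "'r poly"
  show "map_poly f (p + r) = map_poly f p + map_poly f r"
    by (rule poly_eqI) (simp add: coeff_map_poly hom_add)
  show "map_poly f (p * r) = map_poly f p * map_poly f r"
    by (rule poly_eqI) (simp add: coeff_map_poly coeff_mult hom_sum hom_mult)
qed simp

lemma poly_map_poly_hom: "poly (map_poly f p) (f x) = f (poly p x)"
  by (induction p) (simp_all add: map_poly_pCons hom_add hom_mult)

end

lemma unital_ring_hom_comp:
  assumes "unital_ring_hom f" "unital_ring_hom g"
  shows "unital_ring_hom (\<lambda>x. g (f x))"
  using assms by (simp add: unital_ring_hom_def)

lemma unital_ring_hom_inj:
  fixes f :: "'r::field \<Rightarrow> 's::comm_ring_1"
  assumes "unital_ring_hom f" "f x = 0"
  shows "x = 0"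
proof (rule ccontr)
  interpret unital_ring_hom f by fact
  assume "x \<noteq> 0"
  then have "f x * f (inverse x) = 1" by (simp flip: hom_mult)
  then show False using assms(2) by simp
qed

lemma unital_ring_hom_divide:
  fixes f :: "'r::field \<Rightarrow> 's::field"
  assumes "unital_ring_hom f"
  shows "f (x / y) = f x / f y"
proof (cases "y = 0")
  case True
  then show ?thesis using unital_ring_hom.hom_zero[OF assms] by simp
next
  case False
  interpret unital_ring_hom f by fact
  have "f (x / y) * f y = f x" using False by (simp flip: hom_mult)
  moreover have "f y \<noteq> 0" using unital_ring_hom_inj[OF assms] False by blast
  ultimately show ?thesis by (simp add: field_simps)
qed

lemma unital_ring_hom_to_fract: "unital_ring_hom to_fract"
  by unfold_locales simp_all

lemma unital_ring_hom_const: "unital_ring_hom (\<lambda>a. [:a:])"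
  by unfold_locales (simp_all add: one_pCons)

lemma unital_ring_hom_poly: "unital_ring_hom (\<lambda>p. poly p a)"
  by unfold_locales simp_all

section \<open>Extension of injective homomorphisms to fraction fields\<close>

lemma fract_cases_to_fract:
  fixes y :: "'r::idom fract"
  obtains p d where "d \<noteq> 0" "y = to_fract p / to_fract d"
  by (metis Fract_cases Fract_conv_to_fract)

text \<open>The value is independent of the choice once \<open>f\<close> is an injective
  homomorphism: \<open>fract_lift_div\<close> compares two fractions by
  cross-multiplication.\<close>

definition fract_lift :: "('r::idom \<Rightarrow> 's::field) \<Rightarrow> 'r fract \<Rightarrow> 's" where
  "fract_lift f y = (SOME w. \<exists>p d. d \<noteq> 0 \<and> y = to_fract p / to_fract d \<and> w = f p / f d)"

context
  fixes f :: "'r::idom \<Rightarrow> 's::field"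
  assumes hom: "unital_ring_hom f" and inj: "\<And>x. f x = 0 \<Longrightarrow> x = 0"
begin

interpretation unital_ring_hom f by (rule hom)

lemma fract_lift_div:
  assumes "d \<noteq> 0"
  shows "fract_lift f (to_fract p / to_fract d) = f p / f d"
proof -
  let ?y = "to_fract p / to_fract d"
  have "\<exists>p' d'. d' \<noteq> 0 \<and> ?y = to_fract p' / to_fract d' \<and> fract_lift f ?y = f p' / f d'"
    unfolding fract_lift_def by (rule someI_ex) (use assms in blast)
  then obtain p' d' where *: "d' \<noteq> 0" "?y = to_fract p' / to_fract d'"
    "fract_lift f ?y = f p' / f d'" by blast
  then have "to_fract (p * d') = to_fract (p' * d)"
    using assms by (simp add: field_simps)
  then have "p * d' = p' * d" by (simp only: to_fract_eq_iff)
  then have "f p * f d' = f p' * f d" by (simp flip: hom_mult)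
  moreover have "f d \<noteq> 0" "f d' \<noteq> 0" using *(1) assms inj by blast+
  ultimately show ?thesis using *(3) by (simp add: frac_eq_eq mult.commute)
qed

lemma unital_ring_hom_fract_lift: "unital_ring_hom (fract_lift f)"
proof
  fix x y :: "'r fract"
  obtain p d where x: "d \<noteq> 0" "x = to_fract p / to_fract d" by (rule fract_cases_to_fract)
  obtain r e where y: "e \<noteq> 0" "y = to_fract r / to_fract e" by (rule fract_cases_to_fract)
  have nz: "f d \<noteq> 0" "f e \<noteq> 0" using x y inj by auto
  have "x + y = to_fract (p * e + r * d) / to_fract (d * e)"
    using x y by (simp add: field_simps)
  then have "fract_lift f (x + y) = f (p * e + r * d) / f (d * e)"
    using fract_lift_div[of "d * e" "p * e + r * d"] x y by simp
  also have "\<dots> = fract_lift f x + fract_lift f y"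
    using nz unfolding x(2) y(2) fract_lift_div[OF x(1)] fract_lift_div[OF y(1)]
    by (simp add: hom_add hom_mult add_frac_eq)
  finally show "fract_lift f (x + y) = fract_lift f x + fract_lift f y" .
  have "x * y = to_fract (p * r) / to_fract (d * e)"
    using x y by simp
  then have "fract_lift f (x * y) = f (p * r) / f (d * e)"
    using fract_lift_div[of "d * e" "p * r"] x y by simp
  also have "\<dots> = fract_lift f x * fract_lift f y"
    unfolding x(2) y(2) fract_lift_div[OF x(1)] fract_lift_div[OF y(1)]
    by (simp add: hom_mult)
  finally show "fract_lift f (x * y) = fract_lift f x * fract_lift f y" .
next
  show "fract_lift f 1 = 1" using fract_lift_div[of 1 1] by simp
qed

lemma fract_lift_to_fract: "fract_lift f (to_fract p) = f p"
  using fract_lift_div[of 1 p] by simp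

end


section \<open>Presented groups\<close>

lemma pres_eq_ctxt: "pres_eq Rels u v \<Longrightarrow> pres_eq Rels (a @ u @ b) (a @ v @ b)"
proof (induction rule: pres_eq.induct)
  case (pres_cancel u x s v)
  then show ?case using pres_eq.pres_cancel[of Rels "a @ u" x s "v @ b"] by simp
next
  case (pres_rel l r u v)
  then show ?case using pres_eq.pres_rel[of l r Rels "a @ u" "v @ b"] by simp
qed (blast intro: pres_eq.intros)+

lemma pres_eq_append: "pres_eq Rels u v \<Longrightarrow> pres_eq Rels u' v' \<Longrightarrow> pres_eq Rels (u @ u') (v @ v')"
  using pres_eq_ctxt[of Rels u v "[]" u'] pres_eq_ctxt[of Rels u' v' v "[]"]
  by (auto intro: pres_trans)

lemma pres_eq_appendL: "pres_eq Rels u v \<Longrightarrow> pres_eq Rels (a @ u) (a @ v)"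
  by (simp add: pres_eq_append pres_refl)

lemma pres_eq_appendR: "pres_eq Rels u v \<Longrightarrow> pres_eq Rels (u @ a) (v @ a)"
  by (simp add: pres_eq_append pres_refl)

lemma pres_eq_rel: "(l, r) \<in> Rels \<Longrightarrow> pres_eq Rels l r"
  using pres_rel[of l r Rels "[]" "[]"] by simp

definition winv :: "'g gword \<Rightarrow> 'g gword" where
  "winv w = rev (map (\<lambda>(x, s). (x, \<not> s)) w)"

lemma winv_winv [simp]: "winv (winv w) = w"
  by (simp add: winv_def rev_map comp_def case_prod_unfold)

lemma pres_eq_winv_right: "pres_eq Rels (w @ winv w) []"
proof (induction w)
  case (Cons y w)
  obtain x s where y: "y = (x, s)" by (cases y)
  have "pres_eq Rels ([y] @ (w @ winv w) @ [(x, \<not> s)]) ([y] @ [] @ [(x, \<not> s)])"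
    using Cons by (rule pres_eq_ctxt)
  then show ?case
    using pres_cancel[of Rels "[]" x s "[]"] by (auto simp: winv_def y intro: pres_trans)
qed (simp add: winv_def pres_refl)

lemma pres_eq_winv_left: "pres_eq Rels (winv w @ w) []"
  using pres_eq_winv_right[of Rels "winv w"] by simp

lemma equiv_pres_rel_set: "equiv UNIV (pres_rel_set Rels)"
  by (auto simp: pres_rel_set_def intro!: equivI refl_onI symI transI
      intro: pres_refl pres_sym pres_trans)

lemma pres_class_eq_iff: "pres_rel_set Rels `` {u} = pres_rel_set Rels `` {v} \<longleftrightarrow> pres_eq Rels u v"
  using eq_equiv_class_iff[OF equiv_pres_rel_set, of u v Rels] by (simp add: pres_rel_set_def)

lemma presented_group_carrier:
  "C \<in> carrier (presented_group Rels) \<longleftrightarrow> (\<exists>u. C = pres_rel_set Rels `` {u})"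
  by (auto simp: presented_group_def quotient_def)

text \<open>The union in the definition ranges over all representatives; it collapses to one class
  because \<open>pres_eq\<close> is compatible with concatenation.\<close>

lemma presented_group_mult:
  "pres_rel_set Rels `` {u} \<otimes>\<^bsub>presented_group Rels\<^esub> pres_rel_set Rels `` {v} = pres_rel_set Rels `` {u @ v}"
proof -
  have "pres_rel_set Rels `` {u' @ v'} = pres_rel_set Rels `` {u @ v}"
    if "u' \<in> pres_rel_set Rels `` {u}" "v' \<in> pres_rel_set Rels `` {v}" for u' v'
    using that by (simp add: pres_class_eq_iff) (simp add: pres_rel_set_def pres_eq_append pres_sym)
  moreover have "u \<in> pres_rel_set Rels `` {u}" for u by (simp add: pres_rel_set_def pres_refl)
  ultimately have "(\<Union>u'\<in>pres_rel_set Rels `` {u}. \<Union>v'\<in>pres_rel_set Rels `` {v}. pres_rel_set Rels `` {u' @ v'})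
      = pres_rel_set Rels `` {u @ v}" by blast
  then show ?thesis by (simp add: presented_group_def)
qed

lemma presented_group_one: "\<one>\<^bsub>presented_group Rels\<^esub> = pres_rel_set Rels `` {[]}"
  by (simp add: presented_group_def)

lemma group_presented_group: "group (presented_group Rels)"
proof (rule groupI)
  fix C assume "C \<in> carrier (presented_group Rels)"
  then obtain u where u: "C = pres_rel_set Rels `` {u}" by (auto simp: presented_group_carrier)
  show "\<one>\<^bsub>presented_group Rels\<^esub> \<otimes>\<^bsub>presented_group Rels\<^esub> C = C"
    by (simp add: u presented_group_one presented_group_mult)
  show "\<exists>C'\<in>carrier (presented_group Rels). C' \<otimes>\<^bsub>presented_group Rels\<^esub> C = \<one>\<^bsub>presented_group Rels\<^esub>"
    by (rule bexI[of _ "pres_rel_set Rels `` {winv u}"])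
      (auto simp: u presented_group_one presented_group_mult pres_class_eq_iff pres_eq_winv_left
        presented_group_carrier intro: pres_refl)
qed (auto simp: presented_group_carrier presented_group_one presented_group_mult; blast?)+


section \<open>Free algebras and the quaternion relations\<close>

lemma ring_of_type_algebra_sel [simp]:
  "carrier ring_of_type_algebra = UNIV" "monoid.mult ring_of_type_algebra = (*)"
  "monoid.one ring_of_type_algebra = 1" "ring.zero ring_of_type_algebra = 0" "ring.add ring_of_type_algebra = (+)"
  by (simp_all add: ring_of_type_algebra_def fun_eq_iff)

lemma free_alg_over_sel [simp]:
  "carrier (free_alg_over A) = {f. \<forall>w. Poly_Mapping.lookup f w \<in> A}"
  "monoid.mult (free_alg_over A) = (*)" "monoid.one (free_alg_over A) = 1"
  "ring.zero (free_alg_over A) = 0" "ring.add (free_alg_over A) = (+)"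
  by (simp_all add: free_alg_over_def)

lemma ring_ring_of_type_algebra: "ring (ring_of_type_algebra :: 'r::ring_1 ring)"
proof (rule ringI)
  show "abelian_group (ring_of_type_algebra :: 'r ring)"
  proof (rule abelian_groupI)
    fix x :: 'r
    show "\<exists>y\<in>carrier ring_of_type_algebra. y \<oplus>\<^bsub>ring_of_type_algebra\<^esub> x = \<zero>\<^bsub>ring_of_type_algebra\<^esub>"
      by (rule bexI[of _ "- x"]) simp_all
  qed (simp_all add: algebra_simps)
  show "Group.monoid (ring_of_type_algebra :: 'r ring)"
    by (rule monoidI) (simp_all add: mult.assoc)
qed (simp_all add: algebra_simps)

section \<open>Free algebras with coefficients in a subring\<close>

definition is_subring :: "'k::comm_ring_1 set \<Rightarrow> bool" where
  "is_subring A \<longleftrightarrow> 1 \<in> A \<and> (\<forall>x\<in>A. \<forall>y\<in>A. x - y \<in> A \<and> x * y \<in> A)"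

context
  fixes A :: "'k::comm_ring_1 set"
  assumes A: "is_subring A"
begin

lemma is_subring_closed:
  "0 \<in> A" "1 \<in> A" "x \<in> A \<Longrightarrow> - x \<in> A" "x \<in> A \<Longrightarrow> y \<in> A \<Longrightarrow> x + y \<in> A"
  "x \<in> A \<Longrightarrow> y \<in> A \<Longrightarrow> x - y \<in> A" "x \<in> A \<Longrightarrow> y \<in> A \<Longrightarrow> x * y \<in> A"
proof -
  show 0: "0 \<in> A" and 1: "1 \<in> A" using A by (force simp: is_subring_def)+
  show m: "x \<in> A \<Longrightarrow> - x \<in> A" for x using A 0 unfolding is_subring_def by (metis diff_0)
  show "x \<in> A \<Longrightarrow> y \<in> A \<Longrightarrow> x + y \<in> A" for x y
    using A m unfolding is_subring_def by (metis diff_minus_eq_add)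
  show "x \<in> A \<Longrightarrow> y \<in> A \<Longrightarrow> x - y \<in> A" "x \<in> A \<Longrightarrow> y \<in> A \<Longrightarrow> x * y \<in> A" for x y
    using A by (auto simp: is_subring_def)
qed

lemma is_subring_sum: "(\<And>i. i \<in> I \<Longrightarrow> g i \<in> A) \<Longrightarrow> sum g I \<in> A"
  by (induction I rule: infinite_finite_induct) (auto intro: is_subring_closed)

lemma free_alg_over_mult_closed:
  fixes f g :: "('g, 'k) free_alg"
  assumes "\<forall>w. Poly_Mapping.lookup f w \<in> A" "\<forall>w. Poly_Mapping.lookup g w \<in> A"
  shows "Poly_Mapping.lookup (f * g) w \<in> A"
  unfolding lookup_mult Sum_any.expand_set using assms
  by (auto intro!: is_subring_sum is_subring_closed simp: when_def)

lemma ring_free_alg_over: "ring (free_alg_over A :: ('g, 'k) free_alg ring)"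
proof (rule ringI)
  show "abelian_group (free_alg_over A :: ('g, 'k) free_alg ring)"
  proof (rule abelian_groupI)
    fix x :: "('g, 'k) free_alg" assume "x \<in> carrier (free_alg_over A)"
    then show "\<exists>y\<in>carrier (free_alg_over A). y \<oplus>\<^bsub>free_alg_over A\<^esub> x = \<zero>\<^bsub>free_alg_over A\<^esub>"
      by (intro bexI[of _ "- x"]) (auto intro: is_subring_closed)
  qed (auto simp: lookup_add algebra_simps intro: is_subring_closed)
  show "Group.monoid (free_alg_over A :: ('g, 'k) free_alg ring)"
    by (rule monoidI) (auto simp: mult.assoc lookup_one when_def
        intro: is_subring_closed free_alg_over_mult_closed)
qed (simp_all add: algebra_simps)

lemma single_in_free_alg_over: "a \<in> A \<Longrightarrow> Poly_Mapping.single w a \<in> carrier (free_alg_over A)"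
  by (auto simp: lookup_single when_def intro: is_subring_closed)

text \<open>Every element is a finite sum of monomials with coefficients in \<open>A\<close>, so
  additive properties need to be checked on single monomials only.\<close>

lemma free_alg_over_induct [consumes 2, case_names zero single add]:
  fixes f :: "('g, 'k) free_alg"
  assumes "f \<in> carrier (free_alg_over A)"
    and "Q 0"
    and "\<And>w a. a \<in> A \<Longrightarrow> Q (Poly_Mapping.single w a)"
    and "\<And>f g. f \<in> carrier (free_alg_over A) \<Longrightarrow> g \<in> carrier (free_alg_over A) \<Longrightarrow>
      Q f \<Longrightarrow> Q g \<Longrightarrow> Q (f + g)"
  shows "Q f"
  using assms(1)
proof (induction f rule: update_induct)
  case (update f a b)
  have b: "b \<in> A" using update.prems by (auto simp: lookup_update split: if_splits)
  \<comment> \<open>The smaller element agrees with the updated one away from \<open>a\<close>, and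
    its coefficient at \<open>a\<close> is 0 because \<open>a\<close> is a new key.\<close>
  have "Poly_Mapping.lookup f w \<in> A" for w
  proof (cases "w = a")
    case True
    then show ?thesis using update.hyps is_subring_closed(1) by (simp add: in_keys_iff)
  next
    case False
    then show ?thesis using update.prems by (auto simp: lookup_update dest: spec[of _ w])
  qed
  then have f: "f \<in> carrier (free_alg_over A)" by simp
  have "Poly_Mapping.update a b f = f + Poly_Mapping.single a b"
    using update.hyps
    by (intro poly_mapping_eqI) (auto simp: lookup_update lookup_add lookup_single in_keys_iff when_def)
  then show ?case
    using assms(3)[OF b] assms(4)[OF f single_in_free_alg_over[OF b]] update.IH[OF f] by simp
qed (rule assms(2))

end

lemma is_subring_UNIV: "is_subring UNIV"
  by (simp add: is_subring_def)

section \<open>Universal property of the free algebra\<close>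

fun free_mon_eval :: "('g \<Rightarrow> 's::monoid_mult) \<Rightarrow> 'g free_mon \<Rightarrow> 's" where
  "free_mon_eval g (FM w) = prod_list (map g w)"

lemma free_mon_eval_plus: "free_mon_eval g (u + v) = free_mon_eval g u * free_mon_eval g v"
  by (cases u; cases v) simp

lemma free_mon_eval_0: "free_mon_eval g 0 = 1"
  by (simp add: zero_free_mon_def)

definition free_alg_eval ::
    "('k::comm_ring_1 \<Rightarrow> 's::ring_1) \<Rightarrow> ('g \<Rightarrow> 's) \<Rightarrow> ('g, 'k) free_alg \<Rightarrow> 's" where
  "free_alg_eval \<phi> g f =
    (\<Sum>w\<in>Poly_Mapping.keys f. \<phi> (Poly_Mapping.lookup f w) * free_mon_eval g w)"

context
  fixes \<phi> :: "'k::comm_ring_1 \<Rightarrow> 's::ring_1" and g :: "'g \<Rightarrow> 's"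
  assumes \<phi>_add: "\<And>x y. \<phi> (x + y) = \<phi> x + \<phi> y"
    and \<phi>_mult: "\<And>x y. \<phi> (x * y) = \<phi> x * \<phi> y"
    and \<phi>_one: "\<phi> 1 = 1"
    and \<phi>_central: "\<And>x s. \<phi> x * s = s * \<phi> x"
begin

lemma \<phi>_zero: "\<phi> 0 = 0"
  using \<phi>_add[of 0 0] by simp

lemma free_alg_eval_add: "free_alg_eval \<phi> g (f + h) = free_alg_eval \<phi> g f + free_alg_eval \<phi> g h"
  unfolding free_alg_eval_def
  by (rule setsum_keys_plus_distrib) (simp_all add: \<phi>_zero \<phi>_add distrib_right)

lemma free_alg_eval_single:
  "free_alg_eval \<phi> g (Poly_Mapping.single w a) = \<phi> a * free_mon_eval g w"
  by (simp add: free_alg_eval_def \<phi>_zero)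

lemma free_alg_eval_zero: "free_alg_eval \<phi> g 0 = 0"
  by (simp add: free_alg_eval_def)

text \<open>Bilinearity leaves the product of two monomials, where centrality of the image of
  \<open>\<phi>\<close> lets the second coefficient pass the first word.\<close>

lemma free_alg_eval_mult: "free_alg_eval \<phi> g (f * h) = free_alg_eval \<phi> g f * free_alg_eval \<phi> g h"
proof -
  have *: "free_alg_eval \<phi> g (Poly_Mapping.single w a * h)
      = free_alg_eval \<phi> g (Poly_Mapping.single w a) * free_alg_eval \<phi> g h" for w a
  proof -
    have "h \<in> carrier (free_alg_over UNIV)" by simp
    with is_subring_UNIV show ?thesis
    proof (induction h rule: free_alg_over_induct)
      case (single v b)
      then show ?case
        by (simp add: mult_single free_alg_eval_single free_mon_eval_plus \<phi>_mult)
          (metis \<phi>_central mult.assoc)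
    qed (simp_all add: free_alg_eval_zero free_alg_eval_add distrib_left)
  qed
  have "f \<in> carrier (free_alg_over UNIV)" by simp
  with is_subring_UNIV show ?thesis
    by (induction f rule: free_alg_over_induct)
      (simp_all add: free_alg_eval_zero free_alg_eval_add distrib_right *)
qed

lemma free_alg_eval_one: "free_alg_eval \<phi> g 1 = 1"
  using free_alg_eval_single[of 0 1] by (simp add: \<phi>_one free_mon_eval_0)

lemma free_alg_eval_uminus: "free_alg_eval \<phi> g (- f) = - free_alg_eval \<phi> g f"
  using free_alg_eval_add[of f "- f"] by (simp add: free_alg_eval_zero eq_neg_iff_add_eq_0 add.commute)

lemma free_alg_eval_scalar: "free_alg_eval \<phi> g (scalar a) = \<phi> a"
  by (simp add: scalar_def free_alg_eval_single free_mon_eval_0)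

lemma free_alg_eval_indet: "free_alg_eval \<phi> g (indet x) = g x"
  by (simp add: indet_def free_alg_eval_single \<phi>_one)

end

lemma scalar_hom:
  "scalar (a + b) = scalar a + scalar b" "scalar (a * b) = scalar a * scalar b"
  "scalar (- a) = - scalar a" "scalar 0 = 0" "scalar 1 = 1"
  by (simp_all add: scalar_def single_add mult_single single_uminus)

lemma scalar_central:
  fixes f :: "('g, 'k::comm_ring_1) free_alg"
  shows "f * scalar a = scalar a * f"
proof -
  have "f \<in> carrier (free_alg_over UNIV)" by simp
  with is_subring_UNIV show ?thesis
    by (induction f rule: free_alg_over_induct)
      (simp_all add: scalar_def mult_single distrib_left distrib_right mult.commute)
qed

declare free_alg_over_sel(1) [simp del]

lemma is_subring_poly_inverting:
  assumes "f \<noteq> 0"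
  shows "is_subring (poly_inverting f)"
  unfolding is_subring_def
proof (intro conjI ballI)
  show "1 \<in> poly_inverting f"
    unfolding poly_inverting_def by (rule CollectI, rule exI[of _ 1], rule exI[of _ 0]) simp
  fix x y assume "x \<in> poly_inverting f" "y \<in> poly_inverting f"
  then obtain p n r m where xy: "x = to_fract p / to_fract f ^ n" "y = to_fract r / to_fract f ^ m"
    by (auto simp: poly_inverting_def)
  interpret unital_ring_hom to_fract by (rule unital_ring_hom_to_fract)
  have "x - y = to_fract (p * f ^ m - r * f ^ n) / to_fract f ^ (n + m)"
    using assms by (simp add: xy hom_power power_add field_simps)
  then show "x - y \<in> poly_inverting f" unfolding poly_inverting_def by blast
  have "x * y = to_fract (p * r) / to_fract f ^ (n + m)"
    by (simp add: xy power_add)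
  then show "x * y \<in> poly_inverting f" unfolding poly_inverting_def by blast
qed

lemma to_fract_in_poly_inverting: "to_fract p \<in> poly_inverting f"
  unfolding poly_inverting_def by (rule CollectI, rule exI[of _ p], rule exI[of _ 0]) simp


section \<open>The quadratic extension of finite fields\<close>

text \<open>Multiplication by a nonzero \<open>x\<close> permutes the nonzero elements; comparing
  their products gives \<open>x ^ (CARD('a) - 1) = 1\<close>.\<close>

lemma finite_field_power_card:
  fixes x :: "'a::{field,finite}"
  shows "x ^ CARD('a) = x"
proof (cases "x = 0")
  case False
  have "(\<Prod>y\<in>UNIV-{0}. x * y) = (\<Prod>y\<in>UNIV-{0}. y)"
    by (rule prod.reindex_bij_witness[of _ "\<lambda>y. y / x" "\<lambda>y. x * y"]) (use False in auto)
  then have "x ^ (CARD('a) - 1) * \<Prod>(UNIV-{0}) = 1 * (\<Prod>(UNIV-{0}) :: 'a)"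
    by (simp add: prod.distrib)
  then have "x ^ (CARD('a) - 1) = 1"
    by (subst (asm) mult_cancel_right) simp
  then have "x ^ (CARD('a) - 1) * x = x" by (simp only: mult_1)
  moreover have "CARD('a) = Suc (CARD('a) - 1)" using finite_UNIV_card_ge_0[where ?'a = 'a] by simp
  ultimately show ?thesis by (metis power_Suc2)
qed simp

locale quaternion_lattice =
  fixes q :: nat
    and c \<tau> :: "'a::{field,finite}"
    and \<delta> \<zeta> :: "'b::{field,finite}"
    and \<iota> :: "'a \<Rightarrow> 'b"
  assumes odd_q: "odd q" and card_a: "CARD('a) = q" and card_b: "CARD('b) = q ^ 2"
    and \<iota>_ring_hom: "\<iota> \<in> ring_hom ring_of_type_algebra ring_of_type_algebra"
    and c_nz: "c \<noteq> 0" and c_nonsquare: "\<not> (\<exists>x. c = x ^ 2)"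
    and \<delta>_generates: "range (\<lambda>n::int. \<delta> powi n) = UNIV - {0}"
    and \<tau>_nz: "\<tau> \<noteq> 0" and \<tau>_not_1: "\<tau> \<noteq> 1"
    and \<zeta>_nz: "\<zeta> \<noteq> 0" and \<zeta>_norm: "\<zeta> ^ (1 + q) = \<iota> ((\<tau> - 1) / \<tau>)"
begin

sublocale \<iota>: unital_ring_hom \<iota>
proof
  fix x y :: 'a
  show "\<iota> (x + y) = \<iota> x + \<iota> y"
    using ring_hom_add[OF \<iota>_ring_hom, of x y] by simp
  show "\<iota> (x * y) = \<iota> x * \<iota> y"
    using ring_hom_mult[OF \<iota>_ring_hom, of x y] by simp
  show "\<iota> 1 = 1"
    using ring_hom_one[OF \<iota>_ring_hom] by simp
qed

lemma \<iota>_eq_0_iff [simp]: "\<iota> u = 0 \<longleftrightarrow> u = 0"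
  using unital_ring_hom_inj[OF \<iota>.unital_ring_hom_axioms] by auto

lemma \<iota>_inj: "inj \<iota>"
  by (rule injI) (metis \<iota>.hom_diff \<iota>_eq_0_iff eq_iff_diff_eq_0)

lemma \<iota>_divide: "\<iota> (u / v) = \<iota> u / \<iota> v"
proof (cases "v = 0")
  case False
  then have "\<iota> (u / v) * \<iota> v = \<iota> u" by (simp flip: \<iota>.hom_mult)
  then show ?thesis using False by (simp add: field_simps)
qed simp

lemma card_range_\<iota>: "card (range \<iota>) = q"
  using card_image[OF \<iota>_inj] card_a by simp

lemma q_ge_3: "3 \<le> q"
proof -
  have "card {0, 1 :: 'a} \<le> CARD('a)" by (rule card_mono) auto
  then have "2 \<le> q" using card_a by simp
  then show ?thesis using odd_q by (cases "q = 2") auto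
qed

section \<open>Frobenius and norm of the quadratic extension\<close>

definition \<sigma> :: "'b \<Rightarrow> 'b" where "\<sigma> x = x ^ q"

lemma \<sigma>_\<iota> [simp]: "\<sigma> (\<iota> u) = \<iota> u"
  using finite_field_power_card[of u] card_a by (simp add: \<sigma>_def flip: \<iota>.hom_power)

text \<open>
  The polynomial \<open>(T + 1)\<^sup>q - T\<^sup>q - 1\<close> has degree less than \<open>q\<close> and vanishes on the \<open>q\<close>
  elements of the subfield, so it is zero; this avoids showing that \<open>q\<close> is a power of the
  characteristic.
\<close>
lemma frobenius_poly: "[:1, 1:] ^ q = (monom 1 q + 1 :: 'b poly)"
proof (rule ccontr)
  assume ne: "[:1, 1:] ^ q \<noteq> (monom 1 q + 1 :: 'b poly)"
  define p :: "'b poly" where "p = [:1, 1:] ^ q - monom 1 q - 1"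
  have p0: "p \<noteq> 0" using ne by (auto simp: p_def algebra_simps)
  have deg: "degree ([:1, 1:] ^ q :: 'b poly) = q" by (rule degree_linear_power)
  have "coeff ([:1, 1:] ^ q :: 'b poly) q = 1"
    using lead_coeff_power[of "[:1, 1:] :: 'b poly" q] deg by simp
  then have lc: "coeff p q = 0" using q_ge_3 by (simp add: p_def)
  have "degree p \<le> q"
    unfolding p_def by (intro degree_diff_le) (simp_all add: deg degree_monom_le)
  with lc p0 have less: "degree p < q"
    by (metis le_neq_implies_less leading_coeff_0_iff)
  have "range \<iota> \<subseteq> {x. poly p x = 0}"
  proof clarify
    fix u
    have "(1 + \<iota> u) ^ q = \<iota> u ^ q + 1"
      using \<sigma>_\<iota>[of "1 + u"] \<sigma>_\<iota>[of u] by (simp add: \<sigma>_def \<iota>.hom_add)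
    then show "poly p (\<iota> u) = 0" by (simp add: p_def poly_monom)
  qed
  then have "q \<le> card {x. poly p x = 0}"
    using card_mono[of "{x. poly p x = 0}" "range \<iota>"] card_range_\<iota> by simp
  also have "\<dots> \<le> degree p" by (rule card_poly_roots_bound[OF p0])
  finally show False using less by simp
qed

sublocale \<sigma>: unital_ring_hom \<sigma>
proof
  fix x y :: 'b
  show "\<sigma> (x + y) = \<sigma> x + \<sigma> y"
  proof (cases "y = 0")
    case False
    \<comment> \<open>Additivity is homogeneous of degree \<open>q\<close>, so it follows from
      \<open>frobenius_poly\<close> evaluated at \<open>x / y\<close>.\<close>
    have "(1 + x / y) ^ q = (x / y) ^ q + 1"
      using arg_cong[OF frobenius_poly, of "\<lambda>p. poly p (x / y)"] by (simp add: poly_monom)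
    moreover have "x + y = y * (1 + x / y)" using False by (simp add: field_simps)
    ultimately have "\<sigma> (x + y) = y ^ q * ((x / y) ^ q + 1)"
      by (simp only: \<sigma>_def power_mult_distrib)
    also have "\<dots> = (y * (x / y)) ^ q + y ^ q"
      by (simp only: power_mult_distrib distrib_left mult_1_right)
    finally show ?thesis using False by (simp add: \<sigma>_def)
  qed (use q_ge_3 in \<open>simp add: \<sigma>_def\<close>)
qed (simp_all add: \<sigma>_def power_mult_distrib)

lemma \<sigma>_eq_0_iff [simp]: "\<sigma> x = 0 \<longleftrightarrow> x = 0"
  using q_ge_3 by (simp add: \<sigma>_def)

lemma \<sigma>_divide: "\<sigma> (x / y) = \<sigma> x / \<sigma> y"
  by (simp add: \<sigma>_def power_divide)

lemma \<sigma>_\<sigma> [simp]: "\<sigma> (\<sigma> x) = x"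
  using finite_field_power_card[of x] card_b
  by (simp add: \<sigma>_def power2_eq_square flip: power_mult)

text \<open>The polynomial \<open>T ^ q - T\<close> has at most \<open>q\<close> roots, and the
  image of \<open>\<iota>\<close> already supplies \<open>q\<close> of them.\<close>

lemma \<sigma>_fixed: "\<sigma> x = x \<Longrightarrow> \<exists>u. x = \<iota> u"
proof -
  assume x: "\<sigma> x = x"
  define p :: "'b poly" where "p = monom 1 q - monom 1 1"
  have "coeff p q = 1" using q_ge_3 by (simp add: p_def)
  then have p0: "p \<noteq> 0" by auto
  have "degree p \<le> q"
    unfolding p_def using q_ge_3
    by (intro degree_diff_le order_trans[OF degree_monom_le]) simp_all
  then have "card {x. poly p x = 0} \<le> card (range \<iota>)"
    using card_poly_roots_bound[OF p0] card_range_\<iota> by simp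
  moreover have "range \<iota> \<subseteq> {x. poly p x = 0}"
    using \<sigma>_\<iota> by (auto simp: p_def poly_monom \<sigma>_def)
  ultimately have "range \<iota> = {x. poly p x = 0}" by (intro card_seteq) simp_all
  moreover have "poly p x = 0" using x by (simp add: p_def poly_monom \<sigma>_def)
  ultimately show ?thesis by auto
qed

section \<open>Powers of the generator\<close>

lemma \<delta>_nz [simp]: "\<delta> \<noteq> 0"
proof -
  have "\<delta> powi 1 \<in> UNIV - {0}" unfolding \<delta>_generates[symmetric] by blast
  then show ?thesis by simp
qed

text \<open>If \<open>\<delta> ^ m = 1\<close>, then the \<open>m\<close> powers with exponents
  below \<open>m\<close> exhaust all \<open>q ^ 2 - 1\<close> nonzero elements.\<close>

lemma \<delta>_order_ge:
  assumes "\<delta> ^ m = 1" "m > 0"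
  shows "q ^ 2 - 1 \<le> m"
proof -
  have "UNIV - {0} \<subseteq> (\<lambda>i. \<delta> ^ i) ` {..<m}"
  proof
    fix x :: 'b assume "x \<in> UNIV - {0}"
    then obtain n :: int where n: "x = \<delta> powi n" by (metis \<delta>_generates imageE)
    have "\<delta> powi n = \<delta> powi (int m * (n div int m) + n mod int m)" by simp
    also have "\<dots> = (\<delta> powi int m) powi (n div int m) * \<delta> powi (n mod int m)"
      by (simp only: power_int_add[of \<delta>] \<delta>_nz power_int_mult simp_thms)
    also have "\<dots> = \<delta> ^ nat (n mod int m)"
      using assms by (simp add: power_int_def)
    finally have "x = \<delta> ^ nat (n mod int m)" using n by simp
    moreover have "nat (n mod int m) < m" using assms(2) by (simp add: nat_less_iff)
    ultimately show "x \<in> (\<lambda>i. \<delta> ^ i) ` {..<m}" by blast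
  qed
  then have "card (UNIV - {0 :: 'b}) \<le> card {..<m}"
    by (meson card_image_le card_mono finite_imageI finite_lessThan order_trans)
  then show ?thesis using card_b by simp
qed

lemma \<delta>_order: "\<delta> ^ (q ^ 2 - 1) = 1"
proof -
  have "\<delta> ^ Suc (q ^ 2 - 1) = \<delta>"
    using finite_field_power_card[of \<delta>] card_b q_ge_3 by simp
  then show ?thesis by simp
qed

lemma \<delta>_power_eq_1_iff: "\<delta> ^ n = 1 \<longleftrightarrow> (q ^ 2 - 1) dvd n"
proof
  assume n: "\<delta> ^ n = 1"
  define m where "m = q ^ 2 - 1"
  have m: "m > 0" using q_ge_3 by (simp add: m_def power2_eq_square) (metis One_nat_def less_1_mult less_le_trans numeral_3_eq_3 Suc_less_eq zero_less_Suc less_eq_Suc_le)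
  have "\<delta> ^ n = \<delta> ^ (m * (n div m) + n mod m)" by simp
  also have "\<dots> = \<delta> ^ (n mod m)"
    using \<delta>_order by (simp only: power_add power_mult m_def power_one mult_1)
  finally have "\<delta> ^ (n mod m) = 1" using n by simp
  then have "n mod m = 0"
    using \<delta>_order_ge[of "n mod m"] m by (metis m_def mod_less_divisor not_le gr0I)
  then show "(q ^ 2 - 1) dvd n" by (simp add: m_def mod_eq_0_iff_dvd)
next
  assume "(q ^ 2 - 1) dvd n"
  then show "\<delta> ^ n = 1" using \<delta>_order by (auto simp: power_mult elim!: dvdE)
qed

lemma \<delta>_power_surj:
  assumes "x \<noteq> 0"
  obtains n where "x = \<delta> ^ n"
proof -
  obtain n :: int where n: "x = \<delta> powi n"
    using assms \<delta>_generates by (metis DiffI UNIV_I imageE singletonD)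
  show ?thesis
  proof (cases "n \<ge> 0")
    case True
    then show ?thesis using n that by (simp add: power_int_def)
  next
    case False
    \<comment> \<open>Negative exponents are removed by writing the inverse of
      \<open>\<delta>\<close> as \<open>\<delta> ^ (q ^ 2 - 2)\<close>.\<close>
    have "inverse \<delta> * \<delta> ^ (q ^ 2 - 1) = inverse \<delta>" using \<delta>_order by simp
    moreover have "q ^ 2 - 1 = Suc (q ^ 2 - 2)"
      using q_ge_3 power_mono[of 3 q 2] by simp
    ultimately have "inverse \<delta> = inverse \<delta> * (\<delta> * \<delta> ^ (q ^ 2 - 2))" by simp
    then have "inverse \<delta> = \<delta> ^ (q ^ 2 - 2)"
      by (metis \<delta>_nz left_inverse mult.assoc mult_1)
    then have "x = \<delta> ^ ((q ^ 2 - 2) * nat (- n))"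
      using n False by (simp add: power_int_def power_mult)
    then show ?thesis by (rule that)
  qed
qed

lemma q_square: "q ^ 2 - 1 = (q + 1) * (q - 1)"
  by (simp add: power2_eq_square algebra_simps)

text \<open>Being fixed means \<open>\<delta> ^ (n * (q - 1)) = 1\<close>, and the order of
  \<open>\<delta>\<close> is \<open>(q + 1) * (q - 1)\<close>. Hence \<open>\<delta>\<close> has
  order \<open>q + 1\<close> modulo the subfield.\<close>

lemma \<sigma>_\<delta>_power_iff: "\<sigma> (\<delta> ^ n) = \<delta> ^ n \<longleftrightarrow> (q + 1) dvd n"
proof -
  have "n * q = n + n * (q - 1)" using q_ge_3 by (simp add: algebra_simps)
  then have "\<sigma> (\<delta> ^ n) = \<delta> ^ n * \<delta> ^ (n * (q - 1))"
    by (simp add: \<sigma>_def flip: power_mult power_add)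
  then have "\<sigma> (\<delta> ^ n) = \<delta> ^ n \<longleftrightarrow> \<delta> ^ (n * (q - 1)) = 1" by simp
  also have "\<dots> \<longleftrightarrow> (q + 1) * (q - 1) dvd n * (q - 1)"
    by (simp only: \<delta>_power_eq_1_iff q_square)
  also have "\<dots> \<longleftrightarrow> (q + 1) dvd n" using q_ge_3 by (simp only: dvd_times_right_cancel_iff)
  finally show ?thesis .
qed

text \<open>A square root of \<open>c\<close> in the larger field; as a constant skew polynomial it
  represents the generator \<open>Z\<close>.\<close>

definition z :: 'b where "z = (SOME y. y ^ 2 = \<iota> c)"

lemma z_square: "z ^ 2 = \<iota> c"
proof -
  obtain n where n: "\<iota> c = \<delta> ^ n" using \<delta>_power_surj[of "\<iota> c"] c_nz by auto
  \<comment> \<open>An element of the subfield has an exponent divisible by \<open>q + 1\<close>,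
    which is even; halving the exponent gives the root.\<close>
  then have "(q + 1) dvd n" using \<sigma>_\<delta>_power_iff[of n] by (metis \<sigma>_\<iota>)
  moreover have "2 dvd q + 1" using odd_q by simp
  ultimately have "2 dvd n" using dvd_trans by blast
  then have "(\<delta> ^ (n div 2)) ^ 2 = \<iota> c" using n by (simp flip: power_mult)
  then show ?thesis unfolding z_def by (rule someI)
qed

lemma z_nz [simp]: "z \<noteq> 0"
  using z_square c_nz by auto

text \<open>The conjugate is another square root of \<open>c\<close>, and a fixed \<open>z\<close>
  would make \<open>c\<close> a square in the subfield.\<close>

lemma \<sigma>_z [simp]: "\<sigma> z = - z"
proof -
  have "(\<sigma> z) ^ 2 = z ^ 2" using z_square by (metis \<sigma>.hom_power \<sigma>_\<iota>)
  moreover have "\<sigma> z \<noteq> z"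
  proof
    assume "\<sigma> z = z"
    then obtain u where "z = \<iota> u" using \<sigma>_fixed by blast
    then have "\<iota> (u ^ 2) = \<iota> c" using z_square by (simp add: \<iota>.hom_power)
    then show False using c_nonsquare \<iota>_inj by (metis injD)
  qed
  ultimately show ?thesis by (simp add: power2_eq_iff)
qed

lemma z_mult_z: "z * z = \<iota> c"
  using z_square by (simp add: power2_eq_square)

text \<open>In characteristic two, \<open>\<sigma> z = - z\<close> would say that \<open>z\<close>
  is fixed, and \<open>c\<close> would again be a square.\<close>

lemma two_nz: "(2 :: 'b) \<noteq> 0"
proof
  assume *: "(2 :: 'b) = 0"
  have "z + z = 2 * z" by simp
  then have "\<sigma> z = z" using * by (simp add: eq_neg_iff_add_eq_0)
  then obtain u where "z = \<iota> u" using \<sigma>_fixed by blast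
  then have "\<iota> (u ^ 2) = \<iota> c" using z_square by (simp add: \<iota>.hom_power)
  then show False using c_nonsquare \<iota>_inj by (metis injD)
qed

text \<open>The half trace and the half antitrace divided by \<open>z\<close> are fixed by
  \<open>\<sigma>\<close>, hence lie in the subfield.\<close>

lemma \<iota>_decomp: "\<exists>r s. x = \<iota> r + z * \<iota> s"
proof -
  have s2: "\<sigma> 2 = 2" using \<sigma>.hom_add[of 1 1] by simp
  have "\<sigma> ((x + \<sigma> x) / 2) = (x + \<sigma> x) / 2"
    by (simp add: \<sigma>_divide \<sigma>.hom_add s2 add.commute)
  then obtain r where r: "(x + \<sigma> x) / 2 = \<iota> r" using \<sigma>_fixed by blast
  have "\<sigma> ((x - \<sigma> x) / (2 * z)) = (x - \<sigma> x) / (2 * z)"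
    using two_nz by (simp add: \<sigma>_divide \<sigma>.hom_diff \<sigma>.hom_mult s2 field_simps)
  then obtain s where s: "(x - \<sigma> x) / (2 * z) = \<iota> s" using \<sigma>_fixed by blast
  have "x = (x + \<sigma> x) / 2 + z * ((x - \<sigma> x) / (2 * z))"
    using two_nz by (simp add: add_divide_distrib[symmetric])
  then show ?thesis using r s by auto
qed

text \<open>A generator of the group of norm-one elements. Conjugating a skew polynomial by the
  constant \<open>\<delta>\<close> multiplies its coefficient of \<open>F'\<close> by
  \<open>\<epsilon>\<close>, so \<open>\<epsilon> ^ i\<close> records conjugation by the
  \<open>i\<close>-th power of \<open>d\<close>.\<close>

definition \<epsilon> :: 'b where "\<epsilon> = \<delta> / \<sigma> \<delta>"

lemma \<epsilon>_nz [simp]: "\<epsilon> \<noteq> 0" and \<epsilon>_norm: "\<epsilon> * \<sigma> \<epsilon> = 1"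
  by (simp_all add: \<epsilon>_def \<sigma>_divide)

lemma \<epsilon>_power: "\<epsilon> ^ n = \<delta> ^ n / \<sigma> (\<delta> ^ n)"
  by (simp add: \<epsilon>_def power_divide \<sigma>.hom_power)

lemma \<epsilon>_power_norm: "\<epsilon> ^ n * \<sigma> (\<epsilon> ^ n) = 1"
  by (simp add: \<sigma>.hom_power \<epsilon>_norm flip: power_mult_distrib)

lemma \<sigma>_\<epsilon>_power: "\<sigma> (\<epsilon> ^ n) = 1 / \<epsilon> ^ n"
  using \<epsilon>_power_norm[of n] by (simp add: field_simps)

lemma \<epsilon>_power_eq_1_iff: "\<epsilon> ^ n = 1 \<longleftrightarrow> (q + 1) dvd n"
  using \<sigma>_\<delta>_power_iff[of n] by (auto simp: \<epsilon>_power)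

lemma \<epsilon>_power_inj:
  assumes "i \<le> q" "j \<le> q" "\<epsilon> ^ i = \<epsilon> ^ j"
  shows "i = j"
  using assms
proof (induction i j rule: linorder_wlog)
  case (le i j)
  have "\<epsilon> ^ j = \<epsilon> ^ i * \<epsilon> ^ (j - i)" using le.hyps by (simp only: power_add[symmetric] le_add_diff_inverse)
  then have "\<epsilon> ^ (j - i) = 1" using le by simp
  then have "q + 1 dvd j - i" using \<epsilon>_power_eq_1_iff by blast
  moreover have "j - i < q + 1" using le.prems by simp
  ultimately have "j - i = 0" using nat_dvd_not_less by blast
  then show ?case using le by simp
qed auto

text \<open>The elements of norm one are roots of \<open>T ^ (q + 1) - 1\<close>, and the powers of
  \<open>\<epsilon>\<close> with exponents from 0 to \<open>q\<close> are already
  \<open>q + 1\<close> distinct roots.\<close>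

lemma norm_1_cases:
  assumes "u * \<sigma> u = 1"
  shows "\<exists>i\<le>q. u = \<epsilon> ^ i"
proof -
  define p :: "'b poly" where "p = monom 1 (q + 1) - 1"
  have "coeff p (q + 1) = 1" by (simp add: p_def)
  then have p0: "p \<noteq> 0" by auto
  have roots: "poly p v = 0 \<longleftrightarrow> v * \<sigma> v = 1" for v
    by (simp add: p_def poly_monom \<sigma>_def)
  have "degree p \<le> q + 1"
    unfolding p_def by (intro degree_diff_le degree_monom_le) simp
  moreover have "card ((\<lambda>i. \<epsilon> ^ i) ` {..q}) = q + 1"
    by (subst card_image) (auto intro!: inj_onI \<epsilon>_power_inj)
  ultimately have "card {x. poly p x = 0} \<le> card ((\<lambda>i. \<epsilon> ^ i) ` {..q})"
    using card_poly_roots_bound[OF p0] by simp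
  moreover have "(\<lambda>i. \<epsilon> ^ i) ` {..q} \<subseteq> {x. poly p x = 0}"
    using roots \<epsilon>_power_norm by auto
  ultimately have "(\<lambda>i. \<epsilon> ^ i) ` {..q} = {x. poly p x = 0}"
    by (intro card_seteq) simp_all
  then show ?thesis using roots[of u] assms by blast
qed

text \<open>The value of \<open>(t - 1) / t\<close> at \<open>t = \<tau>\<close>, and at the same
  time the norm of \<open>\<zeta>\<close> by \<open>\<zeta>_mult_\<sigma>\<close>.\<close>

definition \<kappa> :: 'a where "\<kappa> = (\<tau> - 1) / \<tau>"

lemma \<kappa>_nz [simp]: "\<kappa> \<noteq> 0" and \<kappa>_not_1 [simp]: "\<kappa> \<noteq> 1"
  using \<tau>_nz \<tau>_not_1 by (auto simp: \<kappa>_def)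

lemma \<iota>_\<kappa>_not_1 [simp]: "\<iota> \<kappa> \<noteq> 1"
  using \<iota>_inj \<kappa>_not_1 by (metis \<iota>.hom_one injD)

lemma \<zeta>_mult_\<sigma>: "\<zeta> * \<sigma> \<zeta> = \<iota> \<kappa>"
  using \<zeta>_norm by (simp add: \<kappa>_def \<sigma>_def)

lemma norm_\<kappa>_cases:
  assumes "\<iota> \<kappa> * u * \<sigma> u = 1"
  shows "\<exists>j\<le>q. u = \<epsilon> ^ j / \<zeta>"
proof -
  have "(\<zeta> * u) * \<sigma> (\<zeta> * u) = 1"
    using assms by (simp add: \<sigma>.hom_mult mult_ac flip: \<zeta>_mult_\<sigma>)
  then obtain j where "j \<le> q" "\<zeta> * u = \<epsilon> ^ j" using norm_1_cases by blast
  then show ?thesis using \<zeta>_nz by (intro exI[of _ j]) (simp add: field_simps)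
qed

lemma \<epsilon>_\<zeta>_norm: "\<iota> \<kappa> * (\<epsilon> ^ j / \<zeta>) * \<sigma> (\<epsilon> ^ j / \<zeta>) = 1"
  using \<zeta>_nz by (simp add: \<sigma>_divide \<sigma>_\<epsilon>_power flip: \<zeta>_mult_\<sigma>)


section \<open>The system of equations\<close>

lemma eq_mod_subfieldD:
  assumes "eq_mod_subfield \<iota> x y"
  shows "y \<noteq> 0" "x / \<sigma> x = y / \<sigma> y"
  using assms by (auto simp: eq_mod_subfield_def \<sigma>.hom_mult)

lemma eq_mod_subfield_solvable:
  assumes "y \<noteq> 0"
  shows "\<exists>j\<le>q. eq_mod_subfield \<iota> (\<delta> powi (int j - int l)) y"
proof -
  obtain n where n: "y * \<delta> ^ l = \<delta> ^ n" using \<delta>_power_surj[of "y * \<delta> ^ l"] assms by auto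
  \<comment> \<open>Changing the exponent by a multiple of \<open>q + 1\<close> changes the power of
    \<open>\<delta>\<close> only by a factor from the subfield.\<close>
  define j where "j = n mod (q + 1)"
  have "\<sigma> (\<delta> ^ ((q + 1) * (n div (q + 1)))) = \<delta> ^ ((q + 1) * (n div (q + 1)))"
    unfolding \<sigma>_\<delta>_power_iff by (rule dvd_triv_left)
  then obtain u where u: "\<delta> ^ ((q + 1) * (n div (q + 1))) = \<iota> u" using \<sigma>_fixed by blast
  have "\<delta> ^ n = \<delta> ^ ((q + 1) * (n div (q + 1)) + j)"
    unfolding j_def by (simp only: mult_div_mod_eq)
  then have "y * \<delta> ^ l = \<iota> u * \<delta> ^ j" using u n by (simp only: power_add)
  moreover have "u \<noteq> 0" using u by (metis \<delta>_nz \<iota>.hom_zero power_not_zero)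
  ultimately have "\<delta> powi (int j - int l) = \<iota> (1 / u) * y"
    by (simp add: power_int_diff \<iota>_divide field_simps)
  moreover have "j \<le> q" by (simp add: j_def less_Suc_eq_le[symmetric])
  ultimately show ?thesis using assms \<open>u \<noteq> 0\<close>
    by (intro exI[of _ j]) (auto simp: eq_mod_subfield_def intro!: exI[of _ "1 / u"])
qed

lemma \<epsilon>_powi: "\<delta> powi ((int i - int l) * (1 - int q)) = \<epsilon> ^ i / \<epsilon> ^ l"
proof -
  have "\<delta> powi (1 - int q) = \<epsilon>"
    by (simp add: power_int_diff \<epsilon>_def \<sigma>_def)
  then have "\<delta> powi ((1 - int q) * (int i - int l)) = \<epsilon> powi (int i - int l)"
    by (simp add: power_int_mult)
  then show ?thesis by (simp add: power_int_diff mult.commute)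
qed

text \<open>Both right-hand sides must be nonzero. The element \<open>r\<close> below has norm
  \<open>\<kappa>\<close>, which is neither 0 nor 1, so \<open>r\<close> is neither 0 nor 1.\<close>

lemma star_system_solvable: "\<exists>j\<le>q. \<exists>k\<le>q. star_system \<iota> q \<delta> \<zeta> i l j k"
proof -
  define r where "r = \<zeta> * (\<epsilon> ^ i / \<epsilon> ^ l)"
  have "r * \<sigma> r = \<iota> \<kappa>"
    by (simp add: r_def \<sigma>.hom_mult \<sigma>_divide \<sigma>_\<epsilon>_power flip: \<zeta>_mult_\<sigma>)
  then have "r \<noteq> 1" "r \<noteq> 0" by auto
  then have "(1 - r) * \<delta> ^ ((q + 1) div 2) \<noteq> 0" "(1 - 1 / r) * \<delta> ^ ((q + 1) div 2) \<noteq> 0"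
    by auto
  then show ?thesis unfolding star_system_def \<epsilon>_powi r_def[symmetric]
    using eq_mod_subfield_solvable by blast
qed

text \<open>The square \<open>\<delta> ^ (q + 1)\<close> is fixed while the element itself is not,
  since \<open>q + 1\<close> does not divide \<open>(q + 1) div 2\<close>. This factor produces the
  signs in the system, just as \<open>z\<close> does in products of linear skew polynomials.\<close>

lemma \<sigma>_\<delta>_half: "\<sigma> (\<delta> ^ ((q + 1) div 2)) = - (\<delta> ^ ((q + 1) div 2))"
proof -
  let ?h = "\<delta> ^ ((q + 1) div 2)"
  have "(q + 1) div 2 * 2 = q + 1" using odd_q by presburger
  then have "?h ^ 2 = \<delta> ^ (q + 1)" by (simp only: power_mult[symmetric])
  then have "(\<sigma> ?h) ^ 2 = ?h ^ 2"
    using \<sigma>_\<delta>_power_iff[of "q + 1"] by (simp flip: \<sigma>.hom_power)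
  moreover have "\<sigma> ?h \<noteq> ?h"
    unfolding \<sigma>_\<delta>_power_iff using q_ge_3 by (auto dest!: dvd_imp_le)
  ultimately show ?thesis by (simp add: power2_eq_iff)
qed

text \<open>The two conclusions equate the coefficients of \<open>lin u * lin v\<close> and
  \<open>lin v' * lin u'\<close>, as computed in \<open>lin_mult\<close>. They are obtained by
  applying \<open>x / \<sigma> x\<close> to the system: this quotient depends only on the class
  modulo the subfield.\<close>

lemma star_system_imp:
  assumes "star_system \<iota> q \<delta> \<zeta> i l j k"
  defines "u \<equiv> \<epsilon> ^ i" and "u' \<equiv> \<epsilon> ^ k" and "v \<equiv> \<epsilon> ^ j / \<zeta>" and "v' \<equiv> \<epsilon> ^ l / \<zeta>"
  shows "u * \<sigma> v = v' * \<sigma> u'" "v - u = u' - v'"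
proof -
  have nz: "u \<noteq> 0" "u' \<noteq> 0" "v \<noteq> 0" "v' \<noteq> 0" "\<sigma> v' \<noteq> 0"
    using \<zeta>_nz by (simp_all add: u_def u'_def v_def v'_def)
  have \<sigma>u: "\<sigma> u = 1 / u" "\<sigma> u' = 1 / u'" by (simp_all add: u_def u'_def \<sigma>_\<epsilon>_power)
  define h where "h = \<delta> ^ ((q + 1) div 2)"
  have h: "\<sigma> h = - h" "h \<noteq> 0" unfolding h_def by (rule \<sigma>_\<delta>_half) simp
  define r where "r = \<zeta> * (\<epsilon> ^ i / \<epsilon> ^ l)"
  have r: "r = u / v'" using \<zeta>_nz by (simp add: r_def u_def v'_def)
  \<comment> \<open>The quotient sends powers of \<open>\<delta>\<close> to powers of
    \<open>\<epsilon>\<close>, so the unknown exponents turn into the unknowns \<open>v\<close> and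
    \<open>u'\<close>.\<close>
  have frob_quot: "\<delta> powi (int m - int n) / \<sigma> (\<delta> powi (int m - int n)) = \<epsilon> ^ m / \<epsilon> ^ n" for m n
    by (simp add: power_int_diff \<sigma>_divide \<epsilon>_power field_simps)
  have "eq_mod_subfield \<iota> (\<delta> powi (int j - int l)) ((1 - r) * h)"
    and "eq_mod_subfield \<iota> (\<delta> powi (int k - int i)) ((1 - 1 / r) * h)"
    using assms(1) by (simp_all add: star_system_def \<epsilon>_powi r_def h_def)
  note D = eq_mod_subfieldD[OF this(1)] eq_mod_subfieldD[OF this(2)]
  have hq: "(x * h) / \<sigma> (x * h) = - x / \<sigma> x" for x
    using h by (simp add: \<sigma>.hom_mult)
  have r1: "1 - r \<noteq> 0" "1 - 1 / r \<noteq> 0" using D(1,3) by auto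
  have "\<epsilon> ^ j / \<epsilon> ^ l = - (1 - r) / \<sigma> (1 - r)"
    and "\<epsilon> ^ k / \<epsilon> ^ i = - (1 - 1 / r) / \<sigma> (1 - 1 / r)"
    using D(2,4) by (simp_all only: frob_quot hq)
  then have 1: "v / v' = - (1 - r) / \<sigma> (1 - r)" and 2: "u' / u = - (1 - 1 / r) / \<sigma> (1 - 1 / r)"
    using \<zeta>_nz by (simp_all add: u_def u'_def v_def v'_def)
  have s1: "\<sigma> (1 - r) = 1 - 1 / (u * \<sigma> v')" and s2: "\<sigma> (1 - 1 / r) = 1 - u * \<sigma> v'"
    by (simp_all add: r \<sigma>.hom_diff \<sigma>_divide \<sigma>u field_simps)
  \<comment> \<open>In terms of \<open>w\<close> the system becomes linear in \<open>u'\<close> and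
    \<open>v\<close> (\<open>E1\<close> and \<open>E2\<close>), and comparison gives
    \<open>v = u' * w\<close>.\<close>
  define w where "w = u * \<sigma> v'"
  have w: "w \<noteq> 0" "w \<noteq> 1" using nz r1(2) s2 unfolding w_def by (auto simp del: \<sigma>.hom_diff)
  have E1: "u' * (w - 1) = u - v'"
  proof -
    have "u' / u = - (1 - v' / u) / (1 - w)" using 2[unfolded s2, folded w_def] by (simp add: r)
    then have "u * (u' * (w - 1)) = u * (u - v')" using w nz by (simp add: field_simps)
    then show ?thesis using nz by simp
  qed
  have E2: "v * (w - 1) = (u - v') * w"
  proof -
    have "v / v' = - (1 - u / v') / (1 - 1 / w)" using 1[unfolded s1, folded w_def] by (simp add: r)
    then have "v' * (v * (w - 1)) = v' * ((u - v') * w)" using w nz by (simp add: field_simps)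
    then show ?thesis using nz by simp
  qed
  have "v * (w - 1) = u' * (w - 1) * w" by (simp only: E1 E2)
  then have v: "v = u' * w" using w by simp
  then have "\<sigma> v = v' / (u' * u)"
    by (simp add: w_def \<sigma>.hom_mult \<sigma>u)
  then show "u * \<sigma> v = v' * \<sigma> u'" using nz by (simp add: \<sigma>u)
  show "v - u = u' - v'" using E1 by (simp add: v algebra_simps)
qed


section \<open>Skew polynomials as matrices\<close>

abbreviation \<sigma>p :: "'b poly \<Rightarrow> 'b poly" where "\<sigma>p \<equiv> map_poly \<sigma>"

abbreviation \<iota>p :: "'a poly \<Rightarrow> 'b poly" where "\<iota>p \<equiv> map_poly \<iota>"

sublocale \<sigma>p: unital_ring_hom \<sigma>p
  by (rule \<sigma>.map_poly_hom)

sublocale \<iota>p: unital_ring_hom \<iota>p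
  by (rule \<iota>.map_poly_hom)

lemma \<sigma>p_\<sigma>p [simp]: "\<sigma>p (\<sigma>p p) = p"
  by (rule poly_eqI) (simp add: coeff_map_poly)

lemma \<sigma>p_pCons [simp]: "\<sigma>p (pCons a p) = pCons (\<sigma> a) (\<sigma>p p)"
  by (simp add: map_poly_pCons)

lemma \<sigma>p_\<iota>p [simp]: "\<sigma>p (\<iota>p p) = \<iota>p p"
  by (rule poly_eqI) (simp add: coeff_map_poly)

lemma \<sigma>p_eq_0_iff [simp]: "\<sigma>p p = 0 \<longleftrightarrow> p = 0"
  by (rule map_poly_eq_0_iff) simp_all

lemma degree_\<sigma>p [simp]: "degree (\<sigma>p p) = degree p"
  by (cases "p = 0") (simp_all add: map_poly_degree_eq)

lemma poly_\<sigma>p_\<iota>: "poly (\<sigma>p p) (\<iota> k) = \<sigma> (poly p (\<iota> k))"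
  using \<sigma>.poly_map_poly_hom[of p "\<iota> k"] by simp

text \<open>
  \<open>skew x y\<close> stands for the skew polynomial \<open>x + y F\<close> where \<open>F\<^sup>2\<close> is the variable of
  the polynomials and \<open>F\<close> acts on the coefficients by \<open>\<sigma>\<close>; the determinant is the reduced norm.
\<close>
definition skew :: "'b poly \<Rightarrow> 'b poly \<Rightarrow> 'b poly mat2" where
  "skew x y = Mat2 x y ([:0, 1:] * \<sigma>p y) (\<sigma>p x)"

lemma skew_mult:
  "skew x y * skew x' y' = skew (x * x' + [:0, 1:] * y * \<sigma>p y') (x * y' + y * \<sigma>p x')"
  unfolding skew_def times_mat2.simps mat2.inject
  by (simp only: \<sigma>p.hom_add \<sigma>p.hom_mult \<sigma>p_\<sigma>p \<sigma>p_pCons \<sigma>.hom_zero \<sigma>.hom_one map_poly_0 map_poly_1')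
    (simp only: algebra_simps simp_thms)

lemma skew_inject: "skew x y = skew x' y' \<longleftrightarrow> x = x' \<and> y = y'"
  by (auto simp: skew_def)

lemma skew_scal: "\<sigma>p p = p \<Longrightarrow> skew p 0 = scal p"
  by (simp add: skew_def scal_def)

lemma scal_mult_skew: "\<sigma>p p = p \<Longrightarrow> scal p * skew x y = skew (p * x) (p * y)"
  by (simp add: skew_scal[symmetric] skew_mult)

lemma det2_skew: "det2 (skew x y) = x * \<sigma>p x - [:0, 1:] * (y * \<sigma>p y)"
  by (simp add: skew_def algebra_simps)

lemma skew_1: "skew 1 0 = 1"
  by (simp add: skew_def one_mat2_def)

text \<open>The skew polynomial \<open>z (1 + u F')\<close>. If
  \<open>\<iota> k * u * \<sigma> u = 1\<close>, its reduced norm is a constant multiple of the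
  variable minus \<open>\<iota> k\<close>.\<close>

definition lin :: "'b \<Rightarrow> 'b poly mat2" where
  "lin u = skew [:z:] [:z * u:]"

lemma lin_mult: "lin u * lin v = skew [:z * z, - (z * z * (u * \<sigma> v)):] [:z * z * (v - u):]"
  by (simp add: lin_def skew_mult skew_inject \<sigma>.hom_mult algebra_simps)

text \<open>Moving \<open>z\<close> across \<open>F'\<close> changes the sign, so the square is
  \<open>z\<^sup>2 (1 - u F') (1 + u F')\<close>, which is central. This is the source of the
  relations for the squares of \<open>a\<close> and \<open>b\<close>.\<close>

lemma lin_mult_self:
  assumes "\<iota> k * u * \<sigma> u = 1"
  shows "lin u * lin u = scal (smult (\<iota> (- c / k)) [:- \<iota> k, 1:])"
proof -
  have k: "\<iota> k \<noteq> 0" using assms by auto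
  then have "u * \<sigma> u = 1 / \<iota> k" using assms by (simp add: field_simps)
  then have "lin u * lin u = skew (smult (\<iota> (- c / k)) [:- \<iota> k, 1:]) 0"
    unfolding lin_mult z_mult_z using k by (simp add: skew_inject \<iota>_divide \<iota>.hom_uminus)
  also have "\<dots> = scal (smult (\<iota> (- c / k)) [:- \<iota> k, 1:])"
    by (rule skew_scal) (simp add: \<sigma>.hom_uminus \<sigma>.hom_mult)
  finally show ?thesis .
qed


section \<open>Words in the lattice\<close>

text \<open>The letters for \<open>a\<close> and \<open>b\<close> and for their inverses share one
  matrix: its square is a scalar, so it is its own inverse projectively, and no denominators
  arise.\<close>

definition letter :: "lattice_gen \<times> bool \<Rightarrow> 'b poly mat2" where
  "letter y = (case y of
      (GenD, s) \<Rightarrow> skew [:if s then \<delta> else 1 / \<delta>:] 0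
    | (GenA, s) \<Rightarrow> lin 1
    | (GenB, s) \<Rightarrow> lin (1 / \<zeta>))"

definition word :: "lattice_gen gword \<Rightarrow> 'b poly mat2" where
  "word w = prod_list (map letter w)"

lemma word_simps [simp]:
  "word [] = 1" "word (y # w) = letter y * word w" "word (u @ v) = word u * word v"
  by (simp_all add: word_def)

lemma word_d_power: "word (replicate n (GenD, s)) = skew [:(if s then \<delta> else 1 / \<delta>) ^ n:] 0"
  by (induction n) (auto simp: letter_def skew_mult skew_1[symmetric] skew_inject one_pCons)

lemma word_conj_d:
  assumes "letter (y, True) = lin u"
  shows "word (conj_d n y) = lin (\<epsilon> ^ n * u)"
  using assms
  by (simp add: conj_d_def word_d_power lin_def skew_mult skew_inject \<epsilon>_power \<sigma>.hom_power
      \<sigma>_divide power_one_over)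

lemma word_conj_A: "word (conj_d n GenA) = lin (\<epsilon> ^ n)"
  using word_conj_d[of GenA 1 n] by (simp add: letter_def)

lemma word_conj_B: "word (conj_d n GenB) = lin (\<epsilon> ^ n / \<zeta>)"
  using word_conj_d[of GenB "1 / \<zeta>" n] by (simp add: letter_def)

lemma word_is_skew: "\<exists>x y. word w = skew x y"
proof (induction w)
  case Nil
  then show ?case using skew_1 by auto
next
  case (Cons g w)
  have "\<exists>x y. letter g = skew x y"
    by (auto simp: letter_def lin_def split: prod.split lattice_gen.split)
  then show ?case using Cons skew_mult by (metis word_simps(2))
qed

text \<open>These polynomials become units of the coefficient ring
  (\<open>unit_scalars_coeff_units\<close>); they are the scalars by which matrices of words may
  differ.\<close>

definition unit_scalars :: "'b poly set" where
  "unit_scalars = {smult (\<iota> u) ([:-1, 1:] ^ m * [:- \<iota> \<kappa>, 1:] ^ n) | u m n. u \<noteq> 0}"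

lemma unit_scalarsI: "u \<noteq> 0 \<Longrightarrow> smult (\<iota> u) ([:-1, 1:] ^ m * [:- \<iota> \<kappa>, 1:] ^ n) \<in> unit_scalars"
  by (auto simp: unit_scalars_def)

lemma unit_scalars_nz: "s \<in> unit_scalars \<Longrightarrow> s \<noteq> 0"
  by (auto simp: unit_scalars_def)

lemma unit_scalars_1: "1 \<in> unit_scalars"
  using unit_scalarsI[of 1 0 0] by (simp add: one_pCons)

lemma unit_scalars_const: "u \<noteq> 0 \<Longrightarrow> [:\<iota> u:] \<in> unit_scalars"
  using unit_scalarsI[of u 0 0] by (simp add: one_pCons)

lemma unit_scalars_mult: "s \<in> unit_scalars \<Longrightarrow> t \<in> unit_scalars \<Longrightarrow> s * t \<in> unit_scalars"
proof -
  assume "s \<in> unit_scalars" "t \<in> unit_scalars"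
  then obtain u m n u' m' n' where st: "u \<noteq> 0" "u' \<noteq> 0"
    "s = smult (\<iota> u) ([:-1, 1:] ^ m * [:- \<iota> \<kappa>, 1:] ^ n)"
    "t = smult (\<iota> u') ([:-1, 1:] ^ m' * [:- \<iota> \<kappa>, 1:] ^ n')"
    by (auto simp: unit_scalars_def)
  have "s * t = smult (\<iota> (u * u')) ([:-1, 1:] ^ (m + m') * [:- \<iota> \<kappa>, 1:] ^ (n + n'))"
    unfolding st by (simp only: mult_smult_left mult_smult_right smult_smult \<iota>.hom_mult power_add mult_ac)
  then show ?thesis using unit_scalarsI st by simp
qed

lemma lin_square_unit:
  "\<exists>s\<in>unit_scalars. lin 1 * lin 1 = scal s"
  "\<exists>s\<in>unit_scalars. lin (1 / \<zeta>) * lin (1 / \<zeta>) = scal s"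
proof -
  have "smult (\<iota> (- c)) [:-1, 1:] \<in> unit_scalars"
    using unit_scalarsI[of "- c" 1 0] c_nz by simp
  then show "\<exists>s\<in>unit_scalars. lin 1 * lin 1 = scal s"
    using lin_mult_self[of 1 1] by (intro bexI) simp_all
  have "smult (\<iota> (- c / \<kappa>)) [:- \<iota> \<kappa>, 1:] \<in> unit_scalars"
    using unit_scalarsI[of "- c / \<kappa>" 0 1] c_nz by simp
  then show "\<exists>s\<in>unit_scalars. lin (1 / \<zeta>) * lin (1 / \<zeta>) = scal s"
    using lin_mult_self[of \<kappa> "1 / \<zeta>"] \<epsilon>_\<zeta>_norm[of 0] by (intro bexI) simp_all
qed

lemma letter_inverse: "\<exists>s'\<in>unit_scalars. letter (y, s) * letter (y, \<not> s) = scal s'"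
proof (cases y)
  case GenD
  then have "letter (y, s) * letter (y, \<not> s) = skew [:1:] 0"
    by (simp add: letter_def skew_mult skew_inject)
  then have "letter (y, s) * letter (y, \<not> s) = scal 1"
    by (simp add: scal_simps skew_1 one_pCons[symmetric])
  then show ?thesis using unit_scalars_1 by blast
qed (use lin_square_unit in \<open>simp_all add: letter_def\<close>)

text \<open>Scalars stand on both sides because their inverses are in general not
  polynomials.\<close>

definition proj_eq :: "'b poly mat2 \<Rightarrow> 'b poly mat2 \<Rightarrow> bool" where
  "proj_eq M N \<longleftrightarrow> (\<exists>s\<in>unit_scalars. \<exists>t\<in>unit_scalars. scal s * M = scal t * N)"

lemma proj_eq_refl: "proj_eq M M"
  unfolding proj_eq_def using unit_scalars_1 by blast

lemma proj_eq_sym: "proj_eq M N \<Longrightarrow> proj_eq N M"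
  unfolding proj_eq_def by metis

lemma proj_eq_trans:
  assumes "proj_eq M N" "proj_eq N P"
  shows "proj_eq M P"
proof -
  obtain s t s' t' where *: "s \<in> unit_scalars" "t \<in> unit_scalars" "scal s * M = scal t * N"
    "s' \<in> unit_scalars" "t' \<in> unit_scalars" "scal s' * N = scal t' * P"
    using assms unfolding proj_eq_def by blast
  have "scal (s * s') * M = scal s' * (scal s * M)"
    by (simp only: mult.commute[of s s'] scal_simps(4) mult.assoc)
  also have "\<dots> = scal t * (scal s' * N)"
    by (simp only: *(3) scal_left_commute[of "scal s'" t])
  also have "\<dots> = scal (t * t') * P"
    by (simp only: *(6) scal_simps(4) mult.assoc)
  finally show ?thesis unfolding proj_eq_def using * unit_scalars_mult by blast
qed

lemma proj_eq_ctxt: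
  assumes "proj_eq M N"
  shows "proj_eq (U * M * V) (U * N * V)"
proof -
  obtain s t where st: "s \<in> unit_scalars" "t \<in> unit_scalars" "scal s * M = scal t * N"
    using assms unfolding proj_eq_def by blast
  have "scal a * (U * L * V) = U * (scal a * L) * V" for a L
    by (simp only: mult.assoc scal_left_commute[of U a])
  then have "scal s * (U * M * V) = scal t * (U * N * V)" by (simp only: st(3))
  then show ?thesis unfolding proj_eq_def using st by blast
qed

lemma proj_eq_scal: "s \<in> unit_scalars \<Longrightarrow> proj_eq (scal s) 1"
  unfolding proj_eq_def using unit_scalars_1
  by (intro bexI[of _ 1] bexI[of _ s]) (simp_all add: scal_simps)

section \<open>Soundness of the relations\<close>

abbreviation rels where "rels \<equiv> lattice_rels \<iota> q \<delta> \<zeta>"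

abbreviation pres :: "lattice_gen gword \<Rightarrow> lattice_gen gword \<Rightarrow> bool" (infix "\<approx>" 50) where
  "u \<approx> v \<equiv> pres_eq rels u v"

text \<open>The power \<open>\<delta> ^ (q + 1)\<close> lies in the subfield and the squares of
  \<open>a\<close> and \<open>b\<close> are scalars. The remaining relations hold as exact
  equalities of matrices by \<open>star_system_imp\<close>.\<close>

lemma rels_sound:
  assumes "(l, r) \<in> rels"
  shows "proj_eq (word l) (word r)"
proof -
  have "\<exists>u. \<delta> ^ (q + 1) = \<iota> u" using \<sigma>_\<delta>_power_iff[of "q + 1"] by (intro \<sigma>_fixed) simp
  then obtain u where u: "\<delta> ^ (q + 1) = \<iota> u" ..
  then have u0: "u \<noteq> 0" by (metis \<delta>_nz \<iota>.hom_zero power_not_zero)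
  have "word (replicate (q + 1) (GenD, True)) = skew [:\<iota> u:] 0"
    by (simp only: word_d_power if_True u)
  also have "\<dots> = scal [:\<iota> u:]" by (rule skew_scal) simp
  finally have d: "proj_eq (word (replicate (q + 1) (GenD, True))) 1"
    using unit_scalars_const[OF u0] proj_eq_scal by simp
  have a: "proj_eq (lin 1 * lin 1) 1" and b: "proj_eq (lin (1 / \<zeta>) * lin (1 / \<zeta>)) 1"
    using lin_square_unit proj_eq_scal by metis+
  have sq: "word (conj_d i GenA @ conj_d j GenB) = word (conj_d m GenB @ conj_d k GenA)"
    if "star_system \<iota> q \<delta> \<zeta> i m j k" for i j m k
    using star_system_imp[OF that] by (simp add: word_conj_A word_conj_B lin_mult)
  show ?thesis
    using assms d a b sq proj_eq_refl unfolding lattice_rels_def by (auto simp: letter_def)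
qed

lemma pres_sound: "u \<approx> v \<Longrightarrow> proj_eq (word u) (word v)"
proof (induction rule: pres_eq.induct)
  case (pres_cancel u x s v)
  obtain s' where "s' \<in> unit_scalars" "letter (x, s) * letter (x, \<not> s) = scal s'"
    using letter_inverse by blast
  then have "proj_eq (word u * (letter (x, s) * letter (x, \<not> s)) * word v) (word u * 1 * word v)"
    by (intro proj_eq_ctxt) (simp add: proj_eq_scal)
  then show ?case by (simp add: mult.assoc)
next
  case (pres_rel l r u v)
  then show ?case using proj_eq_ctxt[OF rels_sound, of l r "word u" "word v"] by (simp add: mult.assoc)
qed (blast intro: proj_eq_refl proj_eq_sym proj_eq_trans)+


section \<open>Normal forms of words\<close>

lemma pres_d: "replicate (q + 1) (GenD, True) \<approx> []"
  by (rule pres_eq_rel) (simp add: lattice_rels_def)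

lemma pres_d_mult: "replicate ((q + 1) * n) (GenD, True) \<approx> []"
proof (induction n)
  case (Suc n)
  then show ?case using pres_eq_append[OF pres_d Suc] by (simp add: replicate_add[symmetric] add.commute)
qed (simp add: pres_refl)

lemma pres_letter_cancel: "[(x, s), (x, \<not> s)] \<approx> []"
  using pres_cancel[of rels "[]" x s "[]"] by simp

lemma pres_square:
  assumes "x = GenA \<or> x = GenB"
  shows "[(x, True), (x, True)] \<approx> []"
  by (rule pres_eq_rel) (use assms in \<open>auto simp: lattice_rels_def\<close>)

lemma pres_inverse_letter:
  assumes "u @ [(x, True)] \<approx> []"
  shows "[(x, False)] \<approx> u"
proof -
  have "u @ [(x, True), (x, False)] \<approx> u @ []"
    using pres_letter_cancel[of x True] by (intro pres_eq_appendL) simp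
  moreover have "(u @ [(x, True)]) @ [(x, False)] \<approx> [] @ [(x, False)]"
    using assms by (rule pres_eq_appendR)
  ultimately show ?thesis by (simp, blast intro: pres_sym pres_trans)
qed

lemma pres_dinv: "[(GenD, False)] \<approx> replicate q (GenD, True)"
  by (rule pres_inverse_letter) (use pres_d in \<open>simp add: replicate_append_same\<close>)

lemma pres_conj_Suc: "[(GenD, True)] @ conj_d n x \<approx> conj_d (Suc n) x @ [(GenD, True)]"
proof -
  let ?u = "(GenD, True) # replicate n (GenD, True) @ (x, True) # replicate n (GenD, False)"
  have "?u @ [(GenD, False), (GenD, True)] \<approx> ?u @ []"
    using pres_letter_cancel[of GenD False] by (intro pres_eq_appendL) simp
  moreover have "conj_d (Suc n) x @ [(GenD, True)] = ?u @ [(GenD, False), (GenD, True)]"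
    by (simp add: conj_d_def replicate_app_Cons_same)
  moreover have "[(GenD, True)] @ conj_d n x = ?u"
    by (simp add: conj_d_def)
  ultimately show ?thesis by (simp only: append_Nil2 pres_sym)
qed

lemma pres_dd_cancel: "replicate n (GenD, True) @ replicate n (GenD, False) \<approx> []"
  and pres_dd_cancel': "replicate n (GenD, False) @ replicate n (GenD, True) \<approx> []"
  using pres_eq_winv_right[of rels "replicate n (GenD, True)"]
    pres_eq_winv_right[of rels "replicate n (GenD, False)"]
  by (simp_all add: winv_def)

lemma pres_conj_period: "conj_d (q + 1) x \<approx> conj_d 0 x"
proof -
  have "replicate (q + 1) (GenD, False) \<approx> []"
    using pres_eq_appendR[OF pres_d, of "replicate (q + 1) (GenD, False)"]
      pres_dd_cancel[of "q + 1"] by (simp, blast intro: pres_sym pres_trans)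
  then have "replicate (q + 1) (GenD, True) @ [(x, True)] @ replicate (q + 1) (GenD, False)
      \<approx> [] @ [(x, True)] @ []"
    using pres_d by (blast intro: pres_eq_append pres_refl)
  then show ?thesis by (simp add: conj_d_def)
qed

text \<open>Indices of conjugates are kept between 0 and \<open>q\<close>, the range on which
  \<open>\<epsilon> ^ i\<close> is injective.\<close>

definition cyc :: "nat \<Rightarrow> nat" where "cyc i = (if i = q then 0 else Suc i)"

lemma pres_d_conj: "[(GenD, True)] @ conj_d n x \<approx> conj_d (cyc n) x @ [(GenD, True)]"
  using pres_conj_Suc[of n x] pres_eq_appendR[OF pres_conj_period[of x], of "[(GenD, True)]"]
  by (auto simp: cyc_def intro: pres_trans)

lemma pres_conj_square:
  assumes "x = GenA \<or> x = GenB"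
  shows "conj_d n x @ conj_d n x \<approx> []"
proof -
  let ?d = "replicate n (GenD, True)" and ?d' = "replicate n (GenD, False)"
  have "(?d @ [(x, True)]) @ (?d' @ ?d) @ ([(x, True)] @ ?d')
      \<approx> (?d @ [(x, True)]) @ [] @ ([(x, True)] @ ?d')"
    by (rule pres_eq_ctxt[OF pres_dd_cancel'])
  moreover have "?d @ [(x, True), (x, True)] @ ?d' \<approx> ?d @ [] @ ?d'"
    by (rule pres_eq_ctxt[OF pres_square[OF assms]])
  ultimately have "(?d @ [(x, True)]) @ (?d' @ ?d) @ ([(x, True)] @ ?d') \<approx> []"
    using pres_dd_cancel[of n] by (simp, blast intro: pres_trans)
  then show ?thesis by (simp add: conj_d_def)
qed

text \<open>A relation \<open>a_i b_j = b_l a_k\<close>, multiplied by \<open>b_l\<close> on the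
  left and by \<open>b_j\<close> on the right, becomes \<open>b_l a_i = a_k b_j\<close>. Solvability
  of the system supplies such a relation for every pair of \<open>i\<close> and
  \<open>l\<close>.\<close>

lemma pres_BA_swap:
  assumes "i \<le> q" "l \<le> q"
  shows "\<exists>j\<le>q. \<exists>k\<le>q. conj_d l GenB @ conj_d i GenA \<approx> conj_d k GenA @ conj_d j GenB"
proof -
  obtain j k where jk: "j \<le> q" "k \<le> q" "star_system \<iota> q \<delta> \<zeta> i l j k"
    using star_system_solvable by blast
  let ?ai = "conj_d i GenA" and ?bj = "conj_d j GenB" and ?bl = "conj_d l GenB"
    and ?ak = "conj_d k GenA"
  have sq: "?ai @ ?bj \<approx> ?bl @ ?ak"
    by (rule pres_eq_rel) (use jk assms in \<open>auto simp: lattice_rels_def\<close>)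
  have "?bl @ ?ai @ ?bj @ ?bj \<approx> ?bl @ ?ai @ []"
    by (intro pres_eq_appendL pres_conj_square) simp
  moreover have "?bl @ (?ai @ ?bj) @ ?bj \<approx> ?bl @ (?bl @ ?ak) @ ?bj"
    by (rule pres_eq_ctxt[OF sq])
  moreover have "(?bl @ ?bl) @ ?ak @ ?bj \<approx> [] @ ?ak @ ?bj"
    by (intro pres_eq_appendR pres_conj_square) simp
  ultimately have "?bl @ ?ai \<approx> ?ak @ ?bj"
    by (simp, blast intro: pres_sym pres_trans)
  then show ?thesis using jk by blast
qed

section \<open>Sorting words into conjugates of a, conjugates of b and a power of d\<close>

definition conj_list :: "lattice_gen \<Rightarrow> nat list \<Rightarrow> lattice_gen gword" where
  "conj_list x is = concat (map (\<lambda>i. conj_d i x) is)"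

lemma conj_list_simps [simp]:
  "conj_list x [] = []" "conj_list x (i # is) = conj_d i x @ conj_list x is"
  by (simp_all add: conj_list_def)

lemma pres_d_conj_list: "[(GenD, True)] @ conj_list x is \<approx> conj_list x (map cyc is) @ [(GenD, True)]"
proof (induction "is")
  case (Cons i "is")
  have "([(GenD, True)] @ conj_d i x) @ conj_list x is
      \<approx> (conj_d (cyc i) x @ [(GenD, True)]) @ conj_list x is"
    by (rule pres_eq_appendR[OF pres_d_conj])
  moreover have "conj_d (cyc i) x @ ([(GenD, True)] @ conj_list x is)
      \<approx> conj_d (cyc i) x @ (conj_list x (map cyc is) @ [(GenD, True)])"
    by (rule pres_eq_appendL[OF Cons])
  ultimately show ?case by (simp, blast intro: pres_trans)
qed (simp add: pres_refl)

lemma pres_B_conj_list: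
  assumes "set is \<subseteq> {..q}" "l \<le> q"
  shows "\<exists>is' j. set is' \<subseteq> {..q} \<and> j \<le> q \<and>
    conj_d l GenB @ conj_list GenA is \<approx> conj_list GenA is' @ conj_d j GenB"
  using assms
proof (induction "is" arbitrary: l)
  case Nil
  then show ?case by (intro exI[of _ "[]"] exI[of _ l]) (simp add: pres_refl)
next
  case (Cons i "is")
  then obtain j k where jk: "j \<le> q" "k \<le> q"
    "conj_d l GenB @ conj_d i GenA \<approx> conj_d k GenA @ conj_d j GenB"
    using pres_BA_swap[of i l] by auto
  obtain is' j' where IH: "set is' \<subseteq> {..q}" "j' \<le> q"
    "conj_d j GenB @ conj_list GenA is \<approx> conj_list GenA is' @ conj_d j' GenB"
    using Cons.IH[of j] Cons.prems jk by auto
  have "(conj_d l GenB @ conj_d i GenA) @ conj_list GenA is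
      \<approx> (conj_d k GenA @ conj_d j GenB) @ conj_list GenA is"
    by (rule pres_eq_appendR[OF jk(3)])
  moreover have "conj_d k GenA @ (conj_d j GenB @ conj_list GenA is)
      \<approx> conj_d k GenA @ (conj_list GenA is' @ conj_d j' GenB)"
    by (rule pres_eq_appendL[OF IH(3)])
  ultimately have "conj_d l GenB @ conj_list GenA (i # is)
      \<approx> conj_list GenA (k # is') @ conj_d j' GenB"
    by (simp, blast intro: pres_trans)
  then show ?case using IH jk by (intro exI[of _ "k # is'"] exI[of _ j']) simp
qed

definition normal_word :: "nat list \<Rightarrow> nat list \<Rightarrow> nat \<Rightarrow> lattice_gen gword" where
  "normal_word is js k = conj_list GenA is @ conj_list GenB js @ replicate k (GenD, True)"

definition normalizable :: "lattice_gen gword \<Rightarrow> bool" where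
  "normalizable w \<longleftrightarrow>
    (\<exists>is js k. set is \<subseteq> {..q} \<and> set js \<subseteq> {..q} \<and> w \<approx> normal_word is js k)"

lemma normalizable_cong: "u \<approx> v \<Longrightarrow> normalizable v \<Longrightarrow> normalizable u"
  unfolding normalizable_def by (blast intro: pres_trans)

lemma normalizable_d:
  assumes "normalizable w"
  shows "normalizable ((GenD, True) # w)"
proof -
  obtain "is" js k where n: "set is \<subseteq> {..q}" "set js \<subseteq> {..q}" "w \<approx> normal_word is js k"
    using assms unfolding normalizable_def by blast
  let ?d = "[(GenD, True)]" and ?dk = "replicate k (GenD, True)"
  have "?d @ w \<approx> ?d @ normal_word is js k"
    by (rule pres_eq_appendL[OF n(3)])
  moreover have "(?d @ conj_list GenA is) @ conj_list GenB js @ ?dk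
      \<approx> (conj_list GenA (map cyc is) @ ?d) @ conj_list GenB js @ ?dk"
    by (rule pres_eq_appendR[OF pres_d_conj_list])
  moreover have "conj_list GenA (map cyc is) @ (?d @ conj_list GenB js) @ ?dk
      \<approx> conj_list GenA (map cyc is) @ (conj_list GenB (map cyc js) @ ?d) @ ?dk"
    by (rule pres_eq_ctxt[OF pres_d_conj_list])
  ultimately have "?d @ w \<approx> normal_word (map cyc is) (map cyc js) (Suc k)"
    unfolding normal_word_def by (simp, blast intro: pres_trans)
  moreover have "cyc ` {..q} \<subseteq> {..q}" by (auto simp: cyc_def)
  ultimately show ?thesis using n unfolding normalizable_def
    by (intro exI[of _ "map cyc is"] exI[of _ "map cyc js"] exI[of _ "Suc k"]) auto
qed

lemma normalizable_d_power: "normalizable w \<Longrightarrow> normalizable (replicate n (GenD, True) @ w)"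
  by (induction n) (simp_all add: normalizable_d)

lemma normalizable_a:
  assumes "normalizable w"
  shows "normalizable ((GenA, True) # w)"
proof -
  obtain "is" js k where n: "set is \<subseteq> {..q}" "set js \<subseteq> {..q}" "w \<approx> normal_word is js k"
    using assms unfolding normalizable_def by blast
  have "[(GenA, True)] @ w \<approx> [(GenA, True)] @ normal_word is js k"
    by (rule pres_eq_appendL[OF n(3)])
  then have "(GenA, True) # w \<approx> normal_word (0 # is) js k"
    by (simp add: normal_word_def conj_d_def)
  then show ?thesis using n unfolding normalizable_def
    by (intro exI[of _ "0 # is"] exI[of _ js] exI[of _ k]) simp
qed

lemma normalizable_b:
  assumes "normalizable w"
  shows "normalizable ((GenB, True) # w)"
proof -
  obtain "is" js k where n: "set is \<subseteq> {..q}" "set js \<subseteq> {..q}" "w \<approx> normal_word is js k"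
    using assms unfolding normalizable_def by blast
  obtain is' j where s: "set is' \<subseteq> {..q}" "j \<le> q"
    "conj_d 0 GenB @ conj_list GenA is \<approx> conj_list GenA is' @ conj_d j GenB"
    using pres_B_conj_list[OF n(1), of 0] by auto
  have "[(GenB, True)] @ w \<approx> [(GenB, True)] @ normal_word is js k"
    by (rule pres_eq_appendL[OF n(3)])
  moreover have "(conj_d 0 GenB @ conj_list GenA is) @ conj_list GenB js @ replicate k (GenD, True)
     \<approx> (conj_list GenA is' @ conj_d j GenB) @ conj_list GenB js @ replicate k (GenD, True)"
    by (rule pres_eq_appendR[OF s(3)])
  ultimately have "(GenB, True) # w \<approx> normal_word is' (j # js) k"
    by (simp add: normal_word_def conj_d_def, blast intro: pres_trans)
  then show ?thesis using n s unfolding normalizable_def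
    by (intro exI[of _ is'] exI[of _ "j # js"] exI[of _ k]) simp
qed

text \<open>Each positive letter can be absorbed on the left of a normal form. Inverse letters are
  replaced first: the inverse of \<open>d\<close> is its \<open>q\<close>-th power, and
  \<open>a\<close> and \<open>b\<close> are involutions.\<close>

lemma normalizable_word: "normalizable w"
proof (induction w)
  case Nil
  have "[] \<approx> normal_word [] [] 0" by (simp add: normal_word_def pres_refl)
  then show ?case unfolding normalizable_def by (metis empty_subsetI list.set(1))
next
  case (Cons y w)
  obtain x s where y: "y = (x, s)" by (cases y)
  have True_case: "normalizable ((x, True) # w)"
    using Cons normalizable_d normalizable_a normalizable_b by (cases x) auto
  show ?case
  proof (cases s)
    case False
    show ?thesis
    proof (cases "x = GenD")
      case True
      have "[(GenD, False)] @ w \<approx> replicate q (GenD, True) @ w"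
        by (rule pres_eq_appendR[OF pres_dinv])
      then show ?thesis
        using normalizable_cong normalizable_d_power[OF Cons] True False y by simp
    next
      case F: False
      then have "x = GenA \<or> x = GenB" by (cases x) auto
      then have "[(x, False)] \<approx> [(x, True)]"
        using pres_inverse_letter[of "[(x, True)]" x] pres_square by simp
      then have "[(x, False)] @ w \<approx> [(x, True)] @ w" by (rule pres_eq_appendR)
      then show ?thesis using normalizable_cong True_case False y by simp
    qed
  qed (use True_case y in simp)
qed

lemma pres_conj_list_reduced:
  assumes "x = GenA \<or> x = GenB" "set is \<subseteq> {..q}"
  shows "\<exists>is'. set is' \<subseteq> {..q} \<and> distinct_adj is' \<and> conj_list x is \<approx> conj_list x is'"
  using assms(2)
proof (induction "is")
  case Nil
  then show ?case by (intro exI[of _ "[]"]) (simp add: pres_refl)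
next
  case (Cons i "is")
  then obtain is' where IH: "set is' \<subseteq> {..q}" "distinct_adj is'" "conj_list x is \<approx> conj_list x is'"
    by auto
  have *: "conj_list x (i # is) \<approx> conj_list x (i # is')"
    using pres_eq_appendL[OF IH(3)] by simp
  show ?case
  \<comment> \<open>A new entry either cancels against an equal head or extends the reduced
    list.\<close>
  proof (cases "is' \<noteq> [] \<and> hd is' = i")
    case True
    then obtain r where r: "is' = i # r" by (cases is') auto
    have "(conj_d i x @ conj_d i x) @ conj_list x r \<approx> [] @ conj_list x r"
      by (rule pres_eq_appendR[OF pres_conj_square[OF assms(1)]])
    then have "conj_list x (i # is) \<approx> conj_list x r"
      using * pres_trans unfolding r by simp blast
    then show ?thesis using IH r by (intro exI[of _ r]) (auto simp: distinct_adj_Cons)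
  next
    case False
    then show ?thesis using IH * Cons.prems
      by (intro exI[of _ "i # is'"]) (auto simp: distinct_adj_Cons)
  qed
qed

lemma reduced_normal_form:
  "\<exists>is js k. set is \<subseteq> {..q} \<and> set js \<subseteq> {..q} \<and> distinct_adj is \<and> distinct_adj js \<and>
    w \<approx> normal_word is js k"
proof -
  obtain "is" js k where n: "set is \<subseteq> {..q}" "set js \<subseteq> {..q}" "w \<approx> normal_word is js k"
    using normalizable_word unfolding normalizable_def by blast
  obtain is' where i: "set is' \<subseteq> {..q}" "distinct_adj is'" "conj_list GenA is \<approx> conj_list GenA is'"
    using pres_conj_list_reduced[OF _ n(1)] by blast
  obtain js' where j: "set js' \<subseteq> {..q}" "distinct_adj js'" "conj_list GenB js \<approx> conj_list GenB js'"
    using pres_conj_list_reduced[OF _ n(2)] by blast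
  have "normal_word is js k \<approx> normal_word is' js' k"
    unfolding normal_word_def by (intro pres_eq_append i j pres_refl)
  then show ?thesis using n(3) i j pres_trans by blast
qed


section \<open>Faithfulness of the representation\<close>

abbreviation ev :: "'a \<Rightarrow> 'b poly mat2 \<Rightarrow> 'b mat2" where
  "ev k \<equiv> map_mat2 (\<lambda>p. poly p (\<iota> k))"

lemmas ev_hom = unital_ring_hom.map_mat2_hom(1-5)[OF unital_ring_hom_poly]

lemma ev_lin:
  "ev k (lin u) = Mat2 z (z * u) (- (\<iota> k * z * \<sigma> u)) (- z)"
  by (simp add: lin_def skew_def \<sigma>.hom_mult)

lemma det2_ev_lin:
  assumes "\<iota> m * u * \<sigma> u = 1"
  shows "det2 (ev k (lin u)) = 0 \<longleftrightarrow> k = m"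
proof -
  have "det2 (ev k (lin u)) = z * z * (\<iota> k * u * \<sigma> u - 1)"
    by (simp add: ev_lin algebra_simps)
  also have "\<dots> = z * z * ((\<iota> k - \<iota> m) * (u * \<sigma> u))"
    using assms by (simp add: algebra_simps)
  finally have *: "det2 (ev k (lin u)) = z * z * ((\<iota> k - \<iota> m) * (u * \<sigma> u))" .
  have "u \<noteq> 0" using assms by auto
  then show ?thesis using \<iota>_inj unfolding * by (auto dest: injD)
qed

text \<open>
  At its zero the linear factor has rank one, and the kernel of each factor meets the image of the
  next one trivially unless the two factors agree.
\<close>
lemma reduced_product_ev:
  assumes "distinct_adj us" "us \<noteq> []" "\<forall>u\<in>set us. \<iota> k * u * \<sigma> u = 1"
  shows "m11 (ev k (prod_list (map lin us))) \<noteq> 0 \<and>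
    m21 (ev k (prod_list (map lin us))) = - (\<iota> k * \<sigma> (hd us)) * m11 (ev k (prod_list (map lin us)))"
  using assms
proof (induction us)
  case (Cons u us)
  show ?case
  proof (cases "us = []")
    case True
    then show ?thesis by (simp add: ev_lin)
  next
    case False
    then obtain v vs where us: "us = v # vs" by (cases us) auto
    obtain a b c' d where P: "ev k (prod_list (map lin us)) = Mat2 a b c' d"
      by (cases "ev k (prod_list (map lin us))")
    \<comment> \<open>The invariant says that the first column is a nonzero vector on the image line
      of the leading factor.\<close>
    have IH: "a \<noteq> 0" "c' = - (\<iota> k * \<sigma> v) * a"
      using Cons.IH Cons.prems False P us by (auto simp: distinct_adj_Cons)
    have "ev k (prod_list (map lin (u # us))) = ev k (lin u) * Mat2 a b c' d"
      by (simp only: list.map prod_list.Cons ev_hom P)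
    then have E: "m11 (ev k (prod_list (map lin (u # us)))) = z * a * (1 - \<iota> k * u * \<sigma> v)"
      "m21 (ev k (prod_list (map lin (u # us)))) = - (\<iota> k * z * \<sigma> u * a) - z * c'"
      by (simp_all add: ev_lin IH(2) algebra_simps)
    have uv: "u \<noteq> v" "\<iota> k * u * \<sigma> u = 1" "\<iota> k * v * \<sigma> v = 1"
      using Cons.prems us by (auto simp: distinct_adj_Cons)
    have "\<iota> k * u * \<sigma> v \<noteq> 1"
    proof
      assume "\<iota> k * u * \<sigma> v = 1"
      then have "(u - v) * (\<iota> k * \<sigma> v) = 0" using uv by (simp add: algebra_simps)
      then show False using uv by auto
    qed
    moreover have "\<iota> k * \<sigma> u * (1 - \<iota> k * u * \<sigma> v) = \<iota> k * \<sigma> u - \<iota> k * \<sigma> v * (\<iota> k * u * \<sigma> u)"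
      by (simp add: algebra_simps)
    then have "\<iota> k * \<sigma> u * (1 - \<iota> k * u * \<sigma> v) = \<iota> k * \<sigma> u - \<iota> k * \<sigma> v"
      using uv by simp
    then have "- (\<iota> k * z * \<sigma> u * a) - z * c' = - (\<iota> k * \<sigma> u) * (z * a * (1 - \<iota> k * u * \<sigma> v))"
      unfolding IH(2) by (simp add: algebra_simps)
    ultimately show ?thesis using IH(1) unfolding E by simp
  qed
qed simp

lemma det2_ev_prod:
  assumes "\<forall>u\<in>set us. \<iota> m * u * \<sigma> u = 1"
  shows "det2 (ev k (prod_list (map lin us))) = 0 \<longleftrightarrow> us \<noteq> [] \<and> k = m"
  using assms by (induction us) (auto simp: ev_hom det2_mult det2_ev_lin)

lemma word_conj_list:
  "word (conj_list GenA is) = prod_list (map lin (map (\<lambda>i. \<epsilon> ^ i) is))"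
  "word (conj_list GenB is) = prod_list (map lin (map (\<lambda>i. \<epsilon> ^ i / \<zeta>) is))"
  by (induction "is") (simp_all add: word_conj_A word_conj_B)

lemma distinct_adj_map_\<epsilon>:
  assumes "distinct_adj is" "set is \<subseteq> {..q}"
  shows "distinct_adj (map (\<lambda>i. \<epsilon> ^ i) is)" "distinct_adj (map (\<lambda>i. \<epsilon> ^ i / \<zeta>) is)"
proof -
  have "inj_on (\<lambda>i. \<epsilon> ^ i) {..q}" "inj_on (\<lambda>i. \<epsilon> ^ i / \<zeta>) {..q}"
    using \<epsilon>_power_inj \<zeta>_nz by (auto intro!: inj_onI)
  then show "distinct_adj (map (\<lambda>i. \<epsilon> ^ i) is)" "distinct_adj (map (\<lambda>i. \<epsilon> ^ i / \<zeta>) is)"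
    using distinct_adj_mapI[OF assms(1)] inj_on_subset[OF _ assms(2)] by blast+
qed

lemma word_scalar_imp_trivial:
  assumes "scal p * word w = scal r" "p \<noteq> 0"
  shows "w \<approx> []"
proof -
  obtain "is" js k where n: "set is \<subseteq> {..q}" "set js \<subseteq> {..q}" "distinct_adj is" "distinct_adj js"
    "w \<approx> normal_word is js k" using reduced_normal_form by blast
  define us where "us = map (\<lambda>i. \<epsilon> ^ i) is"
  define vs where "vs = map (\<lambda>i. \<epsilon> ^ i / \<zeta>) js"
  define A where "A = prod_list (map lin us)"
  define B where "B = prod_list (map lin vs)"
  define D where "D = skew [:\<delta> ^ k:] 0"
  have N: "word (normal_word is js k) = A * B * D"
    by (simp add: normal_word_def word_conj_list word_d_power A_def B_def D_def us_def vs_def mult.assoc)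
  obtain s t where st: "s \<in> unit_scalars" "t \<in> unit_scalars" "scal s * word w = scal t * (A * B * D)"
    using pres_sound[OF n(5)] unfolding N proj_eq_def by blast
  have "scal (p * t) * (A * B * D) = scal (s * r)"
    using assms(1) st(3) by (simp add: scal_simps mult.assoc) (metis scal_left_commute)
  moreover have pt: "p * t \<noteq> 0" using assms(2) unit_scalars_nz[OF st(2)] by simp
  \<comment> \<open>The common nonzero factor \<open>p * t\<close> cancels entry by entry, so the
    product itself is scalar over the polynomials.\<close>
  ultimately have "\<exists>e. A * B * D = scal e"
  proof (cases "A * B * D")
    case (Mat2 a b c' d)
    then have "p * t * a = p * t * d" "p * t * b = 0" "p * t * c' = 0"
      using \<open>scal (p * t) * (A * B * D) = scal (s * r)\<close> by (simp_all add: scal_def)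
    then show ?thesis using pt Mat2 by (simp add: scal_def)
  qed
  then obtain e where e: "A * B * D = scal e" by blast
  have us: "\<forall>u\<in>set us. \<iota> 1 * u * \<sigma> u = 1" using \<epsilon>_power_norm by (auto simp: us_def)
  have vs: "\<forall>v\<in>set vs. \<iota> \<kappa> * v * \<sigma> v = 1" using \<epsilon>_\<zeta>_norm by (auto simp: vs_def)
  have D: "det2 (ev m D) \<noteq> 0" for m
    by (simp add: D_def skew_def)
  have dets: "poly e (\<iota> m) * poly e (\<iota> m) = det2 (ev m A) * det2 (ev m B) * det2 (ev m D)" for m
  proof -
    have "ev m A * ev m B * ev m D = ev m (A * B * D)" by (simp only: ev_hom)
    also have "\<dots> = scal (poly e (\<iota> m))" by (simp only: e ev_hom)
    finally show ?thesis by (metis det2_mult det2_scal)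
  qed
  have zero: "ev m A * ev m B * ev m D = 0" if "poly e (\<iota> m) = 0" for m
  proof -
    have "ev m A * ev m B * ev m D = ev m (A * B * D)" by (simp only: ev_hom)
    also have "\<dots> = scal (poly e (\<iota> m))" by (simp only: e ev_hom)
    finally show ?thesis using that by (simp add: scal_simps)
  qed
  \<comment> \<open>At 1 the factors to the right of \<open>A\<close> are invertible, so vanishing
    of the product would pass to \<open>A\<close>, against
    \<open>reduced_product_ev\<close>.\<close>
  have "us = []"
  proof (rule ccontr)
    assume ne: "us \<noteq> []"
    then have "det2 (ev 1 A) = 0" unfolding A_def using det2_ev_prod[OF us] by blast
    then have "poly e (\<iota> 1) = 0" using dets[of 1] by simp
    then have "ev 1 A * (ev 1 B * ev 1 D) = 0" using zero[of 1] by (simp only: mult.assoc)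
    moreover have "det2 (ev 1 B) \<noteq> 0"
      unfolding B_def using det2_ev_prod[OF vs, of 1] \<kappa>_not_1 by metis
    then have "det2 (ev 1 B * ev 1 D) \<noteq> 0"
      using D[of 1] by (simp only: det2_mult mult_eq_0_iff simp_thms)
    ultimately have "ev 1 A = 0" by (rule mat2_mult_eq_0_right)
    moreover have "m11 (ev 1 A) \<noteq> 0" unfolding A_def
      by (rule reduced_product_ev[THEN conjunct1])
        (use ne us distinct_adj_map_\<epsilon>[OF n(3,1)] in \<open>simp_all add: us_def\<close>)
    ultimately show False by (simp add: zero_mat2_def)
  qed
  \<comment> \<open>At \<open>\<kappa>\<close> it is \<open>A\<close> and \<open>D\<close> that are
    invertible and can be removed from both sides of \<open>B\<close>.\<close>
  moreover have "vs = []"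
  proof (rule ccontr)
    assume ne: "vs \<noteq> []"
    then have "det2 (ev \<kappa> B) = 0" unfolding B_def using det2_ev_prod[OF vs] by blast
    then have "poly e (\<iota> \<kappa>) = 0" using dets[of \<kappa>] by simp
    then have "ev \<kappa> A * (ev \<kappa> B * ev \<kappa> D) = 0" using zero by (simp add: mult.assoc)
    moreover have "det2 (ev \<kappa> A) \<noteq> 0"
      unfolding A_def using det2_ev_prod[OF us, of \<kappa>] \<kappa>_not_1 by metis
    ultimately have "ev \<kappa> B * ev \<kappa> D = 0" using mat2_mult_eq_0_left by blast
    then have "ev \<kappa> B = 0" using D[of \<kappa>] by (rule mat2_mult_eq_0_right)
    moreover have "m11 (ev \<kappa> B) \<noteq> 0" unfolding B_def
      by (rule reduced_product_ev[THEN conjunct1])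
        (use ne vs distinct_adj_map_\<epsilon>[OF n(4,2)] in \<open>simp_all add: vs_def\<close>)
    ultimately show False by (simp add: zero_mat2_def)
  qed
  ultimately have nil: "is = []" "js = []" and "D = scal e"
    using e by (simp_all add: us_def vs_def A_def B_def)
  \<comment> \<open>A constant skew polynomial is a scalar matrix only if its value is fixed by
    \<open>\<sigma>\<close>; then \<open>q + 1\<close> divides \<open>k\<close>, and the power of
    \<open>d\<close> is trivial in the presented group.\<close>
  then have "\<sigma> (\<delta> ^ k) = \<delta> ^ k" by (auto simp: D_def skew_def scal_def)
  then have "(q + 1) dvd k" by (simp only: \<sigma>_\<delta>_power_iff)
  then have "normal_word is js k \<approx> []"
    using pres_d_mult by (auto simp: normal_word_def nil elim!: dvdE)
  then show ?thesis using n(5) pres_trans by blast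
qed

text \<open>Equality up to scalars makes the matrix of \<open>winv v @ u\<close> scalar up to a
  nonzero factor, so that \<open>word_scalar_imp_trivial\<close> applies.\<close>

lemma word_faithful:
  assumes "scal p * word u = scal r * word v" "p \<noteq> 0"
  shows "u \<approx> v"
proof -
  obtain s t where st: "t \<in> unit_scalars" "s \<in> unit_scalars"
    "scal s * word (winv v @ v) = scal t * 1"
    using pres_sound[OF pres_eq_winv_left[of rels v]] unfolding proj_eq_def by auto
  have "scal (s * p) * word (winv v @ u) = scal s * (word (winv v) * (scal p * word u))"
    by (simp only: scal_simps(4) word_simps(3) mult.assoc scal_left_commute[of "word (winv v)" p])
  also have "\<dots> = scal r * (scal s * word (winv v @ v))"
    by (simp only: assms(1) word_simps(3) scal_left_commute[of "word (winv v)" r]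
        scal_left_commute[of "scal s" r])
  also have "\<dots> = scal (r * t)" by (simp only: st(3) scal_simps(4) mult_1_right)
  finally have "winv v @ u \<approx> []"
    by (rule word_scalar_imp_trivial) (use assms unit_scalars_nz[OF st(2)] in simp)
  then have "v @ (winv v @ u) \<approx> v @ []" by (rule pres_eq_appendL)
  moreover have "(v @ winv v) @ u \<approx> [] @ u" by (rule pres_eq_appendR[OF pres_eq_winv_right])
  ultimately show ?thesis by (simp, blast intro: pres_sym pres_trans)
qed


section \<open>Factorisation into generators\<close>

lemma skew_eq_const:
  assumes "degree (det2 (skew x y)) = 0" "det2 (skew x y) \<noteq> 0"
  shows "\<exists>a. a \<noteq> 0 \<and> skew x y = skew [:a:] 0"
proof -
  let ?N = "x * \<sigma>p x" and ?M = "[:0, 1:] * (y * \<sigma>p y)"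
  have degN: "degree ?N = 2 * degree x"
    by (cases "x = 0") (simp_all add: degree_mult_eq)
  have y: "y = 0"
  proof (rule ccontr)
    assume "y \<noteq> 0"
    then have degM: "degree ?M = 2 * degree y + 1"
      by (simp add: degree_mult_eq del: mult_pCons_left)
    \<comment> \<open>An even and an odd degree: the two terms of the norm cannot cancel.\<close>
    have "degree ?N \<noteq> degree ?M" unfolding degN degM by presburger
    then consider "degree ?N < degree (- ?M)" | "degree (- ?M) < degree ?N"
      unfolding degree_minus by linarith
    then have "degree ?M \<le> degree (?N + - ?M)"
    proof cases
      case 1
      then show ?thesis using degree_add_eq_right by (metis degree_minus order_refl)
    next
      case 2
      then show ?thesis using degree_add_eq_left by (metis degree_minus less_imp_le)
    qed
    then have "degree ?M \<le> degree (?N - ?M)" by (simp only: diff_conv_add_uminus)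
    then show False using assms(1) degM unfolding det2_skew by simp
  qed
  then have "degree x = 0" using assms(1) degN unfolding det2_skew by simp
  then obtain a where a: "x = [:a:]" by (rule degree_eq_zeroE)
  then show ?thesis using y assms(2) by (auto simp: skew_def)
qed

lemma const_word: "a \<noteq> 0 \<Longrightarrow> \<exists>w. skew [:a:] 0 = word w"
  using \<delta>_power_surj[of a] word_d_power[of _ True] by (metis)

definition loc_poly :: "'b poly" where "loc_poly = [:-1, 1:] * [:- \<iota> \<kappa>, 1:]"

text \<open>At the zero of the norm either both coefficients vanish and the central linear
  polynomial splits off, or \<open>1 - u F'\<close> for a suitable \<open>u\<close> multiplies the
  skew polynomial into a multiple of that central polynomial. Multiplying back by
  \<open>1 + u F'\<close> exhibits the linear left factor.\<close>

lemma descent_step: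
  assumes "poly (det2 (skew x y)) (\<iota> k) = 0" "k \<noteq> 0" "det2 (skew x y) \<noteq> 0"
  shows "(\<exists>x' y'. skew x y = scal [:- \<iota> k, 1:] * skew x' y') \<or>
    (\<exists>u a x' y'. a \<noteq> 0 \<and> \<iota> k * u * \<sigma> u = 1 \<and> skew x y = skew [:a:] 0 * lin u * skew x' y')"
proof -
  let ?\<pi> = "[:- \<iota> k, 1:]"
  define x0 where "x0 = poly x (\<iota> k)"
  define y0 where "y0 = poly y (\<iota> k)"
  have \<pi>: "\<sigma>p ?\<pi> = ?\<pi>" by (simp add: \<sigma>.hom_uminus)
  have norm: "x0 * \<sigma> x0 = \<iota> k * y0 * \<sigma> y0"
    using assms(1) by (simp add: det2_skew x0_def y0_def poly_\<sigma>p_\<iota> algebra_simps)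
  show ?thesis
  proof (cases "x0 = 0")
    case True
    then have "y0 = 0" using norm assms(2) by auto
    with True obtain x' y' where "x = ?\<pi> * x'" "y = ?\<pi> * y'"
      by (auto simp: x0_def y0_def poly_eq_0_iff_dvd elim!: dvdE)
    then show ?thesis using scal_mult_skew[OF \<pi>] by metis
  next
    case False
    \<comment> \<open>This choice makes the second coefficient of \<open>(1 - u F')\<close> times
      \<open>skew x y\<close> vanish at \<open>\<iota> k\<close>; the vanishing norm does the same
      for the first.\<close>
    define u where "u = y0 / \<sigma> x0"
    have "\<iota> k * y0 * \<sigma> y0 / (x0 * \<sigma> x0) = 1"
      by (simp only: norm[symmetric]) (use False in simp)
    then have u: "\<iota> k * u * \<sigma> u = 1" by (simp add: u_def \<sigma>_divide mult.commute)
    have "x0 - \<iota> k * u * \<sigma> y0 = (x0 * \<sigma> x0 - \<iota> k * y0 * \<sigma> y0) / \<sigma> x0"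
      using False by (simp add: u_def diff_divide_distrib mult.commute)
    then have "poly (x - [:0, u:] * \<sigma>p y) (\<iota> k) = 0" "poly (y - [:u:] * \<sigma>p x) (\<iota> k) = 0"
      using norm False
      by (simp_all add: x0_def[symmetric] y0_def[symmetric] poly_\<sigma>p_\<iota> u_def mult.assoc)
    then obtain x' y' where XY': "x - [:0, u:] * \<sigma>p y = ?\<pi> * x'" "y - [:u:] * \<sigma>p x = ?\<pi> * y'"
      by (metis poly_eq_0_iff_dvd dvdE)
    have "skew 1 [:- u:] * skew x y = skew (x - [:0, u:] * \<sigma>p y) (y - [:u:] * \<sigma>p x)"
      by (simp add: skew_mult skew_inject)
    then have *: "skew 1 [:- u:] * skew x y = scal ?\<pi> * skew x' y'"
      by (simp only: XY' scal_mult_skew[OF \<pi>])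
    have k: "\<iota> k \<noteq> 0" using assms(2) by simp
    have uu: "u * \<sigma> u = 1 / \<iota> k" using u k by (simp add: field_simps)
    \<comment> \<open>The product is \<open>1 - u * \<sigma> u\<close> times the variable, a
      constant multiple of the central polynomial, which therefore cancels on both sides.\<close>
    have "skew 1 [:u:] * skew 1 [:- u:] = skew [:1, - (u * \<sigma> u):] 0"
      by (simp add: skew_mult skew_inject \<sigma>.hom_uminus one_pCons)
    also have "\<dots> = skew (smult (- 1 / \<iota> k) ?\<pi>) 0"
      using k by (simp add: skew_inject uu)
    also have "\<dots> = scal (smult (- 1 / \<iota> k) ?\<pi>)"
      by (rule skew_scal) (simp add: \<sigma>.hom_uminus \<sigma>_divide)
    finally have "scal (smult (- 1 / \<iota> k) ?\<pi>) * skew x y = skew 1 [:u:] * (skew 1 [:- u:] * skew x y)"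
      by (simp flip: mult.assoc)
    also have "\<dots> = scal ?\<pi> * (skew 1 [:u:] * skew x' y')"
      by (simp only: * scal_left_commute)
    finally have "scal ?\<pi> * (scal [:- 1 / \<iota> k:] * skew x y) = scal ?\<pi> * (skew 1 [:u:] * skew x' y')"
      by (simp add: scal_simps(4)[symmetric] mult.assoc[symmetric])
    then have "scal [:- 1 / \<iota> k:] * skew x y = skew 1 [:u:] * skew x' y'"
      by (rule scal_mult_cancel) simp
    then have "scal [:- \<iota> k:] * (scal [:- 1 / \<iota> k:] * skew x y) = scal [:- \<iota> k:] * (skew 1 [:u:] * skew x' y')"
      by simp
    moreover have "scal [:- \<iota> k:] * (scal [:- 1 / \<iota> k:] * skew x y) = skew x y"
      using k by (simp add: mult.assoc[symmetric] scal_simps(4)[symmetric] scal_simps(2) flip: one_pCons)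
    moreover have "scal [:- \<iota> k:] = skew [:- \<iota> k:] 0"
      by (rule skew_scal[symmetric]) (simp add: \<sigma>.hom_uminus)
    moreover have "skew [:- \<iota> k:] 0 * skew 1 [:u:] = skew [:- \<iota> k / z:] 0 * lin u"
      by (simp add: lin_def skew_mult skew_inject)
    ultimately have "skew x y = skew [:- \<iota> k / z:] 0 * lin u * skew x' y'"
      by (simp flip: mult.assoc)
    moreover have "- \<iota> k / z \<noteq> 0" using k by simp
    ultimately show ?thesis using u by blast
  qed
qed

lemma degree_det2_lin: "\<iota> k * u * \<sigma> u = 1 \<Longrightarrow> degree (det2 (lin u)) = 1"
proof -
  assume "\<iota> k * u * \<sigma> u = 1"
  then have "u * \<sigma> u \<noteq> 0" by auto
  then show ?thesis by (simp add: lin_def det2_skew \<sigma>.hom_mult)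
qed

text \<open>The cofactor must vanish at \<open>a\<close> because \<open>p\<close> does not, so the
  linear factor divides the cofactor.\<close>

lemma dvd_linear_mult_cancel:
  fixes p r :: "'k::field poly"
  assumes "p dvd [:- a, 1:] * r" "poly p a \<noteq> 0"
  shows "p dvd r"
proof -
  obtain s where s: "[:- a, 1:] * r = p * s" using assms(1) by (rule dvdE)
  have "poly p a * poly s a = 0" using arg_cong[OF s, of "\<lambda>f. poly f a"] by simp
  then obtain s' where "s = [:- a, 1:] * s'" using assms(2) by (auto simp: poly_eq_0_iff_dvd elim: dvdE)
  then have "[:- a, 1:] * r = [:- a, 1:] * (p * s')" using s by (simp only: mult_ac)
  then have "r = p * s'" by (rule mult_left_cancel[THEN iffD1, rotated]) simp
  then show ?thesis by simp
qed

lemma dvd_loc_poly_power_imp_unit: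
  assumes "p dvd loc_poly ^ N" "poly p 1 \<noteq> 0" "poly p (\<iota> \<kappa>) \<noteq> 0"
  shows "is_unit p"
  using assms(1)
proof (induction N)
  case (Suc N)
  then have "p dvd [:- 1, 1:] * ([:- \<iota> \<kappa>, 1:] * loc_poly ^ N)"
    by (simp only: power_Suc loc_poly_def mult.assoc)
  then show ?case using Suc.IH dvd_linear_mult_cancel assms by blast
qed simp

text \<open>Induction on the degree of the norm. A central factor lowers it by two and a linear
  factor by one; without a zero at 1 or \<open>\<iota> \<kappa>\<close> the norm is a unit and the
  skew polynomial is constant.\<close>

lemma skew_factorisation:
  assumes "det2 (skew x y) dvd loc_poly ^ N"
  shows "\<exists>w m n. skew x y = scal ([:-1, 1:] ^ m * [:- \<iota> \<kappa>, 1:] ^ n) * word w"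
  using assms
proof (induction "degree (det2 (skew x y))" arbitrary: x y rule: less_induct)
  case less
  have P0: "loc_poly \<noteq> 0" by (simp add: loc_poly_def)
  then have nz: "det2 (skew x y) \<noteq> 0" using less.prems by auto
  show ?case
  proof (cases "\<exists>k\<in>{1, \<kappa>}. poly (det2 (skew x y)) (\<iota> k) = 0")
    case False
    have "is_unit (det2 (skew x y))"
      by (rule dvd_loc_poly_power_imp_unit[OF less.prems]) (use False in auto)
    then have "degree (det2 (skew x y)) = 0" by (auto simp: is_unit_poly_iff)
    then obtain a where "a \<noteq> 0" "skew x y = skew [:a:] 0" using skew_eq_const nz by blast
    then obtain w where "skew x y = word w" using const_word by metis
    then show ?thesis by (intro exI[of _ w] exI[of _ 0]) (simp add: scal_simps)
  next
    case True
    then obtain k where k: "k \<in> {1, \<kappa>}" "poly (det2 (skew x y)) (\<iota> k) = 0" by blast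
    then have k0: "k \<noteq> 0" by auto
    from descent_step[OF k(2) k0 nz] show ?thesis
    proof (elim disjE exE conjE)
      fix x' y' assume XY: "skew x y = scal [:- \<iota> k, 1:] * skew x' y'"
      have d: "det2 (skew x y) = [:- \<iota> k, 1:] * [:- \<iota> k, 1:] * det2 (skew x' y')"
        unfolding XY det2_mult det2_scal ..
      then have nz': "det2 (skew x' y') \<noteq> 0" using nz by auto
      have "degree (det2 (skew x' y')) < degree (det2 (skew x y))"
        unfolding d using nz' by (simp add: degree_mult_eq del: mult_pCons_left mult_pCons_right)
      moreover have "det2 (skew x' y') dvd loc_poly ^ N"
        using less.prems unfolding d by (rule dvd_mult_right)
      ultimately obtain w m n where
        w: "skew x' y' = scal ([:-1, 1:] ^ m * [:- \<iota> \<kappa>, 1:] ^ n) * word w"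
        using less.hyps by blast
      have "skew x y = scal ([:- \<iota> k, 1:] * ([:-1, 1:] ^ m * [:- \<iota> \<kappa>, 1:] ^ n)) * word w"
        unfolding XY w by (simp only: scal_simps(4) mult.assoc)
      moreover have "[:- \<iota> k, 1:] * ([:-1, 1:] ^ m * [:- \<iota> \<kappa>, 1:] ^ n) =
          (if k = 1 then [:-1, 1:] ^ Suc m * [:- \<iota> \<kappa>, 1:] ^ n else [:-1, 1:] ^ m * [:- \<iota> \<kappa>, 1:] ^ Suc n)"
        using k(1) by (auto simp only: power_Suc mult_ac insert_iff empty_iff \<iota>.hom_one split: if_splits)
      ultimately show ?thesis by (metis (full_types))
    next
      fix u a x' y'
      assume a: "a \<noteq> 0" and u: "\<iota> k * u * \<sigma> u = 1"
        and XY: "skew x y = skew [:a:] 0 * lin u * skew x' y'"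
      \<comment> \<open>The norm condition leaves only the parameters \<open>\<epsilon> ^ i\<close>
        or \<open>\<epsilon> ^ i / \<zeta>\<close>, which belong to the conjugates of
        \<open>a\<close> and \<open>b\<close>.\<close>
      have "\<exists>v. lin u = word v"
      proof (cases "k = 1")
        case True
        then obtain i where "u = \<epsilon> ^ i" using norm_1_cases u by auto
        then show ?thesis using word_conj_A by metis
      next
        case False
        then obtain i where "u = \<epsilon> ^ i / \<zeta>" using norm_\<kappa>_cases u k by auto
        then show ?thesis using word_conj_B by metis
      qed
      then obtain v where v: "lin u = word v" ..
      obtain v' where v': "skew [:a:] 0 = word v'" using const_word[OF a] ..
      have d: "det2 (skew x y) = det2 (skew [:a:] 0) * det2 (lin u) * det2 (skew x' y')"
        unfolding XY det2_mult ..
      have nz': "det2 (skew x' y') \<noteq> 0" "det2 (skew [:a:] 0) \<noteq> 0" using nz d by auto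
      have "degree (det2 (skew x y)) = 1 + degree (det2 (skew x' y'))"
      proof -
        have "degree (det2 (skew [:a:] 0)) = 0" by (simp add: det2_skew)
        moreover have "det2 (lin u) \<noteq> 0" using nz d by auto
        ultimately show ?thesis
          unfolding d using nz' degree_det2_lin[OF u] by (simp add: degree_mult_eq)
      qed
      then have "degree (det2 (skew x' y')) < degree (det2 (skew x y))" by simp
      moreover have "det2 (skew x' y') dvd loc_poly ^ N"
        using less.prems unfolding d by (rule dvd_mult_right)
      ultimately obtain w m n where
        w: "skew x' y' = scal ([:-1, 1:] ^ m * [:- \<iota> \<kappa>, 1:] ^ n) * word w"
        using less.hyps by blast
      have "skew x y = scal ([:-1, 1:] ^ m * [:- \<iota> \<kappa>, 1:] ^ n) * word (v' @ v @ w)"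
        unfolding XY w v v' by (simp add: mult.assoc scal_left_commute)
      then show ?thesis by blast
    qed
  qed
qed


section \<open>The coefficient ring\<close>

definition coeff_ring :: "'a poly fract set" where
  "coeff_ring = poly_inverting ([:0, 1:] * [:- \<tau>, 1:])"

definition var_t :: "'a poly fract" where "var_t = to_fract [:0, 1:]"
definition var_x :: "'b poly fract" where "var_x = to_fract [:0, 1:]"

lemma coeff_subring: "is_subring coeff_ring"
  unfolding coeff_ring_def by (rule is_subring_poly_inverting) simp

lemmas coeff_closed = is_subring_closed[OF coeff_subring]

lemma var_t_neq: "var_t \<noteq> 0" "var_t \<noteq> to_fract [:\<tau>:]"
  by (simp_all add: var_t_def del: to_fract_eq_iff add: to_fract_eq_iff)

lemma coeff_ring_mem:
  "to_fract p \<in> coeff_ring" "1 / var_t \<in> coeff_ring" "1 / (var_t - to_fract [:\<tau>:]) \<in> coeff_ring"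
proof -
  show *: "to_fract p \<in> coeff_ring" for p unfolding coeff_ring_def by (rule to_fract_in_poly_inverting)
  have f: "to_fract ([:0, 1:] * [:- \<tau>, 1:]) = var_t * (var_t - to_fract [:\<tau>:])"
    unfolding to_fract_mult var_t_def to_fract_diff[symmetric] by simp
  have inv: "to_fract p / (var_t * (var_t - to_fract [:\<tau>:])) \<in> coeff_ring" for p
    unfolding coeff_ring_def poly_inverting_def f[symmetric]
    by (rule CollectI, rule exI[of _ p], rule exI[of _ 1]) simp
  have "to_fract [:- \<tau>, 1:] = var_t - to_fract [:\<tau>:]"
    unfolding var_t_def to_fract_diff[symmetric] by simp
  then show "1 / var_t \<in> coeff_ring" using inv[of "[:- \<tau>, 1:]"] var_t_neq by simp
  show "1 / (var_t - to_fract [:\<tau>:]) \<in> coeff_ring"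
    using inv[of "[:0, 1:]"] var_t_neq by (simp flip: var_t_def)
qed

section \<open>Embedding of the coefficient field into the larger rational function field\<close>

definition cst :: "'a \<Rightarrow> 'b poly fract" where "cst u = to_fract [:\<iota> u:]"

lemma cst_hom: "unital_ring_hom cst"
  unfolding cst_def
  by (intro unital_ring_hom_comp[OF unital_ring_hom_comp[OF \<iota>.unital_ring_hom_axioms unital_ring_hom_const]
        unital_ring_hom_to_fract])

interpretation cst: unital_ring_hom cst by (rule cst_hom)

lemma cst_eq_0_iff [simp]: "cst u = 0 \<longleftrightarrow> u = 0"
  by (simp add: cst_def)

lemma var_x_neq: "1 - var_x \<noteq> 0" "var_x - cst \<kappa> \<noteq> 0" "var_x \<noteq> 0"
proof -
  have "1 - var_x = to_fract [:1, -1:]"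
    unfolding var_x_def to_fract_1[symmetric] to_fract_diff[symmetric] by (simp add: one_pCons)
  then show "1 - var_x \<noteq> 0" by simp
  have "var_x - cst \<kappa> = to_fract [:- \<iota> \<kappa>, 1:]"
    unfolding var_x_def cst_def to_fract_diff[symmetric] by simp
  then show "var_x - cst \<kappa> \<noteq> 0" by simp
  show "var_x \<noteq> 0" by (simp add: var_x_def)
qed

text \<open>
  The substitution \<open>t = 1 / (1 - x)\<close>, equivalently \<open>x = (t - 1) / t\<close>: writing the generator
  \<open>F\<close> of the order as \<open>t F'\<close>, one gets \<open>F'\<^sup>2 = x\<close>.
\<close>
definition eval_t :: "'a poly \<Rightarrow> 'b poly fract" where
  "eval_t p = poly (map_poly cst p) (1 / (1 - var_x))"

lemma eval_t_hom: "unital_ring_hom eval_t"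
  unfolding eval_t_def by (rule unital_ring_hom_comp[OF cst.map_poly_hom unital_ring_hom_poly])

lemma poly_cst_to_fract: "poly (map_poly cst p) (to_fract s) = to_fract (pcompose (\<iota>p p) s)"
  by (induction p) (simp_all add: map_poly_pCons pcompose_pCons cst_def)

text \<open>Clearing denominators in \<open>p\<close> at \<open>1 / (1 - x)\<close> gives the
  reflected polynomial at \<open>1 - x\<close>, and composition with a nonconstant polynomial is
  injective.\<close>

lemma eval_t_inj:
  assumes "eval_t p = 0"
  shows "p = 0"
proof (rule ccontr)
  assume p: "p \<noteq> 0"
  have deg: "degree (map_poly cst p) = degree p" by (rule map_poly_degree_eq) (use p in simp)
  have refl: "reflect_poly (map_poly cst p) = map_poly cst (reflect_poly p)"
    by (rule poly_eqI) (simp add: coeff_reflect_poly coeff_map_poly deg)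
  have "poly (reflect_poly (map_poly cst p)) (1 - var_x)
      = (1 - var_x) ^ degree (map_poly cst p) * poly (map_poly cst p) (inverse (1 - var_x))"
    by (rule poly_reflect_poly_nz[OF var_x_neq(1)])
  also have "\<dots> = 0" using assms by (simp add: eval_t_def inverse_eq_divide)
  finally have "poly (map_poly cst (reflect_poly p)) (1 - var_x) = 0" by (simp only: refl)
  moreover have "1 - var_x = to_fract [:1, -1:]"
    unfolding var_x_def to_fract_1[symmetric] to_fract_diff[symmetric] by (simp add: one_pCons)
  ultimately have "to_fract (pcompose (\<iota>p (reflect_poly p)) [:1, -1:]) = 0"
    by (simp only: poly_cst_to_fract)
  then have "pcompose (\<iota>p (reflect_poly p)) [:1, -1:] = 0" by simp
  then have "\<iota>p (reflect_poly p) = 0" by (rule pcompose_eq_0) simp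
  then have "reflect_poly p = 0" by (subst (asm) map_poly_eq_0_iff) simp_all
  then show False using p by simp
qed

definition emb :: "'a poly fract \<Rightarrow> 'b poly fract" where "emb = fract_lift eval_t"

lemma emb_hom: "unital_ring_hom emb"
  unfolding emb_def by (rule unital_ring_hom_fract_lift[OF eval_t_hom eval_t_inj])

interpretation emb: unital_ring_hom emb by (rule emb_hom)

lemma emb_eq_0_iff [simp]: "emb a = 0 \<longleftrightarrow> a = 0"
  using unital_ring_hom_inj[OF emb_hom] by auto

lemma emb_divide: "emb (a / b) = emb a / emb b"
  by (rule unital_ring_hom_divide[OF emb_hom])

lemma emb_to_fract: "emb (to_fract p) = eval_t p"
  unfolding emb_def by (rule fract_lift_to_fract[OF eval_t_hom eval_t_inj])

lemma emb_const: "emb (to_fract [:u:]) = cst u"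
  by (simp add: emb_to_fract eval_t_def map_poly_pCons)

lemma emb_var_t: "emb var_t = 1 / (1 - var_x)"
  by (simp add: var_t_def emb_to_fract eval_t_def map_poly_pCons)

lemma var_x_eq: "var_x = emb (1 - 1 / var_t)"
  using var_x_neq by (simp add: emb.hom_diff emb_divide emb_var_t)

text \<open>Horner's scheme, with \<open>x = 1 - 1 / t\<close> in the coefficient ring.\<close>

lemma polynomial_in_coeff_ring: "\<exists>a\<in>coeff_ring. emb a = to_fract (\<iota>p r)"
proof (induction r)
  case 0
  then show ?case using coeff_closed(1) by (intro bexI[of _ 0]) simp_all
next
  case (pCons u r)
  then obtain a where a: "a \<in> coeff_ring" "emb a = to_fract (\<iota>p r)" by blast
  have "\<iota>p (pCons u r) = [:\<iota> u:] + [:0, 1:] * \<iota>p r" by (simp add: map_poly_pCons)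
  then have "to_fract (\<iota>p (pCons u r)) = cst u + var_x * emb a"
    by (simp only: to_fract_add to_fract_mult cst_def var_x_def a)
  also have "\<dots> = emb (to_fract [:u:] + (1 - 1 / var_t) * a)"
    by (simp only: emb.hom_add emb.hom_mult emb_const var_x_eq)
  finally have "emb (to_fract [:u:] + (1 - 1 / var_t) * a) = to_fract (\<iota>p (pCons u r))" ..
  moreover have "to_fract [:u:] + (1 - 1 / var_t) * a \<in> coeff_ring"
    by (intro coeff_closed(2,4-6) coeff_ring_mem a)
  ultimately show ?case by blast
qed

section \<open>Units of the coefficient ring\<close>

definition coeff_units :: "'a poly fract set" where
  "coeff_units = {a \<in> coeff_ring. a \<noteq> 0 \<and> 1 / a \<in> coeff_ring}"

lemma coeff_units_1: "1 \<in> coeff_units"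
  using coeff_closed by (simp add: coeff_units_def)

lemma coeff_units_mult:
  assumes "a \<in> coeff_units" "b \<in> coeff_units"
  shows "a * b \<in> coeff_units"
proof -
  have "a * b \<in> coeff_ring" "(1 / a) * (1 / b) \<in> coeff_ring"
    using assms unfolding coeff_units_def by (blast intro: coeff_closed(6))+
  moreover have "(1 / a) * (1 / b) = 1 / (a * b)" by simp
  moreover have "a * b \<noteq> 0" using assms by (simp add: coeff_units_def)
  ultimately show ?thesis unfolding coeff_units_def by simp
qed

lemma coeff_units_inverse: "a \<in> coeff_units \<Longrightarrow> 1 / a \<in> coeff_units"
  by (simp add: coeff_units_def)

lemma coeff_units_divide: "a \<in> coeff_units \<Longrightarrow> b \<in> coeff_units \<Longrightarrow> a / b \<in> coeff_units"
  using coeff_units_mult[of a "1 / b"] coeff_units_inverse[of b] by simp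

lemma coeff_units_power: "a \<in> coeff_units \<Longrightarrow> a ^ n \<in> coeff_units"
  by (induction n) (simp_all add: coeff_units_1 coeff_units_mult)

lemma coeff_units_nz: "a \<in> coeff_units \<Longrightarrow> a \<noteq> 0"
  by (simp add: coeff_units_def)

lemma Units_coeff_ring: "Units (ring_of_type_algebra \<lparr> carrier := coeff_ring \<rparr>) = coeff_units"
proof -
  have "(\<exists>b\<in>coeff_ring. b * a = 1 \<and> a * b = 1) \<longleftrightarrow> a \<noteq> 0 \<and> 1 / a \<in> coeff_ring" for a
  proof
    assume "\<exists>b\<in>coeff_ring. b * a = 1 \<and> a * b = 1"
    then obtain b where b: "b \<in> coeff_ring" "b * a = 1" by blast
    then have "a \<noteq> 0" by auto
    moreover from this have "b = 1 / a" using b(2) by (simp add: field_simps)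
    ultimately show "a \<noteq> 0 \<and> 1 / a \<in> coeff_ring" using b(1) by simp
  qed (auto intro!: bexI[of _ "1 / a"])
  then show ?thesis by (auto simp: Units_def coeff_units_def)
qed

text \<open>Under the substitution, \<open>x - 1\<close> is \<open>- 1 / t\<close> and
  \<open>x - \<kappa>\<close> is \<open>(t - \<tau>) / (\<tau> t)\<close>; both are units because
  \<open>t\<close> and \<open>t - \<tau>\<close> are inverted.\<close>

lemma unit_scalars_coeff_units:
  assumes "s \<in> unit_scalars"
  shows "\<exists>a\<in>coeff_units. emb a = to_fract s"
proof -
  interpret to_fract: unital_ring_hom to_fract by (rule unital_ring_hom_to_fract)
  obtain u m n where u: "u \<noteq> 0" and s: "s = smult (\<iota> u) ([:-1, 1:] ^ m * [:- \<iota> \<kappa>, 1:] ^ n)"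
    using assms by (auto simp: unit_scalars_def)
  have "to_fract s = to_fract ([:\<iota> u:] * ([:-1, 1:] ^ m * [:- \<iota> \<kappa>, 1:] ^ n))"
    by (simp add: s)
  then have s': "to_fract s = cst u * (to_fract [:-1, 1:] ^ m * to_fract [:- \<iota> \<kappa>, 1:] ^ n)"
    by (simp only: to_fract_mult to_fract.hom_power cst_def)
  have "to_fract [:u:] \<in> coeff_units"
  proof -
    have "1 / to_fract [:u:] = to_fract [:1 / u:]"
      using u by (simp add: field_simps flip: to_fract_mult) (simp flip: one_pCons)
    then show ?thesis using u coeff_ring_mem(1) by (simp add: coeff_units_def)
  qed
  moreover have "- (1 / var_t) \<in> coeff_units"
  proof -
    have "- (1 / var_t) \<in> coeff_ring" by (intro coeff_closed(3) coeff_ring_mem)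
    moreover have "1 / (- (1 / var_t)) = to_fract [:0, -1:]"
      unfolding var_t_def by (simp flip: to_fract_uminus)
    then have "1 / (- (1 / var_t)) \<in> coeff_ring" using coeff_ring_mem(1) by metis
    ultimately show ?thesis using var_t_neq unfolding coeff_units_def by simp
  qed
  moreover have "emb (- (1 / var_t)) = to_fract [:-1, 1:]"
  proof -
    have "to_fract [:-1, 1:] = var_x - 1"
      unfolding var_x_def to_fract_1[symmetric] to_fract_diff[symmetric] by (simp add: one_pCons)
    then show ?thesis by (simp add: var_x_eq emb.hom_diff emb.hom_uminus)
  qed
  moreover define b where "b = (var_t - to_fract [:\<tau>:]) / (to_fract [:\<tau>:] * var_t)"
  have \<tau>i: "to_fract [:1 / \<tau>:] = 1 / to_fract [:\<tau>:]"
    using \<tau>_nz by (simp add: field_simps flip: to_fract_mult) (simp flip: one_pCons)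
  have "b \<in> coeff_units"
  proof -
    have t: "var_t \<in> coeff_ring" unfolding var_t_def by (rule coeff_ring_mem)
    have b: "b = (var_t - to_fract [:\<tau>:]) * (to_fract [:1 / \<tau>:] * (1 / var_t))"
      and b': "1 / b = to_fract [:\<tau>:] * var_t * (1 / (var_t - to_fract [:\<tau>:]))"
      by (simp_all add: b_def \<tau>i)
    have "b \<in> coeff_ring" unfolding b by (intro coeff_closed(5,6) coeff_ring_mem t)
    moreover have "1 / b \<in> coeff_ring" unfolding b' by (intro coeff_closed(5,6) coeff_ring_mem t)
    moreover have "b \<noteq> 0" using var_t_neq \<tau>_nz by (simp add: b_def)
    ultimately show ?thesis unfolding coeff_units_def by blast
  qed
  moreover have "emb b = to_fract [:- \<iota> \<kappa>, 1:]"
  proof -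
    have \<kappa>: "\<kappa> = 1 - 1 / \<tau>" using \<tau>_nz by (simp add: \<kappa>_def field_simps)
    have "b = (1 - 1 / var_t) - to_fract [:\<kappa>:]"
    proof -
      have "[:\<kappa>:] = 1 - [:1 / \<tau>:]" by (simp add: \<kappa> one_pCons)
      then have "to_fract [:\<kappa>:] = 1 - 1 / to_fract [:\<tau>:]"
        by (simp only: to_fract_diff to_fract_1 \<tau>i)
      moreover have "b = 1 / to_fract [:\<tau>:] - 1 / var_t"
        using var_t_neq \<tau>_nz by (simp add: b_def field_simps)
      ultimately show ?thesis by simp
    qed
    then have "emb b = var_x - cst \<kappa>" by (simp only: emb.hom_diff[of "1 - 1 / var_t"] var_x_eq emb_const)
    also have "\<dots> = to_fract [:- \<iota> \<kappa>, 1:]"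
      unfolding var_x_def cst_def to_fract_diff[symmetric] by simp
    finally show ?thesis .
  qed
  ultimately have "emb (to_fract [:u:] * ((- (1 / var_t)) ^ m * b ^ n)) = to_fract s"
    "to_fract [:u:] * ((- (1 / var_t)) ^ m * b ^ n) \<in> coeff_units"
    using coeff_units_mult coeff_units_power
    by (simp_all only: emb.hom_mult emb.hom_power emb_const s')
  then show ?thesis by blast
qed

lemma loc_poly_unit_scalar: "loc_poly \<in> unit_scalars" "loc_poly ^ n \<in> unit_scalars"
proof -
  show *: "loc_poly \<in> unit_scalars" using unit_scalarsI[of 1 1 1] by (simp add: loc_poly_def)
  show "loc_poly ^ n \<in> unit_scalars"
    by (induction n) (simp_all add: unit_scalars_1 unit_scalars_mult *)
qed

text \<open>A bound on the poles: \<open>n\<close> bounds their order at 1 and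
  \<open>\<iota> \<kappa>\<close>, there are no others, and the cleared numerator has coefficients
  in the subfield.\<close>

definition integral_at :: "nat \<Rightarrow> 'b poly fract \<Rightarrow> bool" where
  "integral_at n y \<longleftrightarrow> (\<exists>r. y * to_fract loc_poly ^ n = to_fract (\<iota>p r))"

lemma loc_poly_\<iota>p: "loc_poly = \<iota>p ([:-1, 1:] * [:- \<kappa>, 1:])"
  unfolding loc_poly_def \<iota>p.hom_mult by (simp add: map_poly_pCons \<iota>.hom_uminus)

lemma integral_at_mult: "integral_at n y \<Longrightarrow> integral_at m y' \<Longrightarrow> integral_at (n + m) (y * y')"
proof -
  assume "integral_at n y" "integral_at m y'"
  then obtain r r' where "y * to_fract loc_poly ^ n = to_fract (\<iota>p r)" "y' * to_fract loc_poly ^ m = to_fract (\<iota>p r')"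
    unfolding integral_at_def by blast
  moreover have "y * y' * to_fract loc_poly ^ (n + m) = (y * to_fract loc_poly ^ n) * (y' * to_fract loc_poly ^ m)"
    by (simp only: power_add mult_ac)
  ultimately have "y * y' * to_fract loc_poly ^ (n + m) = to_fract (\<iota>p r) * to_fract (\<iota>p r')"
    by (simp only:)
  also have "\<dots> = to_fract (\<iota>p (r * r'))" by (simp only: \<iota>p.hom_mult to_fract_mult)
  finally show ?thesis unfolding integral_at_def by blast
qed

lemma integral_at_0: "integral_at 0 (to_fract (\<iota>p r))"
  unfolding integral_at_def by auto

lemma integral_at_1: "integral_at n 1"
proof -
  interpret to_fract: unital_ring_hom to_fract by (rule unital_ring_hom_to_fract)
  show ?thesis unfolding integral_at_def loc_poly_\<iota>p
    by (auto simp flip: to_fract.hom_power \<iota>p.hom_power)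
qed

lemma integral_at_mono: "integral_at n y \<Longrightarrow> n \<le> m \<Longrightarrow> integral_at m y"
  using integral_at_mult[of n y "m - n" 1] integral_at_1 by simp

lemma integral_at_add: "integral_at n y \<Longrightarrow> integral_at n y' \<Longrightarrow> integral_at n (y + y')"
  unfolding integral_at_def by (metis \<iota>p.hom_add distrib_right to_fract_add)

lemma to_fract_loc_poly: "to_fract loc_poly = (var_x - 1) * (var_x - cst \<kappa>)"
  unfolding loc_poly_def to_fract_mult var_x_def cst_def to_fract_1[symmetric] to_fract_diff[symmetric]
  by (simp add: one_pCons)

text \<open>It suffices to treat \<open>t = 1 / (1 - x)\<close> and \<open>1 / (t (t - \<tau>)) = (1
  - x)\<^sup>2 / (\<tau> (x - \<kappa>))\<close>, whose poles are simple and lie at 1 or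
  \<open>\<kappa>\<close>.\<close>

lemma integral_emb:
  assumes "a \<in> coeff_ring"
  shows "\<exists>n. integral_at n (emb a)"
proof -
  have T: "integral_at 1 (emb var_t)"
  proof -
    have "emb var_t * to_fract loc_poly = cst \<kappa> - var_x"
      using var_x_neq unfolding emb_var_t to_fract_loc_poly by (simp add: field_simps)
    also have "\<dots> = to_fract (\<iota>p [:\<kappa>, -1:])"
      unfolding var_x_def cst_def to_fract_diff[symmetric] by (simp add: map_poly_pCons \<iota>.hom_uminus)
    finally show ?thesis unfolding integral_at_def by auto
  qed
  have p: "\<exists>n. integral_at n (emb (to_fract p))" for p
  proof (induction p)
    case 0
    then show ?case using integral_at_0[of 0] by auto
  next
    case (pCons u p)
    then obtain n where n: "integral_at n (emb (to_fract p))" by blast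
    have "pCons u p = [:u:] + [:0, 1:] * p" by simp
    then have "emb (to_fract (pCons u p)) = cst u + emb var_t * emb (to_fract p)"
      by (simp only: to_fract_add to_fract_mult emb.hom_add emb.hom_mult emb_const var_t_def)
    moreover have "integral_at (1 + n) (emb var_t * emb (to_fract p))"
      by (rule integral_at_mult[OF T n])
    moreover have "integral_at (1 + n) (cst u)"
      using integral_at_mono[OF integral_at_0[of "[:u:]"]] by (simp add: cst_def map_poly_pCons)
    ultimately show ?case using integral_at_add by metis
  qed
  have "integral_at 1 (1 / (emb var_t * (emb var_t - cst \<tau>)))"
  proof -
    have "cst \<kappa> * cst \<tau> = cst \<tau> - 1"
      using \<tau>_nz by (simp add: \<kappa>_def cst.hom_diff flip: cst.hom_mult)
    then have "(emb var_t - cst \<tau>) = cst \<tau> * (var_x - cst \<kappa>) / (1 - var_x)"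
      using var_x_neq unfolding emb_var_t by (simp add: field_simps)
    then have "1 / (emb var_t * (emb var_t - cst \<tau>)) = (1 - var_x) * (1 - var_x) / (cst \<tau> * (var_x - cst \<kappa>))"
      by (simp add: emb_var_t)
    then have "1 / (emb var_t * (emb var_t - cst \<tau>)) * to_fract loc_poly
        = (1 - var_x) * (1 - var_x) * (var_x - 1) / cst \<tau>"
      using var_x_neq by (simp add: to_fract_loc_poly)
    also have "\<dots> = (1 - var_x) * (1 - var_x) * (var_x - 1) * cst (1 / \<tau>)"
      by (simp add: unital_ring_hom_divide[OF cst_hom])
    also have "\<dots> = to_fract (\<iota>p ([:1, -1:] * [:1, -1:] * [:-1, 1:] * [:1 / \<tau>:]))"
    proof -
      have "to_fract (\<iota>p [:1, -1:]) = 1 - var_x" "to_fract (\<iota>p [:-1, 1:]) = var_x - 1"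
        "to_fract (\<iota>p [:1 / \<tau>:]) = cst (1 / \<tau>)"
        unfolding var_x_def cst_def to_fract_1[symmetric] to_fract_diff[symmetric]
        by (simp_all add: map_poly_pCons \<iota>.hom_uminus one_pCons)
      then show ?thesis by (simp only: \<iota>p.hom_mult to_fract_mult)
    qed
    finally show ?thesis unfolding integral_at_def by auto
  qed
  then have inv: "integral_at n ((1 / (emb var_t * (emb var_t - cst \<tau>))) ^ n)" for n
    by (induction n) (use integral_at_1 integral_at_mult in fastforce)+
  obtain p n where a: "a = to_fract p / to_fract ([:0, 1:] * [:- \<tau>, 1:]) ^ n"
    using assms unfolding coeff_ring_def poly_inverting_def by blast
  have "to_fract ([:0, 1:] * [:- \<tau>, 1:]) = var_t * (var_t - to_fract [:\<tau>:])"
    unfolding to_fract_mult var_t_def to_fract_diff[symmetric] by simp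
  then have "a = to_fract p * (1 / (var_t * (var_t - to_fract [:\<tau>:]))) ^ n"
    using a by (simp add: power_one_over)
  then have "emb a = emb (to_fract p) * (1 / (emb var_t * (emb var_t - cst \<tau>))) ^ n"
    by (simp only: emb.hom_mult emb.hom_power emb_divide emb.hom_diff emb_const emb.hom_one)
  then show ?thesis using p[of p] inv[of n] integral_at_mult by metis
qed


section \<open>The quaternion order as a ring of matrices\<close>

abbreviation to_mat :: "'b poly mat2 \<Rightarrow> 'b poly fract mat2" where
  "to_mat \<equiv> map_mat2 to_fract"

lemmas to_mat_hom = unital_ring_hom.map_mat2_hom(1-5)[OF unital_ring_hom_to_fract]

lemma to_mat_inj: "to_mat M = to_mat N \<longleftrightarrow> M = N"
  by (cases M; cases N) simp

text \<open>\<open>Z\<close> becomes the constant skew polynomial \<open>z\<close>, and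
  \<open>F\<close> becomes \<open>t\<close> times \<open>skew 0 1\<close>, in accordance with
  \<open>F = t F'\<close>.\<close>

definition gen_mat :: "quat_gen \<Rightarrow> 'b poly fract mat2" where
  "gen_mat g = (case g of GenZ \<Rightarrow> Mat2 (to_fract [:z:]) 0 0 (- to_fract [:z:])
    | GenF \<Rightarrow> Mat2 0 (emb var_t) (var_x * emb var_t) 0)"

definition rep :: "(quat_gen, 'a poly fract) free_alg \<Rightarrow> 'b poly fract mat2" where
  "rep = free_alg_eval (\<lambda>a. scal (emb a)) gen_mat"

lemma scal_emb_hom:
  "scal (emb (a + b)) = scal (emb a) + scal (emb b)"
  "scal (emb (a * b)) = scal (emb a) * scal (emb b)"
  "scal (emb 1) = 1"
  "scal (emb a) * M = M * scal (emb a)"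
  by (simp_all only: emb.hom_add emb.hom_mult emb.hom_one scal_simps) (rule scal_commute)

lemmas rep_hom_eval =
  free_alg_eval_add[of "\<lambda>a. scal (emb a)" gen_mat, OF scal_emb_hom, folded rep_def]
  free_alg_eval_mult[of "\<lambda>a. scal (emb a)" gen_mat, OF scal_emb_hom, folded rep_def]
  free_alg_eval_one[of "\<lambda>a. scal (emb a)" gen_mat, OF scal_emb_hom, folded rep_def]
  free_alg_eval_zero[of "\<lambda>a. scal (emb a)" gen_mat, OF scal_emb_hom, folded rep_def]
  free_alg_eval_uminus[of "\<lambda>a. scal (emb a)" gen_mat, OF scal_emb_hom, folded rep_def]
  free_alg_eval_scalar[of "\<lambda>a. scal (emb a)" gen_mat, OF scal_emb_hom, folded rep_def]
  free_alg_eval_indet[of "\<lambda>a. scal (emb a)" gen_mat, OF scal_emb_hom, folded rep_def]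

lemma rep_diff: "rep (f - h) = rep f - rep h"
  by (metis diff_conv_add_uminus rep_hom_eval(1,5))

lemmas rep_hom = rep_hom_eval rep_diff

abbreviation FA :: "(quat_gen, 'a poly fract) free_alg ring" where
  "FA \<equiv> free_alg_over coeff_ring"

abbreviation FI :: "(quat_gen, 'a poly fract) free_alg set" where
  "FI \<equiv> quat_ideal c coeff_ring"

lemma ring_FA: "ring FA"
  by (rule ring_free_alg_over[OF coeff_subring])

lemma hom_rep: "ring_hom_ring FA ring_of_type_algebra rep"
  by (rule ring_hom_ringI2[OF ring_FA ring_ring_of_type_algebra])
    (auto intro!: ring_hom_memI simp: rep_hom)

lemma scalar_in_FA: "a \<in> coeff_ring \<Longrightarrow> scalar a \<in> carrier FA"
  unfolding scalar_def by (rule single_in_free_alg_over[OF coeff_subring])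

lemma indet_in_FA: "indet g \<in> carrier FA"
  unfolding indet_def by (rule single_in_free_alg_over[OF coeff_subring coeff_closed(2)])

lemma FA_closed:
  "f \<in> carrier FA \<Longrightarrow> h \<in> carrier FA \<Longrightarrow> f + h \<in> carrier FA"
  "f \<in> carrier FA \<Longrightarrow> h \<in> carrier FA \<Longrightarrow> f * h \<in> carrier FA"
  "f \<in> carrier FA \<Longrightarrow> - f \<in> carrier FA"
  "f \<in> carrier FA \<Longrightarrow> h \<in> carrier FA \<Longrightarrow> f - h \<in> carrier FA"
proof -
  show 1: "f \<in> carrier FA \<Longrightarrow> h \<in> carrier FA \<Longrightarrow> f + h \<in> carrier FA" for f h
    by (simp add: free_alg_over_sel(1) lookup_add coeff_closed(4))
  show "f \<in> carrier FA \<Longrightarrow> h \<in> carrier FA \<Longrightarrow> f * h \<in> carrier FA"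
    by (simp add: free_alg_over_sel(1) free_alg_over_mult_closed[OF coeff_subring])
  show 2: "f \<in> carrier FA \<Longrightarrow> - f \<in> carrier FA" for f
    unfolding free_alg_over_sel by (simp add: coeff_closed(3))
  show "f \<in> carrier FA \<Longrightarrow> h \<in> carrier FA \<Longrightarrow> f - h \<in> carrier FA"
    using 1[OF _ 2] by (metis diff_conv_add_uminus)
qed

lemma quat_relators_in_FA: "quat_relators c \<subseteq> carrier FA"
  unfolding quat_relators_def
  by (intro insert_subsetI empty_subsetI FA_closed scalar_in_FA indet_in_FA coeff_ring_mem(1))

lemma ideal_FI: "ideal FI FA"
  unfolding quat_ideal_def by (rule ring.genideal_ideal[OF ring_FA quat_relators_in_FA])

lemma FI_closed:
  "f \<in> FI \<Longrightarrow> h \<in> FI \<Longrightarrow> f + h \<in> FI"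
  "f \<in> FI \<Longrightarrow> h \<in> carrier FA \<Longrightarrow> h * f \<in> FI"
  "f \<in> FI \<Longrightarrow> h \<in> carrier FA \<Longrightarrow> f * h \<in> FI"
  "f \<in> FI \<Longrightarrow> - f \<in> FI" "0 \<in> FI"
  "f \<in> FI \<Longrightarrow> h \<in> FI \<Longrightarrow> f - h \<in> FI"
proof -
  show 1: "f \<in> FI \<Longrightarrow> h \<in> FI \<Longrightarrow> f + h \<in> FI" for f h 
    using additive_subgroup.a_closed[OF ideal.axioms(1)[OF ideal_FI], of f h]
    unfolding free_alg_over_sel(5) by blast
  show "f \<in> FI \<Longrightarrow> h \<in> carrier FA \<Longrightarrow> h * f \<in> FI" for f h 
    using ideal.I_l_closed[OF ideal_FI, of f h] unfolding free_alg_over_sel(2) by blast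
  then have "f \<in> FI \<Longrightarrow> (- 1) * f \<in> FI" for f
    using FA_closed(3)[of 1] scalar_in_FA[OF coeff_closed(2)] unfolding scalar_hom(5) by blast
  then show 2: "f \<in> FI \<Longrightarrow> - f \<in> FI" for f by simp
  show "f \<in> FI \<Longrightarrow> h \<in> carrier FA \<Longrightarrow> f * h \<in> FI" 
    using ideal.I_r_closed[OF ideal_FI, of f h] unfolding free_alg_over_sel(2) by blast
  show "0 \<in> FI" 
    using additive_subgroup.zero_closed[OF ideal.axioms(1)[OF ideal_FI]]
    unfolding free_alg_over_sel(4) .
  show "f \<in> FI \<Longrightarrow> h \<in> FI \<Longrightarrow> f - h \<in> FI" using 1[OF _ 2] by (metis diff_conv_add_uminus)
qed

section \<open>Reduction to the basis 1, Z, F, ZF of the order\<close>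

definition nf :: "'a poly fract \<Rightarrow> 'a poly fract \<Rightarrow> 'a poly fract \<Rightarrow> 'a poly fract \<Rightarrow>
    (quat_gen, 'a poly fract) free_alg" where
  "nf a0 a1 a2 a3 = scalar a0 + scalar a1 * indet GenZ + scalar a2 * indet GenF
     + scalar a3 * (indet GenZ * indet GenF)"

definition reducible :: "(quat_gen, 'a poly fract) free_alg \<Rightarrow> bool" where
  "reducible f \<longleftrightarrow> f \<in> carrier FA \<and>
    (\<exists>a0\<in>coeff_ring. \<exists>a1\<in>coeff_ring. \<exists>a2\<in>coeff_ring. \<exists>a3\<in>coeff_ring. f - nf a0 a1 a2 a3 \<in> FI)"

lemma nf_in_FA:
  assumes "a0 \<in> coeff_ring" "a1 \<in> coeff_ring" "a2 \<in> coeff_ring" "a3 \<in> coeff_ring"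
  shows "nf a0 a1 a2 a3 \<in> carrier FA"
  unfolding nf_def by (intro FA_closed scalar_in_FA indet_in_FA assms)

lemma reducible_add:
  assumes "reducible f" "reducible h"
  shows "reducible (f + h)"
proof -
  obtain a0 a1 a2 a3 b0 b1 b2 b3 where ab: "f - nf a0 a1 a2 a3 \<in> FI" "h - nf b0 b1 b2 b3 \<in> FI"
    "a0 \<in> coeff_ring" "a1 \<in> coeff_ring" "a2 \<in> coeff_ring" "a3 \<in> coeff_ring"
    "b0 \<in> coeff_ring" "b1 \<in> coeff_ring" "b2 \<in> coeff_ring" "b3 \<in> coeff_ring"
    using assms unfolding reducible_def by blast
  have "(f - nf a0 a1 a2 a3) + (h - nf b0 b1 b2 b3)
      = f + h - nf (a0 + b0) (a1 + b1) (a2 + b2) (a3 + b3)"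
    by (simp add: nf_def scalar_hom algebra_simps)
  then have "f + h - nf (a0 + b0) (a1 + b1) (a2 + b2) (a3 + b3) \<in> FI"
    using FI_closed(1)[OF ab(1,2)] by (simp only:)
  then show ?thesis
    using assms ab coeff_closed(4) FA_closed(1) unfolding reducible_def by blast
qed

lemma reducible_generator_mult:
  assumes "reducible f"
  shows "reducible (indet g * f)"
proof -
  obtain a0 a1 a2 a3 where a: "f - nf a0 a1 a2 a3 \<in> FI"
    "a0 \<in> coeff_ring" "a1 \<in> coeff_ring" "a2 \<in> coeff_ring" "a3 \<in> coeff_ring"
    using assms unfolding reducible_def by blast
  let ?Z = "indet GenZ :: (quat_gen, 'a poly fract) free_alg" and ?F = "indet GenF"
  let ?f = "to_fract ([:0, 1:] * [:- 1, 1:]) :: 'a poly fract" and ?c = "to_fract [:c:]"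
  have rel: "?Z * ?Z - scalar ?c \<in> FI" "?F * ?F - scalar ?f \<in> FI" "?Z * ?F - (- (?F * ?Z)) \<in> FI"
    using ring.genideal_self[OF ring_FA quat_relators_in_FA] by (auto simp: quat_ideal_def quat_relators_def)
  have gf: "indet g * (f - nf a0 a1 a2 a3) \<in> FI" by (rule FI_closed(2)[OF a(1) indet_in_FA])
  have comm: "indet x * scalar b = scalar b * indet x"
    "indet x * (scalar b * y) = scalar b * (indet x * y)"
    for x b and y :: "(quat_gen, 'a poly fract) free_alg"
    by (simp_all only: scalar_central[of "indet x"] flip: mult.assoc)
  have "\<exists>b0\<in>coeff_ring. \<exists>b1\<in>coeff_ring. \<exists>b2\<in>coeff_ring. \<exists>b3\<in>coeff_ring.
    indet g * nf a0 a1 a2 a3 - nf b0 b1 b2 b3 \<in> FI"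
  proof (cases g)
    case GenZ
    \<comment> \<open>Left multiplication by \<open>Z\<close> produces a square in the terms
      \<open>Z\<close> and \<open>Z F\<close>; these are rewritten by the first relator, times
      \<open>F\<close> in the second case.\<close>
    have "scalar a1 * (?Z * ?Z - scalar ?c) + scalar a3 * ((?Z * ?Z - scalar ?c) * ?F) \<in> FI"
      by (intro FI_closed(1) FI_closed(2)[OF _ scalar_in_FA] FI_closed(3)[OF _ indet_in_FA] rel a)
    also have "scalar a1 * (?Z * ?Z - scalar ?c) + scalar a3 * ((?Z * ?Z - scalar ?c) * ?F)
        = indet g * nf a0 a1 a2 a3 - nf (a1 * ?c) a0 (a3 * ?c) a2"
      unfolding nf_def scalar_hom GenZ
      by (simp add: distrib_left distrib_right right_diff_distrib left_diff_distrib mult.assoc comm)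
    finally show ?thesis using a coeff_closed(6)[OF _ coeff_ring_mem(1)] by blast
  next
    case GenF
    let ?r = "?Z * ?F - (- (?F * ?Z))"
    \<comment> \<open>The anticommutator rewrites \<open>F Z\<close>, and \<open>F Z F\<close> is
      treated by \<open>?r * F\<close> followed by \<open>Z\<close> times the relator for the square
      of \<open>F\<close>.\<close>
    have "scalar a1 * ?r + scalar a2 * (?F * ?F - scalar ?f)
        + scalar a3 * (?r * ?F - ?Z * (?F * ?F - scalar ?f)) \<in> FI"
      by (intro FI_closed(1,6) FI_closed(2)[OF _ scalar_in_FA] FI_closed(2)[OF _ indet_in_FA]
          FI_closed(3)[OF _ indet_in_FA] rel a)
    also have "scalar a1 * ?r + scalar a2 * (?F * ?F - scalar ?f)
        + scalar a3 * (?r * ?F - ?Z * (?F * ?F - scalar ?f))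
        = indet g * nf a0 a1 a2 a3 - nf (a2 * ?f) (- (a3 * ?f)) a0 (- a1)"
      unfolding nf_def scalar_hom GenF
      by (simp add: distrib_left distrib_right right_diff_distrib left_diff_distrib mult.assoc comm)
    finally show ?thesis using a coeff_closed(3) coeff_closed(6)[OF _ coeff_ring_mem(1)] by blast
  qed
  then obtain b0 b1 b2 b3 where b: "indet g * nf a0 a1 a2 a3 - nf b0 b1 b2 b3 \<in> FI"
    "b0 \<in> coeff_ring" "b1 \<in> coeff_ring" "b2 \<in> coeff_ring" "b3 \<in> coeff_ring" by blast
  have "indet g * f - nf b0 b1 b2 b3 \<in> FI"
    using FI_closed(1)[OF gf b(1)] by (simp add: right_diff_distrib)
  moreover have "indet g * f \<in> carrier FA"
    using assms FA_closed(2)[OF indet_in_FA] unfolding reducible_def by blast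
  ultimately show ?thesis using b unfolding reducible_def by blast
qed

text \<open>By additivity a monomial suffices, and a monomial is built from its coefficient by
  prepending generators.\<close>

lemma reducible_FA: "f \<in> carrier FA \<Longrightarrow> reducible f"
proof -
  have scalar: "reducible (scalar a)" if "a \<in> coeff_ring" for a
  proof -
    have "scalar a - nf a 0 0 0 = 0" by (simp add: nf_def scalar_hom)
    then show ?thesis using that FI_closed(5) coeff_closed(1) scalar_in_FA
      unfolding reducible_def by metis
  qed
  assume "f \<in> carrier FA"
  with coeff_subring show ?thesis
  proof (induction f rule: free_alg_over_induct)
    case zero
    then show ?case using scalar[OF coeff_closed(1)] by (simp add: scalar_hom)
  next
    case (single w a)
    obtain l where w: "w = FM l" by (cases w)
    have "reducible (Poly_Mapping.single (FM l) a)"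
    proof (induction l)
      case Nil
      then show ?case using scalar[OF single] by (simp add: scalar_def zero_free_mon_def)
    next
      case (Cons g l)
      have "Poly_Mapping.single (FM (g # l)) a = indet g * Poly_Mapping.single (FM l) a"
        by (simp add: indet_def mult_single)
      then show ?case using reducible_generator_mult[OF Cons] by simp
    qed
    then show ?case using w by simp
  qed (use reducible_add in blast)
qed

lemma rep_nf:
  "rep (nf a0 a1 a2 a3) = Mat2
    (emb a0 + to_fract [:z:] * emb a1) (emb var_t * (emb a2 + to_fract [:z:] * emb a3))
    (var_x * (emb var_t * (emb a2 - to_fract [:z:] * emb a3))) (emb a0 - to_fract [:z:] * emb a1)"
  by (simp add: nf_def rep_hom gen_mat_def scal_def algebra_simps)

lemma rep_FI:
  assumes "f \<in> FI"
  shows "rep f = 0"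
proof -
  have zz: "to_fract [:z:] * to_fract [:z:] = cst c"
    by (simp add: cst_def z_mult_z flip: to_fract_mult)
  have ff: "emb (to_fract [:0, 1:] * to_fract [:- 1, 1:]) = emb var_t * (var_x * emb var_t)"
  proof -
    have "[:- 1, 1:] = [:0, 1:] - (1 :: 'a poly)" by (simp add: one_pCons)
    then have "emb (to_fract [:0, 1:] * to_fract [:- 1, 1:]) = emb var_t * (emb var_t - 1)"
      by (simp only: to_fract_diff to_fract_1 emb.hom_mult emb.hom_diff emb.hom_one var_t_def)
    \<comment> \<open>This is \<open>t - 1 = x t\<close>, so the square of the matrix of
      \<open>F\<close> is \<open>t (t - 1)\<close>.\<close>
    also have "emb var_t - 1 = var_x * emb var_t"
      using var_x_neq unfolding emb_var_t by (simp add: field_simps)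
    finally show ?thesis .
  qed
  have "quat_relators c \<subseteq> a_kernel FA ring_of_type_algebra rep"
    using quat_relators_in_FA
    by (auto simp: quat_relators_def a_kernel_def' rep_hom gen_mat_def emb_const scal_def zz ff
        zero_mat2_def mult_ac simp del: mult_pCons_left mult_pCons_right free_alg_over_sel(1))
  then have "FI \<subseteq> a_kernel FA ring_of_type_algebra rep"
    unfolding quat_ideal_def by (rule ring.genideal_minimal[OF ring_FA ring_hom_ring.kernel_is_ideal[OF hom_rep]])
  then show ?thesis using assms by (auto simp: a_kernel_def')
qed

lemma rep_reduced:
  assumes "f \<in> carrier FA"
  obtains a0 a1 a2 a3 where "a0 \<in> coeff_ring" "a1 \<in> coeff_ring" "a2 \<in> coeff_ring" "a3 \<in> coeff_ring"
    "f - nf a0 a1 a2 a3 \<in> FI" "rep f = rep (nf a0 a1 a2 a3)"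
proof -
  obtain a0 a1 a2 a3 where a: "a0 \<in> coeff_ring" "a1 \<in> coeff_ring" "a2 \<in> coeff_ring" "a3 \<in> coeff_ring"
    "f - nf a0 a1 a2 a3 \<in> FI"
    using reducible_FA[OF assms] unfolding reducible_def by blast
  then have "rep f = rep (nf a0 a1 a2 a3)" using rep_FI[OF a(5)] by (simp add: rep_hom)
  then show ?thesis using a that by blast
qed

lemma plus_minus_eq_0:
  fixes s t :: "'b poly fract"
  assumes "s + t = 0" "s - t = 0"
  shows "s = 0" "t = 0"
proof -
  have "to_fract [:2 :: 'b:] = 2"
    by (metis numeral_poly one_add_one to_fract_1 to_fract_add)
  moreover have "to_fract [:2 :: 'b:] \<noteq> 0" using two_nz by simp
  moreover have "2 * s = (s + t) + (s - t)" by simp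
  ultimately show "s = 0" using assms by auto
  then show "t = 0" using assms by simp
qed

text \<open>Modulo the ideal every element is a normal form. The entries of its matrix determine
  \<open>a0\<close>, \<open>a1\<close>, \<open>a2\<close> and \<open>a3\<close>, since the
  characteristic is odd, so a normal form of zero image is zero.\<close>

lemma kernel_rep: "a_kernel FA ring_of_type_algebra rep = FI"
proof
  show "FI \<subseteq> a_kernel FA ring_of_type_algebra rep"
    using rep_FI additive_subgroup.a_subset[OF ideal.axioms(1)[OF ideal_FI]] by (auto simp: a_kernel_def')
  show "a_kernel FA ring_of_type_algebra rep \<subseteq> FI"
  proof
    fix f assume "f \<in> a_kernel FA ring_of_type_algebra rep"
    then have f: "f \<in> carrier FA" "rep f = 0" unfolding a_kernel_def' by simp_all
    obtain a0 a1 a2 a3 where a: "f - nf a0 a1 a2 a3 \<in> FI" "rep f = rep (nf a0 a1 a2 a3)"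
      using rep_reduced[OF f(1)] by metis
    have "emb var_t \<noteq> 0" using var_t_neq by simp
    moreover have "rep (nf a0 a1 a2 a3) = 0" using a(2) f(2) by (simp only:)
    ultimately have "emb a0 + to_fract [:z:] * emb a1 = 0" "emb a0 - to_fract [:z:] * emb a1 = 0"
      "emb a2 + to_fract [:z:] * emb a3 = 0" "emb a2 - to_fract [:z:] * emb a3 = 0"
      using var_x_neq(3) unfolding rep_nf zero_mat2_def mat2.inject mult_eq_0_iff by blast+
    then have "emb a0 = 0" "to_fract [:z:] * emb a1 = 0" "emb a2 = 0" "to_fract [:z:] * emb a3 = 0"
      using plus_minus_eq_0 by blast+
    then have "nf a0 a1 a2 a3 = 0" by (simp add: nf_def scalar_hom)
    then show "f \<in> FI" using a(1) by simp
  qed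
qed

section \<open>Skew polynomials in the image of the representation\<close>

lemma \<iota>p_decomp: "\<exists>r s. p = \<iota>p r + [:z:] * \<iota>p s"
proof (induction p)
  case 0
  then show ?case by (intro exI[of _ 0]) simp
next
  case (pCons a p)
  then obtain r s where p: "p = \<iota>p r + [:z:] * \<iota>p s" by blast
  obtain r0 s0 where "a = \<iota> r0 + z * \<iota> s0" using \<iota>_decomp by blast
  then have "pCons a p = \<iota>p (pCons r0 r) + [:z:] * \<iota>p (pCons s0 s)"
    using p by (simp add: map_poly_pCons)
  then show ?case by blast
qed

lemma skew_in_range: "to_mat (skew x y) \<in> rep ` carrier FA"
proof -
  obtain r0 r1 r2 r3 where x: "x = \<iota>p r0 + [:z:] * \<iota>p r1" and y: "y = \<iota>p r2 + [:z:] * \<iota>p r3"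
    using \<iota>p_decomp by metis
  obtain a0 a1 a2 a3 where a: "a0 \<in> coeff_ring" "a1 \<in> coeff_ring" "a2 \<in> coeff_ring" "a3 \<in> coeff_ring"
    "emb a0 = to_fract (\<iota>p r0)" "emb a1 = to_fract (\<iota>p r1)" "emb a2 = to_fract (\<iota>p r2)"
    "emb a3 = to_fract (\<iota>p r3)"
    using polynomial_in_coeff_ring by metis
  \<comment> \<open>The coefficients of \<open>F'\<close> are divided by \<open>t\<close>, which is
    invertible in the coefficient ring, to become coefficients of \<open>F\<close>.\<close>
  define f where "f = nf a0 a1 (a2 * (1 / var_t)) (a3 * (1 / var_t))"
  have "f \<in> carrier FA"
    unfolding f_def using a coeff_closed(6) coeff_ring_mem(2) by (intro nf_in_FA) blast+
  have \<sigma>z: "\<sigma>p (\<iota>p r + [:z:] * \<iota>p s) = \<iota>p r - [:z:] * \<iota>p s" for r s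
    unfolding \<sigma>p.hom_add \<sigma>p.hom_mult by simp
  have "emb var_t \<noteq> 0" using var_t_neq by simp
  then have "rep f = Mat2
      (emb a0 + to_fract [:z:] * emb a1) (emb a2 + to_fract [:z:] * emb a3)
      (var_x * (emb a2 - to_fract [:z:] * emb a3)) (emb a0 - to_fract [:z:] * emb a1)"
    unfolding f_def rep_nf emb.hom_mult emb_divide emb.hom_one by (simp add: field_simps)
  also have "\<dots> = to_mat (skew x y)"
    unfolding skew_def mat2.map x y \<sigma>z a(5-8) to_fract_mult to_fract_add to_fract_diff var_x_def ..
  finally show ?thesis using \<open>f \<in> carrier FA\<close> by (metis imageI)
qed

lemma rep_clear_denominators:
  assumes "f \<in> carrier FA"
  shows "\<exists>n x y. scal (to_fract (loc_poly ^ n)) * rep f = to_mat (skew x y)"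
proof -
  interpret to_fract: unital_ring_hom to_fract by (rule unital_ring_hom_to_fract)
  obtain a0 a1 a2 a3 where a: "a0 \<in> coeff_ring" "a1 \<in> coeff_ring" "a2 \<in> coeff_ring" "a3 \<in> coeff_ring"
    "rep f = rep (nf a0 a1 a2 a3)"
    using rep_reduced[OF assms] by metis
  have var_t: "var_t \<in> coeff_ring" unfolding var_t_def by (rule coeff_ring_mem)
  \<comment> \<open>For the coefficients of \<open>F\<close> the factor \<open>t\<close> is
    included, because \<open>F = t F'\<close>; one exponent is then taken for all four.\<close>
  obtain n0 n1 n2 n3 where n: "integral_at n0 (emb a0)" "integral_at n1 (emb a1)"
    "integral_at n2 (emb (var_t * a2))" "integral_at n3 (emb (var_t * a3))"
    using integral_emb coeff_closed(6)[OF var_t] a(1-4) by metis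
  define m where "m = n0 + n1 + n2 + n3"
  have "integral_at m (emb a0)" "integral_at m (emb a1)"
    "integral_at m (emb (var_t * a2))" "integral_at m (emb (var_t * a3))"
    by (rule integral_at_mono[OF n(1)] integral_at_mono[OF n(2)] integral_at_mono[OF n(3)]
        integral_at_mono[OF n(4)]; simp add: m_def)+
  then obtain r0 r1 r2 r3 where r:
    "emb a0 * to_fract loc_poly ^ m = to_fract (\<iota>p r0)" "emb a1 * to_fract loc_poly ^ m = to_fract (\<iota>p r1)"
    "emb var_t * emb a2 * to_fract loc_poly ^ m = to_fract (\<iota>p r2)"
    "emb var_t * emb a3 * to_fract loc_poly ^ m = to_fract (\<iota>p r3)"
    unfolding integral_at_def emb.hom_mult by blast
  have \<sigma>z: "\<sigma>p (\<iota>p r + [:z:] * \<iota>p s) = \<iota>p r - [:z:] * \<iota>p s" for r s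
    unfolding \<sigma>p.hom_add \<sigma>p.hom_mult by simp
  have "scal (to_fract (loc_poly ^ m)) * rep f
      = to_mat (skew (\<iota>p r0 + [:z:] * \<iota>p r1) (\<iota>p r2 + [:z:] * \<iota>p r3))"
    unfolding a(5) rep_nf scal_simps(1) skew_def mat2.map \<sigma>z to_fract_mult to_fract_add to_fract_diff
      r[symmetric] to_fract.hom_power var_x_def
    by (simp add: algebra_simps)
  then show ?thesis by blast
qed


section \<open>The isomorphism\<close>

abbreviation QO :: "(quat_gen, 'a poly fract) free_alg set ring" where
  "QO \<equiv> quat_order c coeff_ring"

text \<open>The map induced by \<open>rep\<close> on cosets; \<open>rep\<close> is constant on a
  coset of its kernel, so the image has a single element.\<close>

definition mat_of :: "(quat_gen, 'a poly fract) free_alg set \<Rightarrow> 'b poly fract mat2" where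
  "mat_of u = the_elem (rep ` u)"

lemma QO_eq: "QO = FA Quot (a_kernel FA ring_of_type_algebra rep)"
  by (simp add: quat_order_def kernel_rep)

lemma ring_QO: "ring QO"
  unfolding quat_order_def by (rule ideal.quotient_is_ring[OF ideal_FI])

lemmas QO_closed = monoid.m_closed[OF ring.is_monoid[OF ring_QO]]
  monoid.one_closed[OF ring.is_monoid[OF ring_QO]]

lemma mat_of_mult:
  assumes "u \<in> carrier QO" "v \<in> carrier QO"
  shows "mat_of (u \<otimes>\<^bsub>QO\<^esub> v) = mat_of u * mat_of v"
  using ring_hom_mult[OF ring_hom_ring.the_elem_hom[OF hom_rep], of u v] assms unfolding QO_eq mat_of_def by simp

lemma mat_of_one: "mat_of \<one>\<^bsub>QO\<^esub> = 1"
  using ring_hom_one[OF ring_hom_ring.the_elem_hom[OF hom_rep]] unfolding QO_eq mat_of_def by simp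

lemma mat_of_inj: "u \<in> carrier QO \<Longrightarrow> v \<in> carrier QO \<Longrightarrow> mat_of u = mat_of v \<Longrightarrow> u = v"
  using ring_hom_ring.the_elem_inj[OF hom_rep, of u v] unfolding QO_eq mat_of_def by simp

lemma mat_of_range: "mat_of ` carrier QO = rep ` carrier FA"
  using ring_hom_ring.the_elem_surj[OF hom_rep] unfolding QO_eq mat_of_def by simp

lemma quat_scalar_QO:
  assumes "a \<in> coeff_ring"
  shows "quat_scalar c coeff_ring a \<in> carrier QO" "mat_of (quat_scalar c coeff_ring a) = scal (emb a)"
proof -
  have s: "scalar a \<in> carrier FA" by (rule scalar_in_FA[OF assms])
  show "quat_scalar c coeff_ring a \<in> carrier QO"
    using ring_hom_closed[OF ideal.rcos_ring_hom[OF ideal_FI] s] by (simp add: quat_scalar_def quat_order_def)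
  show "mat_of (quat_scalar c coeff_ring a) = scal (emb a)"
    using ring_hom_ring.the_elem_simp[OF hom_rep s] by (simp add: mat_of_def quat_scalar_def kernel_rep rep_hom)
qed

text \<open>For matrices a right inverse is two-sided, and injectivity of \<open>mat_of\<close>
  carries this back to the order.\<close>

lemma UnitsQO_I:
  assumes "u \<in> carrier QO" "v \<in> carrier QO" "mat_of u * mat_of v = 1"
  shows "u \<in> Units QO"
proof -
  have "u \<otimes>\<^bsub>QO\<^esub> v = \<one>\<^bsub>QO\<^esub>" "v \<otimes>\<^bsub>QO\<^esub> u = \<one>\<^bsub>QO\<^esub>"
    using assms mat2_right_inverse[OF assms(3)]
    by (intro mat_of_inj QO_closed; simp add: mat_of_mult mat_of_one)+
  then show ?thesis using assms by (auto simp: Units_def)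
qed

lemma quat_scalar_Units:
  assumes "a \<in> coeff_units"
  shows "quat_scalar c coeff_ring a \<in> Units QO"
proof (rule UnitsQO_I)
  have a: "a \<in> coeff_ring" "1 / a \<in> coeff_ring" "a \<noteq> 0" using assms by (auto simp: coeff_units_def)
  show "quat_scalar c coeff_ring a \<in> carrier QO" "quat_scalar c coeff_ring (1 / a) \<in> carrier QO"
    using quat_scalar_QO a by blast+
  show "mat_of (quat_scalar c coeff_ring a) * mat_of (quat_scalar c coeff_ring (1 / a)) = 1"
    using a by (simp add: quat_scalar_QO emb_divide scal_simps flip: scal_simps(4))
qed

text \<open>All words representing \<open>u\<close> up to a central unit. For a unit
  \<open>u\<close> this set is a whole class of the presented group (\<open>words_of_eq\<close>), so
  \<open>words_of\<close> itself is the homomorphism.\<close>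

definition words_of :: "(quat_gen, 'a poly fract) free_alg set \<Rightarrow> lattice_gen gword set" where
  "words_of u = {w. \<exists>a\<in>coeff_units. mat_of u = scal (emb a) * to_mat (word w)}"

text \<open>After denominators are cleared for \<open>u\<close> and its inverse, the two norms
  multiply to a power of \<open>loc_poly\<close>, and \<open>skew_factorisation\<close> writes
  \<open>u\<close> as a word up to a unit scalar.\<close>

lemma words_of_nonempty:
  assumes "u \<in> Units QO"
  shows "\<exists>w. w \<in> words_of u"
proof -
  obtain v where uv: "u \<in> carrier QO" "v \<in> carrier QO" "u \<otimes>\<^bsub>QO\<^esub> v = \<one>\<^bsub>QO\<^esub>"
    using assms by (auto simp: Units_def)
  then have prod: "mat_of u * mat_of v = 1" by (metis mat_of_mult mat_of_one)
  have clear: "\<exists>n x y. scal (to_fract (loc_poly ^ n)) * mat_of s = to_mat (skew x y)"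
    if "s \<in> carrier QO" for s
  proof -
    have "mat_of s \<in> rep ` carrier FA" using that mat_of_range by blast
    then obtain f where f: "f \<in> carrier FA" "mat_of s = rep f" by blast
    show ?thesis unfolding f(2) by (rule rep_clear_denominators[OF f(1)])
  qed
  obtain n x y where 1: "scal (to_fract (loc_poly ^ n)) * mat_of u = to_mat (skew x y)"
    using clear[OF uv(1)] by blast
  obtain m x' y' where 2: "scal (to_fract (loc_poly ^ m)) * mat_of v = to_mat (skew x' y')"
    using clear[OF uv(2)] by blast
  have "to_mat (skew x y * skew x' y') = to_mat (skew x y) * to_mat (skew x' y')"
    by (rule to_mat_hom)
  also have "\<dots> = scal (to_fract (loc_poly ^ n)) * (scal (to_fract (loc_poly ^ m)) * (mat_of u * mat_of v))"
    unfolding 1[symmetric] 2[symmetric]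
    by (simp only: mult.assoc scal_left_commute[of "mat_of u" "to_fract (loc_poly ^ m)"])
  also have "\<dots> = to_mat (scal (loc_poly ^ (n + m)))"
    by (simp only: prod mult_1_right power_add to_mat_hom scal_simps(4) to_fract_mult)
  finally have "skew x y * skew x' y' = scal (loc_poly ^ (n + m))" by (simp only: to_mat_inj)
  then have "det2 (skew x y) * det2 (skew x' y') = loc_poly ^ (n + m) * loc_poly ^ (n + m)"
    by (metis det2_mult det2_scal)
  then have "det2 (skew x y) dvd loc_poly ^ ((n + m) + (n + m))" by (metis dvd_triv_left power_add)
  then obtain w i j where w: "skew x y = scal ([:-1, 1:] ^ i * [:- \<iota> \<kappa>, 1:] ^ j) * word w"
    using skew_factorisation by blast
  have "[:-1, 1:] ^ i * [:- \<iota> \<kappa>, 1:] ^ j \<in> unit_scalars" using unit_scalarsI[of 1 i j] by simp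
  then obtain a where a: "a \<in> coeff_units" "emb a = to_fract ([:-1, 1:] ^ i * [:- \<iota> \<kappa>, 1:] ^ j)"
    using unit_scalars_coeff_units by blast
  obtain b where b: "b \<in> coeff_units" "emb b = to_fract (loc_poly ^ n)"
    using unit_scalars_coeff_units[OF loc_poly_unit_scalar(2)] by blast
  have b0: "emb b \<noteq> 0" using coeff_units_nz[OF b(1)] by simp
  have "scal (emb b) * mat_of u = scal (emb a) * to_mat (word w)"
    by (simp only: b(2) 1 w to_mat_hom a(2))
  also have "\<dots> = scal (emb b) * (scal (emb (a / b)) * to_mat (word w))"
    using b0 by (simp add: emb_divide flip: mult.assoc scal_simps(4))
  finally have "mat_of u = scal (emb (a / b)) * to_mat (word w)"
    using b0 by (rule scal_mult_cancel)
  then show ?thesis unfolding words_of_def using coeff_units_divide[OF a(1) b(1)] by blast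
qed

lemma words_of_closed:
  assumes "w \<in> words_of u" "w \<approx> w'"
  shows "w' \<in> words_of u"
proof -
  obtain a where a: "a \<in> coeff_units" "mat_of u = scal (emb a) * to_mat (word w)"
    using assms(1) unfolding words_of_def by blast
  obtain s t where st: "s \<in> unit_scalars" "t \<in> unit_scalars" "scal s * word w = scal t * word w'"
    using pres_sound[OF assms(2)] unfolding proj_eq_def by blast
  obtain b d where b: "b \<in> coeff_units" "emb b = to_fract s" and d: "d \<in> coeff_units" "emb d = to_fract t"
    using unit_scalars_coeff_units st by metis
  have b0: "emb b \<noteq> 0" using coeff_units_nz[OF b(1)] by simp
  have "scal (emb b) * to_mat (word w) = scal (emb d) * to_mat (word w')"
    using arg_cong[OF st(3), of to_mat] by (simp only: to_mat_hom b d)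
  also have "\<dots> = scal (emb b) * (scal (emb (d / b)) * to_mat (word w'))"
    using b0 by (simp add: emb_divide flip: mult.assoc scal_simps(4))
  finally have "to_mat (word w) = scal (emb (d / b)) * to_mat (word w')"
    using b0 by (rule scal_mult_cancel)
  then have "mat_of u = scal (emb (a * (d / b))) * to_mat (word w')"
    by (simp only: a(2) emb.hom_mult scal_simps(4) mult.assoc)
  then show ?thesis
    unfolding words_of_def using coeff_units_mult[OF a(1) coeff_units_divide[OF d(1) b(1)]] by blast
qed

lemma words_of_unique:
  assumes "w \<in> words_of u" "w' \<in> words_of u"
  shows "w \<approx> w'"
proof -
  obtain a where a: "a \<in> coeff_units" "mat_of u = scal (emb a) * to_mat (word w)"
    using assms(1) unfolding words_of_def by blast
  obtain b where b: "b \<in> coeff_units" "mat_of u = scal (emb b) * to_mat (word w')"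
    using assms(2) unfolding words_of_def by blast
  \<comment> \<open>Clearing the denominators of both scalars gives an identity of polynomial
    matrices, to which \<open>word_faithful\<close> applies.\<close>
  obtain p d where p: "d \<noteq> 0" "emb a = to_fract p / to_fract d" by (rule fract_cases_to_fract)
  obtain r e where r: "e \<noteq> 0" "emb b = to_fract r / to_fract e" by (rule fract_cases_to_fract)
  have "emb a \<noteq> 0" using coeff_units_nz[OF a(1)] by simp
  then have "p \<noteq> 0" using p by auto
  have "to_fract d * to_fract e * emb a = to_fract (e * p)"
    "to_fract d * to_fract e * emb b = to_fract (d * r)"
    using p r by simp_all
  moreover have "scal (to_fract d * to_fract e) * (scal (emb a) * to_mat (word w))
      = scal (to_fract d * to_fract e) * (scal (emb b) * to_mat (word w'))"
    using a b by simp
  ultimately have "to_mat (scal (e * p) * word w) = to_mat (scal (d * r) * word w')"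
    by (simp only: to_mat_hom scal_simps(4)[symmetric] mult.assoc[symmetric])
  then have "scal (e * p) * word w = scal (d * r) * word w'" by (simp only: to_mat_inj)
  then show ?thesis by (rule word_faithful) (use r \<open>p \<noteq> 0\<close> in simp)
qed

lemma words_of_eq:
  assumes "w \<in> words_of u"
  shows "words_of u = pres_rel_set rels `` {w}"
proof -
  have "w' \<in> words_of u \<longleftrightarrow> w \<approx> w'" for w'
    using words_of_unique[OF assms] words_of_closed[OF assms] by blast
  then show ?thesis unfolding pres_rel_set_def by blast
qed

lemma words_of_mult:
  assumes "u \<in> carrier QO" "v \<in> carrier QO" "w \<in> words_of u" "w' \<in> words_of v"
  shows "w @ w' \<in> words_of (u \<otimes>\<^bsub>QO\<^esub> v)"
proof -
  obtain a where a: "a \<in> coeff_units" "mat_of u = scal (emb a) * to_mat (word w)"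
    using assms unfolding words_of_def by blast
  obtain b where b: "b \<in> coeff_units" "mat_of v = scal (emb b) * to_mat (word w')"
    using assms unfolding words_of_def by blast
  have "mat_of (u \<otimes>\<^bsub>QO\<^esub> v) = scal (emb (a * b)) * to_mat (word (w @ w'))"
    unfolding mat_of_mult[OF assms(1,2)] a b
    by (simp only: word_simps(3) to_mat_hom emb.hom_mult scal_simps(4) mult.assoc
        scal_left_commute[of "to_mat (word w)" "emb b"])
  then show ?thesis unfolding words_of_def using coeff_units_mult[OF a(1) b(1)] by blast
qed

text \<open>Surjectivity: the matrices of \<open>w\<close> and of \<open>winv w\<close> both come
  from the order, and their product is a unit scalar, so correcting the second by that scalar gives
  an inverse.\<close>

lemma exists_unit_with_word: "\<exists>u\<in>Units QO. w \<in> words_of u"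
proof -
  have skew: "\<exists>u\<in>carrier QO. mat_of u = to_mat (word w)" for w
  proof -
    have "to_mat (word w) \<in> mat_of ` carrier QO"
      unfolding mat_of_range using word_is_skew[of w] skew_in_range by metis
    then show ?thesis by (metis imageE)
  qed
  obtain u where u: "u \<in> carrier QO" "mat_of u = to_mat (word w)" using skew by blast
  obtain v where v: "v \<in> carrier QO" "mat_of v = to_mat (word (winv w))" using skew by blast
  obtain s t where st: "s \<in> unit_scalars" "t \<in> unit_scalars"
    "scal s * word (w @ winv w) = scal t * 1"
    using pres_sound[OF pres_eq_winv_right[of rels w]] unfolding proj_eq_def by auto
  obtain b d where b: "b \<in> coeff_units" "emb b = to_fract s" and d: "d \<in> coeff_units" "emb d = to_fract t"
    using unit_scalars_coeff_units st by metis
  have d0: "emb d \<noteq> 0" using coeff_units_nz[OF d(1)] by simp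
  have "scal (emb b) * (mat_of u * mat_of v) = scal (emb d)"
    using arg_cong[OF st(3), of to_mat] by (simp only: word_simps(3) to_mat_hom b d u v mult_1_right)
  then have "scal (1 / emb d) * (scal (emb b) * (mat_of u * mat_of v)) = scal (1 / emb d) * scal (emb d)"
    by simp
  then have "scal (emb (b / d)) * (mat_of u * mat_of v) = 1"
    using d0 by (simp add: emb_divide scal_simps(2) flip: mult.assoc scal_simps(4))
  then have "mat_of u * (scal (emb (b / d)) * mat_of v) = 1"
    by (simp only: scal_left_commute[of "mat_of u" "emb (b / d)"])
  moreover have bd: "b / d \<in> coeff_ring" using coeff_units_divide[OF b(1) d(1)] by (simp add: coeff_units_def)
  ultimately have "mat_of u * mat_of (quat_scalar c coeff_ring (b / d) \<otimes>\<^bsub>QO\<^esub> v) = 1"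
    using quat_scalar_QO[OF bd] v by (simp add: mat_of_mult)
  then have "u \<in> Units QO"
    using UnitsQO_I[OF u(1) QO_closed(1)[OF quat_scalar_QO(1)[OF bd] v(1)]] by blast
  moreover have "w \<in> words_of u"
    unfolding words_of_def using u coeff_units_1 by (auto simp: scal_simps intro!: bexI[of _ 1])
  ultimately show ?thesis by blast
qed

lemma Nil_in_words_of_iff:
  assumes "u \<in> Units QO"
  shows "[] \<in> words_of u \<longleftrightarrow> u \<in> quat_scalar c coeff_ring ` coeff_units"
proof -
  have u: "u \<in> carrier QO" using assms by (auto simp: Units_def)
  have "[] \<in> words_of u \<longleftrightarrow> (\<exists>a\<in>coeff_units. mat_of u = mat_of (quat_scalar c coeff_ring a))"
    unfolding words_of_def by (auto simp: to_mat_hom quat_scalar_QO coeff_units_def)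
  also have "\<dots> \<longleftrightarrow> (\<exists>a\<in>coeff_units. u = quat_scalar c coeff_ring a)"
    using mat_of_inj[OF u] quat_scalar_QO(1) unfolding coeff_units_def by blast
  finally show ?thesis by blast
qed

text \<open>The first isomorphism theorem for \<open>words_of\<close>, whose kernel consists of the
  units represented by the empty word, that is, the central units.\<close>

lemma PGL1_order_iso: "PGL1_order c coeff_ring \<cong> presented_group rels"
proof -
  have "group (units_of QO)" by (rule monoid.units_group[OF ring.is_monoid[OF ring_QO]])
  moreover have carrier: "carrier (units_of QO) = Units QO" by (simp add: units_of_carrier)
  have closed: "u \<in> Units QO \<Longrightarrow> u \<in> carrier QO" for u by (auto simp: Units_def)
  have "words_of \<in> hom (units_of QO) (presented_group rels)"
  proof (rule homI)
    fix u assume "u \<in> carrier (units_of QO)"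
    then obtain w where "w \<in> words_of u" using words_of_nonempty carrier by blast
    then show "words_of u \<in> carrier (presented_group rels)"
      unfolding presented_group_carrier using words_of_eq by blast
  next
    fix u v assume uv: "u \<in> carrier (units_of QO)" "v \<in> carrier (units_of QO)"
    then obtain w w' where w: "w \<in> words_of u" "w' \<in> words_of v"
      using words_of_nonempty carrier by blast
    have "w @ w' \<in> words_of (u \<otimes>\<^bsub>QO\<^esub> v)"
      using words_of_mult w uv closed carrier by blast
    then show "words_of (u \<otimes>\<^bsub>units_of QO\<^esub> v)
        = words_of u \<otimes>\<^bsub>presented_group rels\<^esub> words_of v"
      unfolding units_of_mult words_of_eq[OF w(1)] words_of_eq[OF w(2)] presented_group_mult
      by (rule words_of_eq)
  qed
  ultimately interpret \<psi>: group_hom "units_of QO" "presented_group rels" words_of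
    by (intro group_hom.intro group_hom_axioms.intro group_presented_group)
  have "kernel (units_of QO) (presented_group rels) words_of
      = {u \<in> Units QO. words_of u = pres_rel_set rels `` {[]}}"
    by (simp add: kernel_def carrier presented_group_one)
  also have "\<dots> = {u \<in> Units QO. [] \<in> words_of u}"
    using words_of_eq by (auto simp: pres_rel_set_def pres_refl)
  also have "\<dots> = quat_scalar c coeff_ring ` coeff_units"
    using Nil_in_words_of_iff quat_scalar_Units by blast
  finally have kernel: "kernel (units_of QO) (presented_group rels) words_of
      = quat_scalar c coeff_ring ` coeff_units" .
  have "words_of ` carrier (units_of QO) = carrier (presented_group rels)"
  proof
    show "words_of ` carrier (units_of QO) \<subseteq> carrier (presented_group rels)"
      using \<psi>.hom_closed by blast
    show "carrier (presented_group rels) \<subseteq> words_of ` carrier (units_of QO)"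
    proof
      fix C assume "C \<in> carrier (presented_group rels)"
      then obtain w where w: "C = pres_rel_set rels `` {w}" by (auto simp: presented_group_carrier)
      obtain u where "u \<in> Units QO" "w \<in> words_of u" using exists_unit_with_word by blast
      then show "C \<in> words_of ` carrier (units_of QO)"
        unfolding w carrier using words_of_eq by blast
    qed
  qed
  from \<psi>.FactGroup_iso[OF this] show ?thesis
    unfolding PGL1_order_def Units_coeff_ring kernel .
qed

end

theorem theoremA:
  fixes q :: nat
    and c \<tau> :: "'a::{field,finite}"
    and \<delta> \<zeta> :: "'b::{field,finite}"
    and \<iota> :: "'a \<Rightarrow> 'b"
  assumes "odd q" and "CARD('a) = q" and "CARD('b) = q ^ 2"
    and "\<iota> \<in> ring_hom ring_of_type_algebra ring_of_type_algebra"
    and "c \<noteq> 0" and "\<not> (\<exists>x. c = x ^ 2)"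
    and "range (\<lambda>n::int. \<delta> powi n) = UNIV - {0}"
    and "\<tau> \<noteq> 0" and "\<tau> \<noteq> 1"
    and "\<zeta> \<noteq> 0" and "\<zeta> ^ (1 + q) = \<iota> ((\<tau> - 1) / \<tau>)"
  shows "PGL1_order c (poly_inverting ([:0, 1:] * [:-\<tau>, 1:])) \<cong>
         presented_group (lattice_rels \<iota> q \<delta> \<zeta>)"
proof -
  interpret quaternion_lattice q c \<tau> \<delta> \<zeta> \<iota>
    by unfold_locales (use assms in auto)
  show ?thesis using PGL1_order_iso unfolding coeff_ring_def .
qed

end
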